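(* Let $M^n$ be a smooth manifold of dimension $n$ and let $g$, $\bar g$ be $C^2$-smooth Riemannian metrics on $M^n$. Let $I_0,I_1,\dots,I_{n-1}:T^*M^n\to\mathbb{R}$ be the functions constructed from the pair $(g,\bar g)$ as in the context. Suppose that $I_0,\dots,I_{n-1}$ are functionally independent almost everywhere (i.e. their differentials are linearly independent at almost every point of $T^*M^n$) and that they pairwise commute with respect to the Poisson bracket of the standard symplectic form on $T^*M^n$. Then the metrics $g$ and $\bar g$ are geodesically equivalent.
   Context: Two metrics $g,\bar g$ on the same manifold are geodesically equivalent if they have the same geodesics, considered as unparameterized curves. Let $G:TM^n\to TM^n$ be the fiberwise-linear mapping given by $G^i_j=g^{i\alpha}\bar g_{\alpha j}$, i.e. $g(G(\xi),\nu)=\bar g(\xi,\nu)$ for all $\xi,\nu\in T_xM^n$. Write $\det(G-\mu E)=c_0\mu^n+c_1\mu^{n-1}+\dots+c_n$, where $E$ is the identity; the coefficients $c_i$ are functions on $M^n$, and $c_0\equiv(-1)^n$. For $k=0,\dots,n-1$ define the fiberwise-linear mappings $S_k:TM^n\to TM^n$ by $$S_k=\left(\frac{\det(g)}{\det(\bar g)}\right)^{\frac{k+2}{n+1}}\sum_{i=0}^k c_i\,G^{k-i+1},$$ and define the functions $I_k:T^*M^n\to\mathbb{R}$ by $I_k(x,p)=g^{\alpha i}(S_k)^j_\alpha p_ip_j$ (summation over repeated indices). Equivalently, after identifying $T^*M^n$ with $TM^n$ by means of $g$, $I_k(x,\xi)=g(S_k(\xi),\xi)$. *)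

theory Defs
  imports "HOL-Analysis.Analysis" "HOL-Computational_Algebra.Polynomial"
begin

section \<open>Functions of class \<open>C\<^sup>k\<close> on open subsets of normed spaces\<close>

text \<open>For open \<open>S\<close> and finite-dimensional \<open>'a\<close> this is the usual notion of a \<open>C\<^sup>k\<close> map: all
  iterated directional derivatives up to order \<open>k\<close> exist and are continuous.\<close>

primrec higher_differentiable_on ::
  "nat \<Rightarrow> 'a::real_normed_vector set \<Rightarrow> ('a \<Rightarrow> 'b::real_normed_vector) \<Rightarrow> bool" where
  "higher_differentiable_on 0 S f \<longleftrightarrow> continuous_on S f"
| "higher_differentiable_on (Suc k) S f \<longleftrightarrow>
     (\<forall>x\<in>S. f differentiable (at x)) \<and>
     (\<forall>v. higher_differentiable_on k S (\<lambda>x. frechet_derivative f (at x) v))"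

definition smooth_on :: "'a::real_normed_vector set \<Rightarrow> ('a \<Rightarrow> 'b::real_normed_vector) \<Rightarrow> bool" where
  "smooth_on S f \<longleftrightarrow> (\<forall>k. higher_differentiable_on k S f)"


section \<open>Smooth manifolds\<close>

text \<open>A chart is a pair of a domain \<open>U\<close> and a map \<open>\<phi>\<close>, of which only the values on \<open>U\<close> matter.
  The manifold is the whole type \<open>'m\<close>, with its Hausdorff and second countable topology.
  Since all notions below quantify over all charts of an atlas and are compatible with smooth changes of
  coordinates, the atlas need not be maximal.\<close>

type_synonym ('m, 'e) chart = "'m set \<times> ('m \<Rightarrow> 'e)"

abbreviation inv_chart :: "('m, 'e) chart \<Rightarrow> 'e \<Rightarrow> 'm" where
  "inv_chart c \<equiv> inv_into (fst c) (snd c)"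

definition is_chart :: "('m::topological_space, 'e::euclidean_space) chart \<Rightarrow> bool" where
  "is_chart c \<longleftrightarrow> open (fst c) \<and> open (snd c ` fst c) \<and>
     homeomorphism (fst c) (snd c ` fst c) (snd c) (inv_chart c)"

definition smooth_atlas ::
  "('m::{t2_space,second_countable_topology}, 'e::euclidean_space) chart set \<Rightarrow> bool" where
  "smooth_atlas A \<longleftrightarrow>
     (\<forall>c\<in>A. is_chart c) \<and> (\<Union>c\<in>A. fst c) = UNIV \<and>
     (\<forall>c\<in>A. \<forall>d\<in>A. smooth_on (snd c ` (fst c \<inter> fst d)) (snd d \<circ> inv_chart c))"


section \<open>Tangent and cotangent spaces\<close>

text \<open>A tangent vector at \<open>x\<close> is given by its components in all charts of the atlas around \<open>x\<close>, related
  by the contravariant transformation law.  It is set to \<open>0\<close> on the irrelevant charts, so that equality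
  of tangent vectors is equality of functions.\<close>

type_synonym ('m, 'n) tvec = "('m, real^'n) chart \<Rightarrow> real^'n"

definition trans_deriv ::
  "('m, real^'n) chart \<Rightarrow> ('m, real^'n) chart \<Rightarrow> 'm \<Rightarrow> real^'n \<Rightarrow> real^'n" where
  "trans_deriv c d x = frechet_derivative (snd d \<circ> inv_chart c) (at (snd c x))"

definition tangent_space :: "('m, real^'n) chart set \<Rightarrow> 'm \<Rightarrow> ('m, 'n) tvec set" where
  "tangent_space A x = {v.
     (\<forall>c\<in>A. \<forall>d\<in>A. x \<in> fst c \<longrightarrow> x \<in> fst d \<longrightarrow> v d = trans_deriv c d x (v c)) \<and>
     (\<forall>c. \<not> (c \<in> A \<and> x \<in> fst c) \<longrightarrow> v c = 0)}"

text \<open>The coordinate vector \<open>\<partial>/\<partial>x\<^sup>i\<close> of the chart \<open>c\<close> at the point \<open>x\<close>.\<close>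

definition coord_vec ::
  "('m, real^'n) chart set \<Rightarrow> ('m, real^'n) chart \<Rightarrow> 'm \<Rightarrow> 'n \<Rightarrow> ('m, 'n) tvec" where
  "coord_vec A c x i =
     (\<lambda>d. if d \<in> A \<and> x \<in> fst d then trans_deriv c d x (axis i 1) else 0)"

definition linear_on_tangent ::
  "('m, real^'n) chart set \<Rightarrow> 'm \<Rightarrow> (('m, 'n) tvec \<Rightarrow> real) \<Rightarrow> bool" where
  "linear_on_tangent A x f \<longleftrightarrow>
     (\<forall>u\<in>tangent_space A x. \<forall>v\<in>tangent_space A x. \<forall>a b.
        f (\<lambda>c. a *\<^sub>R u c + b *\<^sub>R v c) = a * f u + b * f v)"

text \<open>Covectors are linear functionals on the tangent space, extended by \<open>0\<close> outside of it.\<close>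

definition cotangent_space ::
  "('m, real^'n) chart set \<Rightarrow> 'm \<Rightarrow> (('m, 'n) tvec \<Rightarrow> real) set" where
  "cotangent_space A x = {p. linear_on_tangent A x p \<and> (\<forall>v. v \<notin> tangent_space A x \<longrightarrow> p v = 0)}"

type_synonym ('m, 'n) cotangent = "'m \<times> (('m, 'n) tvec \<Rightarrow> real)"

definition cotangent_bundle :: "('m, real^'n) chart set \<Rightarrow> ('m, 'n) cotangent set" where
  "cotangent_bundle A = (SIGMA x:UNIV. cotangent_space A x)"

definition covector_comp ::
  "('m, real^'n) chart set \<Rightarrow> ('m, real^'n) chart \<Rightarrow> ('m, 'n) cotangent \<Rightarrow> real^'n" where
  "covector_comp A c z = (\<chi> i. snd z (coord_vec A c (fst z) i))"

text \<open>The canonical chart \<open>(x, p) \<mapsto> (q\<^sup>1, \<dots>, q\<^sup>n, p\<^sub>1, \<dots>, p\<^sub>n)\<close> of the cotangent bundle.\<close>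

definition cotangent_chart ::
  "('m, real^'n) chart set \<Rightarrow> ('m, real^'n) chart \<Rightarrow> (('m, 'n) cotangent, (real^'n) \<times> (real^'n)) chart"
where
  "cotangent_chart A c =
     ({z \<in> cotangent_bundle A. fst z \<in> fst c}, \<lambda>z. (snd c (fst z), covector_comp A c z))"


section \<open>Riemannian metrics\<close>

type_synonym ('m, 'n) metric = "'m \<Rightarrow> ('m, 'n) tvec \<Rightarrow> ('m, 'n) tvec \<Rightarrow> real"

definition metric_comp ::
  "('m, real^'n) chart set \<Rightarrow> ('m, 'n) metric \<Rightarrow> ('m, real^'n) chart \<Rightarrow> 'm \<Rightarrow> real^'n^'n" where
  "metric_comp A g c x = (\<chi> i j. g x (coord_vec A c x i) (coord_vec A c x j))"

definition riemannian_metric ::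
  "nat \<Rightarrow> ('m, real^'n) chart set \<Rightarrow> ('m, 'n) metric \<Rightarrow> bool" where
  "riemannian_metric k A g \<longleftrightarrow>
     (\<forall>x. \<forall>u\<in>tangent_space A x. linear_on_tangent A x (g x u)) \<and>
     (\<forall>x. \<forall>u\<in>tangent_space A x. \<forall>v\<in>tangent_space A x. g x u v = g x v u) \<and>
     (\<forall>x. \<forall>u\<in>tangent_space A x. u \<noteq> (\<lambda>_. 0) \<longrightarrow> g x u u > 0) \<and>
     (\<forall>c\<in>A. \<forall>i j. higher_differentiable_on k (snd c ` fst c)
        (\<lambda>q. metric_comp A g c (inv_chart c q) $ i $ j))"


section \<open>Geodesics and geodesic equivalence\<close>

definition metric_partial ::
  "('m, real^'n) chart set \<Rightarrow> ('m, 'n) metric \<Rightarrow> ('m, real^'n) chart \<Rightarrow> 'm \<Rightarrow> 'n \<Rightarrow> 'n \<Rightarrow> 'n \<Rightarrow> real"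
where
  "metric_partial A g c x l i j =
     frechet_derivative (\<lambda>q. metric_comp A g c (inv_chart c q) $ i $ j) (at (snd c x)) (axis l 1)"

definition christoffel ::
  "('m, real^'n) chart set \<Rightarrow> ('m, 'n) metric \<Rightarrow> ('m, real^'n) chart \<Rightarrow> 'm \<Rightarrow> 'n \<Rightarrow> 'n \<Rightarrow> 'n \<Rightarrow> real"
where
  "christoffel A g c x k i j =
     (1/2) * (\<Sum>l\<in>UNIV. matrix_inv (metric_comp A g c x) $ k $ l *
        (metric_partial A g c x i j l + metric_partial A g c x j i l - metric_partial A g c x l i j))"

text \<open>Affinely parametrized geodesics, defined on an interval \<open>I\<close>.\<close>

definition geodesic ::
  "('m::topological_space, real^'n) chart set \<Rightarrow> ('m, 'n) metric \<Rightarrow> real set \<Rightarrow> (real \<Rightarrow> 'm) \<Rightarrow> bool"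
where
  "geodesic A g I \<gamma> \<longleftrightarrow> continuous_on I \<gamma> \<and>
     (\<forall>c\<in>A. \<exists>v. \<forall>t\<in>I. \<gamma> t \<in> fst c \<longrightarrow>
        ((\<lambda>s. snd c (\<gamma> s)) has_vector_derivative v t) (at t) \<and>
        (v has_vector_derivative
           (\<chi> k. - (\<Sum>i\<in>UNIV. \<Sum>j\<in>UNIV. christoffel A g c (\<gamma> t) k i j * v t $ i * v t $ j))) (at t))"

definition open_interval :: "real set \<Rightarrow> bool" where
  "open_interval I \<longleftrightarrow> open I \<and> is_interval I \<and> I \<noteq> {}"

text \<open>Two parametrized curves define the same unparametrized curve if they differ by a
  \<open>C\<^sup>2\<close> change of parameter with \<open>C\<^sup>2\<close> inverse.\<close>

definition same_unparametrized ::
  "real set \<Rightarrow> (real \<Rightarrow> 'm) \<Rightarrow> real set \<Rightarrow> (real \<Rightarrow> 'm) \<Rightarrow> bool" where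
  "same_unparametrized I \<gamma> J \<delta> \<longleftrightarrow>
     (\<exists>\<tau>. bij_betw \<tau> J I \<and> higher_differentiable_on 2 J \<tau> \<and>
        higher_differentiable_on 2 I (inv_into J \<tau>) \<and> (\<forall>t\<in>J. \<delta> t = \<gamma> (\<tau> t)))"

definition geodesically_equivalent ::
  "('m::topological_space, real^'n) chart set \<Rightarrow> ('m, 'n) metric \<Rightarrow> ('m, 'n) metric \<Rightarrow> bool" where
  "geodesically_equivalent A g h \<longleftrightarrow>
     (\<forall>I \<gamma>. open_interval I \<longrightarrow>
        (geodesic A g I \<gamma> \<longrightarrow>
          (\<exists>J \<delta>. open_interval J \<and> geodesic A h J \<delta> \<and> same_unparametrized I \<gamma> J \<delta>)) \<and>
        (geodesic A h I \<gamma> \<longrightarrow>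
          (\<exists>J \<delta>. open_interval J \<and> geodesic A g J \<delta> \<and> same_unparametrized I \<gamma> J \<delta>)))"


section \<open>Functions on the cotangent bundle\<close>

definition local_rep :: "('m, 'e) chart \<Rightarrow> ('m \<Rightarrow> 'b) \<Rightarrow> 'e \<Rightarrow> 'b" where
  "local_rep c F = F \<circ> inv_chart c"

definition independent_differentials_at ::
  "('m, real^'n) chart set \<Rightarrow> nat \<Rightarrow> (nat \<Rightarrow> ('m, 'n) cotangent \<Rightarrow> real) \<Rightarrow> ('m, 'n) cotangent \<Rightarrow> bool"
where
  "independent_differentials_at A n F z \<longleftrightarrow>
     (\<forall>c\<in>A. fst z \<in> fst c \<longrightarrow>
        (let \<kappa> = cotangent_chart A c;
             dF = (\<lambda>k. frechet_derivative (local_rep \<kappa> (F k)) (at (snd \<kappa> z)))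
         in \<forall>a :: nat \<Rightarrow> real. (\<forall>w. (\<Sum>k<n. a k * dF k w) = 0) \<longrightarrow> (\<forall>k<n. a k = 0)))"

definition cotangent_null :: "('m, real^'n) chart set \<Rightarrow> ('m, 'n) cotangent set \<Rightarrow> bool" where
  "cotangent_null A N \<longleftrightarrow>
     (\<forall>c\<in>A. negligible (snd (cotangent_chart A c) ` (N \<inter> fst (cotangent_chart A c))))"

definition functionally_independent_ae ::
  "('m, real^'n) chart set \<Rightarrow> nat \<Rightarrow> (nat \<Rightarrow> ('m, 'n) cotangent \<Rightarrow> real) \<Rightarrow> bool" where
  "functionally_independent_ae A n F \<longleftrightarrow>
     cotangent_null A {z \<in> cotangent_bundle A. \<not> independent_differentials_at A n F z}"

text \<open>The standard symplectic form \<open>dp\<^sub>1 \<and> dq\<^sup>1 + \<dots> + dp\<^sub>n \<and> dq\<^sup>n\<close> in canonical coordinates.\<close>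

definition standard_symplectic ::
  "(real^'n) \<times> (real^'n) \<Rightarrow> (real^'n) \<times> (real^'n) \<Rightarrow> real" where
  "standard_symplectic v w = snd v \<bullet> fst w - snd w \<bullet> fst v"

definition hamiltonian_vector ::
  "((real^'n) \<times> (real^'n) \<Rightarrow> real) \<Rightarrow> (real^'n) \<times> (real^'n) \<Rightarrow> (real^'n) \<times> (real^'n)" where
  "hamiltonian_vector f \<zeta> =
     (THE X. \<forall>w. standard_symplectic X w = frechet_derivative f (at \<zeta>) w)"

definition poisson_bracket ::
  "(('m, 'n) cotangent, (real^'n) \<times> (real^'n)) chart \<Rightarrow> (('m, 'n) cotangent \<Rightarrow> real) \<Rightarrow>
   (('m, 'n) cotangent \<Rightarrow> real) \<Rightarrow> ('m, 'n) cotangent \<Rightarrow> real" where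
  "poisson_bracket \<kappa> F H z =
     standard_symplectic (hamiltonian_vector (local_rep \<kappa> F) (snd \<kappa> z))
       (hamiltonian_vector (local_rep \<kappa> H) (snd \<kappa> z))"

definition poisson_commute ::
  "('m, real^'n) chart set \<Rightarrow> (('m, 'n) cotangent \<Rightarrow> real) \<Rightarrow> (('m, 'n) cotangent \<Rightarrow> real) \<Rightarrow> bool"
where
  "poisson_commute A F H \<longleftrightarrow>
     (\<forall>c\<in>A. \<forall>z\<in>fst (cotangent_chart A c). poisson_bracket (cotangent_chart A c) F H z = 0)"


section \<open>The functions constructed from a pair of metrics\<close>

text \<open>Powers with respect to the matrix product; note that \<open>^\<close> on \<open>real^'n^'n\<close> is componentwise.\<close>

definition matpow :: "real^'n^'n \<Rightarrow> nat \<Rightarrow> real^'n^'n" where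
  "matpow M k = ((\<lambda>B. M ** B) ^^ k) (mat 1)"

text \<open>The coefficient \<open>c\<^sub>i\<close> of \<open>\<mu>\<^bsup>n-i\<^esup>\<close> in \<open>det (M - \<mu> E)\<close>.\<close>

definition char_coeff :: "real^'n^'n \<Rightarrow> nat \<Rightarrow> real" where
  "char_coeff M i = coeff (det ((\<chi> a b. [:M $ a $ b:]) - mat [:0, 1:])) (CARD('n) - i)"

text \<open>Components of \<open>G\<close> and \<open>S\<^sub>k\<close> for matrices \<open>g\<close>, \<open>h\<close> of two metrics in a chart; the upper index is
  the row.\<close>

definition G_mat :: "real^'n^'n \<Rightarrow> real^'n^'n \<Rightarrow> real^'n^'n" where
  "G_mat g h = matrix_inv g ** h"

definition S_mat :: "real^'n^'n \<Rightarrow> real^'n^'n \<Rightarrow> nat \<Rightarrow> real^'n^'n" where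
  "S_mat g h k =
     ((det g / det h) powr (real (k + 2) / real (CARD('n) + 1))) *\<^sub>R
     (\<Sum>i\<le>k. char_coeff (G_mat g h) i *\<^sub>R matpow (G_mat g h) (k - i + 1))"

definition I_coord :: "real^'n^'n \<Rightarrow> real^'n^'n \<Rightarrow> nat \<Rightarrow> real^'n \<Rightarrow> real" where
  "I_coord g h k p =
     (\<Sum>\<alpha>\<in>UNIV. \<Sum>i\<in>UNIV. \<Sum>j\<in>UNIV. matrix_inv g $ \<alpha> $ i * S_mat g h k $ j $ \<alpha> * p $ i * p $ j)"

text \<open>The value of \<open>I\<^sub>k\<close> does not depend on the chart used to compute it, see
  \<open>integral_I_eq\<close> below.\<close>

definition integral_I ::
  "('m, real^'n) chart set \<Rightarrow> ('m, 'n) metric \<Rightarrow> ('m, 'n) metric \<Rightarrow> nat \<Rightarrow> ('m, 'n) cotangent \<Rightarrow> real"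
where
  "integral_I A g h k z =
     (let c = (SOME c. c \<in> A \<and> fst z \<in> fst c)
      in I_coord (metric_comp A g c (fst z)) (metric_comp A h c (fst z)) k (covector_comp A c z))"


section \<open>Independence of the choice of chart\<close>

lemma trans_differentiable:
  fixes A :: "('m::{t2_space,second_countable_topology}, real^'n) chart set"
  assumes "smooth_atlas A" "c \<in> A" "d \<in> A" "x \<in> fst c" "x \<in> fst d"
  shows "((snd d \<circ> inv_chart c) has_derivative trans_deriv c d x) (at (snd c x))"
proof -
  have "higher_differentiable_on (Suc 0) (snd c ` (fst c \<inter> fst d)) (snd d \<circ> inv_chart c)"
    using assms unfolding smooth_atlas_def smooth_on_def by blast
  hence "(snd d \<circ> inv_chart c) differentiable (at (snd c x))"
    using assms by simp
  thus ?thesis unfolding trans_deriv_def using frechet_derivative_works by blast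
qed

lemma chart_image_open:
  assumes "is_chart c" "open W" "W \<subseteq> fst c"
  shows "open (snd c ` W)"
proof -
  have "openin (top_of_set (snd c ` fst c)) (snd c ` W)"
    by (rule homeomorphism_imp_open_map[where S="fst c" and g="inv_chart c"])
      (use assms in \<open>auto simp: is_chart_def openin_open\<close>)
  thus ?thesis using assms by (simp add: is_chart_def openin_open_eq)
qed

lemma inv_chart_apply:
  assumes "is_chart c" "x \<in> fst c"
  shows "inv_chart c (snd c x) = x"
  using assms unfolding is_chart_def homeomorphism_def by auto

lemma trans_deriv_cocycle:
  fixes A :: "('m::{t2_space,second_countable_topology}, real^'n) chart set"
  assumes A: "smooth_atlas A" and c: "c \<in> A" "x \<in> fst c" and d: "d \<in> A" "x \<in> fst d"
    and e: "e \<in> A" "x \<in> fst e"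
  shows "trans_deriv d e x (trans_deriv c d x v) = trans_deriv c e x v"
proof -
  have ch: "is_chart c" "is_chart d" "is_chart e" using assms by (auto simp: smooth_atlas_def)
  let ?W = "fst c \<inter> fst d \<inter> fst e"
  have W: "open ?W" "x \<in> ?W" using ch c d e by (auto simp: is_chart_def)
  have oW: "open (snd c ` ?W)" by (rule chart_image_open) (use ch W in auto)
  have D: "((snd e \<circ> inv_chart d) \<circ> (snd d \<circ> inv_chart c) has_derivative
          trans_deriv d e x \<circ> trans_deriv c d x) (at (snd c x))"
    apply (rule diff_chain_at)
     apply (rule trans_differentiable[OF A c(1) d(1) c(2) d(2)])
    using trans_differentiable[OF A d(1) e(1) d(2) e(2)] inv_chart_apply[OF ch(1) c(2)] by simp
  have "((snd e \<circ> inv_chart c) has_derivative trans_deriv d e x \<circ> trans_deriv c d x) (at (snd c x))"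
    by (rule has_derivative_transform_within_open[OF D oW])
      (use W ch in \<open>auto simp: inv_chart_apply\<close>)
  from has_derivative_unique[OF this trans_differentiable[OF A c(1) e(1) c(2) e(2)]]
  show ?thesis by (metis comp_apply)
qed

lemma trans_deriv_id:
  fixes A :: "('m::{t2_space,second_countable_topology}, real^'n) chart set"
  assumes A: "smooth_atlas A" and c: "c \<in> A" "x \<in> fst c"
  shows "trans_deriv c c x v = v"
proof -
  have ch: "is_chart c" using assms by (auto simp: smooth_atlas_def)
  have "((snd c \<circ> inv_chart c) has_derivative id) (at (snd c x))"
    by (rule has_derivative_transform_within_open[where s="snd c ` fst c" and f=id])
      (use ch c in \<open>auto simp: inv_chart_apply is_chart_def has_derivative_id id_def\<close>)
  from has_derivative_unique[OF this trans_differentiable[OF A c(1) c(1) c(2) c(2)]]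
  show ?thesis by (metis id_apply)
qed

lemma trans_deriv_linear:
  fixes A :: "('m::{t2_space,second_countable_topology}, real^'n) chart set"
  assumes "smooth_atlas A" "c \<in> A" "d \<in> A" "x \<in> fst c" "x \<in> fst d"
  shows "linear (trans_deriv c d x)"
  using trans_differentiable[OF assms] has_derivative_linear by blast

lemma coord_vec_tangent:
  fixes A :: "('m::{t2_space,second_countable_topology}, real^'n) chart set"
  assumes "smooth_atlas A" "c \<in> A" "x \<in> fst c"
  shows "coord_vec A c x i \<in> tangent_space A x"
  using assms by (auto simp: tangent_space_def coord_vec_def trans_deriv_cocycle)

lemma zero_tangent:
  fixes A :: "('m::{t2_space,second_countable_topology}, real^'n) chart set"
  assumes "smooth_atlas A"
  shows "(\<lambda>_. 0) \<in> tangent_space A x"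
  using assms by (auto simp: tangent_space_def trans_deriv_linear linear_0)

lemma tangent_lincomb:
  fixes A :: "('m::{t2_space,second_countable_topology}, real^'n) chart set"
  assumes "smooth_atlas A" "u \<in> tangent_space A x" "v \<in> tangent_space A x"
  shows "(\<lambda>c. a *\<^sub>R u c + b *\<^sub>R v c) \<in> tangent_space A x"
proof -
  have "a *\<^sub>R u d + b *\<^sub>R v d = trans_deriv c d x (a *\<^sub>R u c + b *\<^sub>R v c)"
    if "c \<in> A" "d \<in> A" "x \<in> fst c" "x \<in> fst d" for c d
  proof -
    have "u d = trans_deriv c d x (u c)" "v d = trans_deriv c d x (v c)"
      using assms that unfolding tangent_space_def by blast+
    thus ?thesis
      using trans_deriv_linear[OF assms(1) that] by (simp only: linear_add linear_scale)
  qed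
  moreover have "a *\<^sub>R u c + b *\<^sub>R v c = 0" if "\<not> (c \<in> A \<and> x \<in> fst c)" for c
  proof -
    have "u c = 0" "v c = 0" using assms that unfolding tangent_space_def by blast+
    thus ?thesis by simp
  qed
  ultimately show ?thesis unfolding tangent_space_def by blast
qed

lemma linear_on_tangent_sum:
  fixes A :: "('m::{t2_space,second_countable_topology}, real^'n) chart set"
  assumes A: "smooth_atlas A" and f: "linear_on_tangent A x f" and "finite I"
    and w: "\<And>i. i \<in> I \<Longrightarrow> w i \<in> tangent_space A x"
  shows "(\<lambda>c. \<Sum>i\<in>I. a i *\<^sub>R w i c) \<in> tangent_space A x \<and>
         f (\<lambda>c. \<Sum>i\<in>I. a i *\<^sub>R w i c) = (\<Sum>i\<in>I. a i * f (w i))"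
  using \<open>finite I\<close> w
proof (induction I)
  case empty
  have "f (\<lambda>c. 0 *\<^sub>R 0 + 0 *\<^sub>R 0) = 0 * f (\<lambda>_. 0) + 0 * f (\<lambda>_. 0)"
    using f[unfolded linear_on_tangent_def, rule_format, OF zero_tangent[OF A] zero_tangent[OF A], of 0 0] .
  thus ?case using zero_tangent[OF A, of x] by simp
next
  case (insert i I)
  let ?s = "\<lambda>c. \<Sum>i\<in>I. a i *\<^sub>R w i c"
  have s: "?s \<in> tangent_space A x" "f ?s = (\<Sum>i\<in>I. a i * f (w i))" and i: "w i \<in> tangent_space A x"
    using insert by auto
  have "f (\<lambda>c. a i *\<^sub>R w i c + 1 *\<^sub>R ?s c) = a i * f (w i) + 1 * f ?s"
    using f[unfolded linear_on_tangent_def, rule_format, OF i s(1), of "a i" 1] .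
  thus ?case using tangent_lincomb[OF A i s(1), of "a i" 1] insert(1,2) s(2) by simp
qed

lemma linear_on_tangent_coord:
  fixes A :: "('m::{t2_space,second_countable_topology}, real^'n) chart set"
  assumes A: "smooth_atlas A" and f: "linear_on_tangent A x f" and c: "c \<in> A" "x \<in> fst c"
    and v: "v \<in> tangent_space A x"
  shows "f v = (\<Sum>i\<in>UNIV. v c $ i * f (coord_vec A c x i))"
proof -
  have "v = (\<lambda>d. \<Sum>i\<in>UNIV. (v c $ i) *\<^sub>R coord_vec A c x i d)"
  proof
    fix d
    show "v d = (\<Sum>i\<in>UNIV. (v c $ i) *\<^sub>R coord_vec A c x i d)"
    proof (cases "d \<in> A \<and> x \<in> fst d")
      case True
      then interpret linear "trans_deriv c d x" using trans_deriv_linear[OF A c(1) _ c(2)] by blast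
      have "v d = trans_deriv c d x (v c)" using v True c unfolding tangent_space_def by blast
      also have "\<dots> = trans_deriv c d x (\<Sum>i\<in>UNIV. (v c $ i) *\<^sub>R axis i 1)"
        using basis_expansion[of "v c"] by (simp add: scalar_mult_eq_scaleR)
      finally show ?thesis using True by (simp add: sum scale coord_vec_def)
    next
      case False
      hence "v d = 0" using v unfolding tangent_space_def by blast
      with False show ?thesis by (auto simp: coord_vec_def)
    qed
  qed
  thus ?thesis
    using linear_on_tangent_sum[OF A f, of UNIV "\<lambda>i. coord_vec A c x i" "\<lambda>i. v c $ i"]
      coord_vec_tangent[OF A c] by simp
qed

definition jacobian_matrix ::
  "('m, real^'n) chart \<Rightarrow> ('m, real^'n) chart \<Rightarrow> 'm \<Rightarrow> real^'n^'n" where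
  "jacobian_matrix c d x = matrix (trans_deriv c d x)"

lemma jacobian_inverse:
  fixes A :: "('m::{t2_space,second_countable_topology}, real^'n) chart set"
  assumes A: "smooth_atlas A" and c: "c \<in> A" "x \<in> fst c" and d: "d \<in> A" "x \<in> fst d"
  shows "jacobian_matrix c d x ** jacobian_matrix d c x = mat 1"
proof -
  have "trans_deriv c d x \<circ> trans_deriv d c x = id"
    using trans_deriv_cocycle[OF A d c d] trans_deriv_id[OF A d] by auto
  thus ?thesis unfolding jacobian_matrix_def
    by (metis A c d matrix_compose matrix_id_mat_1 trans_deriv_linear)
qed

lemma coord_vec_expand:
  fixes A :: "('m::{t2_space,second_countable_topology}, real^'n) chart set"
  assumes A: "smooth_atlas A" and f: "linear_on_tangent A x f" and c: "c \<in> A" "x \<in> fst c"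
    and d: "d \<in> A" "x \<in> fst d"
  shows "f (coord_vec A c x i) = (\<Sum>j\<in>UNIV. jacobian_matrix c d x $ j $ i * f (coord_vec A d x j))"
  using linear_on_tangent_coord[OF A f d coord_vec_tangent[OF A c, of i]] d
  by (simp add: coord_vec_def jacobian_matrix_def matrix_def)

lemma covector_comp_change:
  fixes A :: "('m::{t2_space,second_countable_topology}, real^'n) chart set"
  assumes A: "smooth_atlas A" and z: "z \<in> cotangent_bundle A" and c: "c \<in> A" "fst z \<in> fst c"
    and d: "d \<in> A" "fst z \<in> fst d"
  shows "covector_comp A c z = transpose (jacobian_matrix c d (fst z)) *v covector_comp A d z"
proof -
  have f: "linear_on_tangent A (fst z) (snd z)"
    using z by (auto simp: cotangent_bundle_def cotangent_space_def)
  show ?thesis using coord_vec_expand[OF A f c d]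
    by (simp add: covector_comp_def vec_eq_iff matrix_vector_mult_def transpose_def)
qed

lemma metric_comp_change:
  fixes A :: "('m::{t2_space,second_countable_topology}, real^'n) chart set"
  assumes A: "smooth_atlas A" and g: "riemannian_metric k A g" and c: "c \<in> A" "x \<in> fst c"
    and d: "d \<in> A" "x \<in> fst d"
  shows "metric_comp A g c x =
    transpose (jacobian_matrix c d x) ** metric_comp A g d x ** jacobian_matrix c d x"
proof -
  let ?J = "jacobian_matrix c d x"
  note t = coord_vec_tangent[OF A c] coord_vec_tangent[OF A d]
  have lin: "linear_on_tangent A x (g x u)" if "u \<in> tangent_space A x" for u
    using g that unfolding riemannian_metric_def by auto
  have sym: "g x u v = g x v u" if "u \<in> tangent_space A x" "v \<in> tangent_space A x" for u v
    using g that unfolding riemannian_metric_def by auto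
  have "g x (coord_vec A c x i) (coord_vec A c x j) =
    (\<Sum>l\<in>UNIV. ?J $ l $ j * (\<Sum>m\<in>UNIV. ?J $ m $ i * g x (coord_vec A d x m) (coord_vec A d x l)))" for i j
  proof -
    have "g x (coord_vec A c x i) (coord_vec A c x j) =
        (\<Sum>l\<in>UNIV. ?J $ l $ j * g x (coord_vec A d x l) (coord_vec A c x i))"
      by (subst coord_vec_expand[OF A lin c d]) (use t sym in auto)
    also have "\<dots> = (\<Sum>l\<in>UNIV. ?J $ l $ j *
        (\<Sum>m\<in>UNIV. ?J $ m $ i * g x (coord_vec A d x l) (coord_vec A d x m)))"
      by (rule sum.cong[OF refl], subst coord_vec_expand[OF A lin c d]) (use t in auto)
    finally show ?thesis using sym[OF t(2) t(2)] by simp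
  qed
  thus ?thesis
    by (simp add: metric_comp_def vec_eq_iff matrix_matrix_mult_def transpose_def mult_ac)
qed

lemma matrix_inv_mult:
  fixes M :: "real^'n^'n"
  assumes "invertible M"
  shows "M ** matrix_inv M = mat 1" "matrix_inv M ** M = mat 1"
  using someI_ex[of "\<lambda>N. M ** N = mat 1 \<and> N ** M = mat 1"] assms
  unfolding invertible_def matrix_inv_def by blast+

lemma matrix_inv_unique:
  fixes M :: "real^'n^'n"
  assumes "M ** N = mat 1"
  shows "matrix_inv M = N"
proof -
  have "invertible M" using assms invertible_right_inverse by blast
  hence "matrix_inv M ** M = mat 1" by (rule matrix_inv_mult)
  thus ?thesis using assms by (metis matrix_mul_assoc matrix_mul_lid matrix_mul_rid)
qed

lemma metric_comp_invertible:
  fixes A :: "('m::{t2_space,second_countable_topology}, real^'n) chart set"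
  assumes A: "smooth_atlas A" and g: "riemannian_metric k A g" and c: "c \<in> A" "x \<in> fst c"
  shows "invertible (metric_comp A g c x)"
proof -
  have "w = 0" if w: "metric_comp A g c x *v w = 0" for w
  proof (rule ccontr)
    assume "w \<noteq> 0"
    define v where "v = (\<lambda>d. \<Sum>i\<in>UNIV. (w $ i) *\<^sub>R coord_vec A c x i d)"
    note t = coord_vec_tangent[OF A c]
    have lin: "linear_on_tangent A x (g x u)" if "u \<in> tangent_space A x" for u
      using g that unfolding riemannian_metric_def by auto
    have sym: "g x u v = g x v u" if "u \<in> tangent_space A x" "v \<in> tangent_space A x" for u v
      using g that unfolding riemannian_metric_def by auto
    have v: "v \<in> tangent_space A x" and
      gv: "\<And>u. u \<in> tangent_space A x \<Longrightarrow> g x u v = (\<Sum>i\<in>UNIV. w $ i * g x u (coord_vec A c x i))"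
      using linear_on_tangent_sum[OF A lin, of _ UNIV "coord_vec A c x" "\<lambda>i. w $ i"] t
      unfolding v_def by auto
    have "v c = w"
      using basis_expansion[of w] c trans_deriv_id[OF A c]
      by (simp add: v_def coord_vec_def scalar_mult_eq_scaleR)
    hence "v \<noteq> (\<lambda>_. 0)" using \<open>w \<noteq> 0\<close> by auto
    hence pos: "g x v v > 0" using g v unfolding riemannian_metric_def by auto
    have "g x v (coord_vec A c x i) = 0" for i
    proof -
      have "g x v (coord_vec A c x i) = (metric_comp A g c x *v w) $ i"
        using sym[OF v t] gv[OF t]
        by (simp add: metric_comp_def matrix_vector_mult_def mult.commute)
      thus ?thesis using w by simp
    qed
    hence "g x v v = 0" using gv[OF v] by simp
    with pos show False by simp
  qed
  thus ?thesis using matrix_left_invertible_ker invertible_left_inverse by blast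
qed

lemma char_coeff_similar:
  fixes M J K :: "real^'n^'n"
  assumes JK: "J ** K = mat 1"
  shows "char_coeff (K ** M ** J) i = char_coeff M i"
proof -
  let ?P = "\<lambda>M::real^'n^'n. (\<chi> a b. [:M $ a $ b:]) :: real poly^'n^'n"
  have mul: "?P (M ** N) = ?P M ** ?P N" for M N
  proof -
    have "[:\<Sum>k\<in>UNIV. f k:] = (\<Sum>k\<in>UNIV. [:f k:])" for f :: "'n \<Rightarrow> real"
      by (simp add: sum_to_poly)
    thus ?thesis by (simp add: matrix_matrix_mult_def vec_eq_iff mult.commute)
  qed
  have one: "?P (mat 1) = mat 1" by (simp add: vec_eq_iff mat_def)
  have KJ: "K ** J = mat 1" using JK matrix_left_right_inverse by blast
  let ?X = "mat [:0, 1:] :: real poly^'n^'n"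
  have comm: "?P K ** ?X = ?X ** ?P K"
    by (simp add: vec_eq_iff matrix_matrix_mult_def mat_def if_distrib if_distribR cong: if_cong)
  have sd: "B ** (M - N) = B ** M - B ** N" "(M - N) ** B = M ** B - N ** B"
    for B M N :: "real poly^'n^'n"
    by (simp_all add: vec_eq_iff matrix_matrix_mult_def algebra_simps sum_subtractf)
  have KJ1: "?P K ** ?P J = mat 1" by (metis KJ mul one)
  have "?P K ** ?X ** ?P J = ?X" unfolding comm matrix_mul_assoc[symmetric] KJ1 by simp
  hence "?P (K ** M ** J) - ?X = ?P K ** (?P M - ?X) ** ?P J"
    by (simp only: sd mul)
  hence "det (?P (K ** M ** J) - ?X) = det (?P K ** ?P J) * det (?P M - ?X)"
    by (simp add: det_mul)
  also have "\<dots> = det (?P M - ?X)" unfolding KJ1 by simp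
  finally show ?thesis by (simp add: char_coeff_def)
qed

lemma matpow_similar:
  fixes M J K :: "real^'n^'n"
  assumes JK: "J ** K = mat 1"
  shows "matpow (K ** M ** J) k = K ** matpow M k ** J"
proof (induction k)
  case 0
  show ?case using JK matrix_left_right_inverse[of J K] by (simp add: matpow_def)
next
  case (Suc k)
  have "matpow (K ** M ** J) (Suc k) = K ** M ** (J ** K) ** matpow M k ** J"
    using Suc by (simp add: matpow_def matrix_mul_assoc)
  thus ?case by (simp add: JK) (simp add: matpow_def matrix_mul_assoc)
qed

lemma I_coord_eq:
  "I_coord g h k p = p \<bullet> ((S_mat g h k ** matrix_inv g) *v p)"
proof -
  have "I_coord g h k p = (\<Sum>\<alpha>\<in>UNIV. \<Sum>j\<in>UNIV. \<Sum>i\<in>UNIV. matrix_inv g $ \<alpha> $ i * S_mat g h k $ j $ \<alpha> * p $ i * p $ j)"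
    unfolding I_coord_def by (rule sum.cong[OF refl], rule sum.swap)
  also have "\<dots> = (\<Sum>j\<in>UNIV. \<Sum>\<alpha>\<in>UNIV. \<Sum>i\<in>UNIV. matrix_inv g $ \<alpha> $ i * S_mat g h k $ j $ \<alpha> * p $ i * p $ j)"
    by (rule sum.swap)
  also have "\<dots> = p \<bullet> (S_mat g h k *v (matrix_inv g *v p))"
    by (simp add: inner_vec_def matrix_vector_mult_def sum_distrib_left sum_distrib_right mult_ac)
  finally show ?thesis by (simp add: matrix_vector_mul_assoc)
qed

lemma I_coord_change:
  fixes g h J :: "real^'n^'n"
  assumes J: "invertible J" and g: "invertible g"
  shows "I_coord (transpose J ** g ** J) (transpose J ** h ** J) k (transpose J *v p) = I_coord g h k p"
proof -
  obtain K where JK: "J ** K = mat 1" and KJ: "K ** J = mat 1"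
    using J unfolding invertible_def by auto
  have tr: "transpose J ** transpose K = mat 1" "transpose K ** transpose J = mat 1"
    using JK KJ by (metis matrix_transpose_mul transpose_mat)+
  have ginv: "g ** matrix_inv g = mat 1" using g by (rule matrix_inv_mult)
  let ?g = "transpose J ** g ** J" and ?h = "transpose J ** h ** J"
  have "?g ** (K ** matrix_inv g ** transpose K) =
      transpose J ** (g ** (J ** K) ** matrix_inv g) ** transpose K"
    by (simp add: matrix_mul_assoc)
  also have "\<dots> = mat 1" by (simp add: JK ginv tr)
  finally have gi: "matrix_inv ?g = K ** matrix_inv g ** transpose K" by (rule matrix_inv_unique)
  have "G_mat ?g ?h = K ** matrix_inv g ** (transpose K ** transpose J) ** h ** J"
    unfolding G_mat_def gi by (simp add: matrix_mul_assoc)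
  hence G: "G_mat ?g ?h = K ** G_mat g h ** J" unfolding tr by (simp add: G_mat_def matrix_mul_assoc)
  have "det J \<noteq> 0" using J invertible_det_nz by blast
  hence det: "det ?g / det ?h = det g / det h" by (simp add: det_mul det_transpose)
  have rdistrib: "(M + N) ** B = M ** B + N ** B" for M N B :: "real^'n^'n"
    by (simp add: vec_eq_iff matrix_matrix_mult_def algebra_simps sum.distrib)
  have sum: "(\<Sum>i\<in>I. a i *\<^sub>R (K ** B i ** J)) = K ** (\<Sum>i\<in>I. a i *\<^sub>R B i) ** J"
    if "finite I" for I and a :: "nat \<Rightarrow> real" and B :: "nat \<Rightarrow> real^'n^'n"
    using that
    by induction (auto simp: matrix_add_ldistrib rdistrib matrix_scalar_ac scalar_matrix_assoc)
  have S: "S_mat ?g ?h k = K ** S_mat g h k ** J"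
    unfolding S_mat_def G det char_coeff_similar[OF JK] matpow_similar[OF JK] sum[OF finite_atMost]
    by (simp add: matrix_scalar_ac scalar_matrix_assoc)
  have "S_mat ?g ?h k ** matrix_inv ?g = K ** S_mat g h k ** (J ** K) ** matrix_inv g ** transpose K"
    unfolding S gi by (simp add: matrix_mul_assoc)
  hence "(S_mat ?g ?h k ** matrix_inv ?g) *v (transpose J *v p) =
      (K ** S_mat g h k ** matrix_inv g ** (transpose K ** transpose J)) *v p"
    unfolding JK by (simp add: matrix_vector_mul_assoc matrix_mul_assoc del: transpose_matrix_vector)
  also have "\<dots> = K *v ((S_mat g h k ** matrix_inv g) *v p)"
    unfolding tr by (simp add: matrix_vector_mul_assoc matrix_mul_assoc)
  finally have "I_coord ?g ?h k (transpose J *v p) =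
      p \<bullet> (J *v (K *v ((S_mat g h k ** matrix_inv g) *v p)))"
    unfolding I_coord_eq by (metis dot_lmul_matrix transpose_matrix_vector)
  thus ?thesis by (simp add: matrix_vector_mul_assoc JK I_coord_eq matrix_mul_assoc)
qed

lemma integral_I_eq:
  fixes A :: "('m::{t2_space,second_countable_topology}, real^'n) chart set"
  assumes A: "smooth_atlas A" and g: "riemannian_metric r A g" and h: "riemannian_metric s A h"
    and z: "z \<in> cotangent_bundle A" and c: "c \<in> A" "fst z \<in> fst c"
  shows "integral_I A g h k z =
    I_coord (metric_comp A g c (fst z)) (metric_comp A h c (fst z)) k (covector_comp A c z)"
proof -
  define d where "d = (SOME c. c \<in> A \<and> fst z \<in> fst c)"
  have d: "d \<in> A" "fst z \<in> fst d" using someI[of "\<lambda>c. c \<in> A \<and> fst z \<in> fst c" c] c by (auto simp: d_def)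
  have "invertible (jacobian_matrix d c (fst z))"
    using jacobian_inverse[OF A d c] jacobian_inverse[OF A c d] invertible_def by blast
  from I_coord_change[OF this metric_comp_invertible[OF A g c]]
  show ?thesis
    unfolding integral_I_def Let_def d_def[symmetric] metric_comp_change[OF A g d c]
      metric_comp_change[OF A h d c] covector_comp_change[OF A z d c] by blast
qed

end

theory Submission
  imports Defs
begin

text \<open>Let \<open>w = (det g / det h)\<close> to the power \<open>1 / (n + 1)\<close> and let \<open>L = h\<inverse> g / w\<close> be the Benenti tensor, so that
  \<open>w = det L\<close>.  The pencil \<open>\<Sum> t\<^sup>k S\<^sub>k\<close> equals minus the adjugate of \<open>t - L\<close>.  At a point
  where the eigenvalues \<open>\<kappa>\<close> of \<open>L\<close> are simple, the commutation relations, written with the Levi-Civita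
  connection of \<open>g\<close> in an orthonormal eigenbasis and evaluated at \<open>t = \<kappa>\<^sub>i\<close>, force
  \<open>\<nabla>\<^sub>l L\<^sub>j\<^sub>k = \<l>\<^sub>j g\<^sub>l\<^sub>k + \<l>\<^sub>k g\<^sub>l\<^sub>j\<close>.  This says that the Christoffel symbols of \<open>h\<close> and \<open>g\<close>
  differ by \<open>\<phi>\<^sub>i \<delta>\<^sub>k\<^sub>j + \<phi>\<^sub>j \<delta>\<^sub>k\<^sub>i\<close> with \<open>\<phi> = - dw / (2 w)\<close>, a closed condition.

  Simple spectrum is dense: otherwise take a point of an open set without such points at which the number
  of distinct eigenvalues is maximal.  There \<open>L\<close> is scalar to first order on the eigenspace of a multiple
  eigenvalue \<open>\<mu>\<close>, and the Killing equation then makes \<open>\<Sum> \<mu>\<^sup>k I\<^sub>k\<close> vanish together with its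
  differential, for all momenta.

  Finally the \<open>g\<close>-geodesics become \<open>h\<close>-geodesics after integrating \<open>1 / w\<close> along them.\<close>

section \<open>Continuously differentiable functions\<close>

text \<open>Eigenvectors of L need not depend continuously on the point, so nothing is ever
  differentiated in an eigenbasis: derivatives are taken of matrices in coordinates, and only the
  resulting arrays of numbers at one point are expanded in the basis. The powers of w in S_k are
  what turns the Horner sums of det (G - \<mu> E) into coefficients of an adjugate. The last
  coefficient is minus the inverse of g, so commuting with I_{n-1} makes every member of the pencil
  a Killing tensor. The Killing equation settles the components of \<nabla> L with a repeated index;
  on three distinct indices it leaves one free parameter, and only there are brackets between two
  arbitrary members of the pencil used. Where eigenvalues collide, the division by their differences
  fails. Continuity repairs this, because the relation between the Christoffel symbols is one
  between continuous functions; what has to be excluded is a whole open set of collisions, and that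
  is where independence of the integrals enters.\<close>

definition C1_on :: "'a::real_normed_vector set \<Rightarrow> ('a \<Rightarrow> real) \<Rightarrow> bool" where
  "C1_on U f \<longleftrightarrow> higher_differentiable_on 1 U f"

lemma C1_on_iff:
  "C1_on U f \<longleftrightarrow> (\<forall>x\<in>U. f differentiable (at x)) \<and>
     (\<forall>v. continuous_on U (\<lambda>x. frechet_derivative f (at x) v))"
  by (simp add: C1_on_def)

lemma C1_onI:
  assumes "\<And>x. x \<in> U \<Longrightarrow> (f has_derivative f' x) (at x)" "\<And>v. continuous_on U (\<lambda>x. f' x v)"
  shows "C1_on U f"
proof -
  have "frechet_derivative f (at x) = f' x" if "x \<in> U" for x
    using assms(1)[OF that] frechet_derivative_at by metis
  hence "continuous_on U (\<lambda>x. frechet_derivative f (at x) v)" for v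
    using assms(2)[of v] by simp
  thus ?thesis using assms(1) unfolding C1_on_iff differentiable_def by blast
qed

lemma C1_on_derivative:
  assumes "C1_on U f" "x \<in> U"
  shows "(f has_derivative frechet_derivative f (at x)) (at x)"
  using assms frechet_derivative_works unfolding C1_on_iff by blast

lemma C1_on_derivative_continuous:
  "C1_on U f \<Longrightarrow> continuous_on U (\<lambda>x. frechet_derivative f (at x) v)"
  unfolding C1_on_iff by blast

lemma C1_on_continuous: "C1_on U f \<Longrightarrow> continuous_on U f"
  unfolding C1_on_iff
  by (meson continuous_at_imp_continuous_on differentiable_imp_continuous_within)

lemma C1_on_const: "C1_on U (\<lambda>x. c)"
  by (rule C1_onI[where f'="\<lambda>x v. 0"]) (auto intro: derivative_eq_intros)

lemma C1_on_add:
  assumes "C1_on U f" "C1_on U g"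
  shows "C1_on U (\<lambda>x. f x + g x)"
  by (rule C1_onI[OF has_derivative_add[OF C1_on_derivative[OF assms(1)] C1_on_derivative[OF assms(2)]]]; assumption?)
    (intro continuous_intros C1_on_derivative_continuous assms)

lemma C1_on_mult:
  assumes "C1_on U f" "C1_on U g"
  shows "C1_on U (\<lambda>x. f x * g x)"
  by (rule C1_onI[OF has_derivative_mult[OF C1_on_derivative[OF assms(1)] C1_on_derivative[OF assms(2)]]]; assumption?)
    (intro continuous_intros C1_on_derivative_continuous C1_on_continuous assms)

lemma C1_on_diff:
  assumes "C1_on U f" "C1_on U g"
  shows "C1_on U (\<lambda>x. f x - g x)"
  by (rule C1_onI[OF has_derivative_diff[OF C1_on_derivative[OF assms(1)] C1_on_derivative[OF assms(2)]]]; assumption?)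
    (intro continuous_intros C1_on_derivative_continuous assms)

lemma C1_on_sum: "(\<And>i. i \<in> I \<Longrightarrow> C1_on U (f i)) \<Longrightarrow> C1_on U (\<lambda>x. \<Sum>i\<in>I. f i x)"
  by (induction I rule: infinite_finite_induct) (auto intro: C1_on_const C1_on_add)

lemma C1_on_prod: "(\<And>i. i \<in> I \<Longrightarrow> C1_on U (f i)) \<Longrightarrow> C1_on U (\<lambda>x. \<Prod>i\<in>I. f i x)"
  by (induction I rule: infinite_finite_induct) (auto intro: C1_on_const C1_on_mult)

lemma C1_on_power: "C1_on U f \<Longrightarrow> C1_on U (\<lambda>x. f x ^ k)"
  by (induction k) (auto intro: C1_on_const C1_on_mult)

lemma C1_on_compose_real:
  assumes f: "C1_on U f" and \<phi>: "\<And>x. x \<in> U \<Longrightarrow> (\<phi> has_field_derivative \<phi>' (f x)) (at (f x))"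
    and c: "continuous_on (f ` U) \<phi>'"
  shows "C1_on U (\<lambda>x. \<phi> (f x))"
proof (rule C1_onI[where f'="\<lambda>x v. \<phi>' (f x) * frechet_derivative f (at x) v"])
  fix x assume x: "x \<in> U"
  show "((\<lambda>x. \<phi> (f x)) has_derivative (\<lambda>v. \<phi>' (f x) * frechet_derivative f (at x) v)) (at x)"
    using has_derivative_compose[OF C1_on_derivative[OF f x] \<phi>[OF x, unfolded has_field_derivative_def]] .
next
  fix v
  show "continuous_on U (\<lambda>x. \<phi>' (f x) * frechet_derivative f (at x) v)"
    by (intro continuous_intros C1_on_derivative_continuous f
        continuous_on_compose2[OF c C1_on_continuous[OF f]]) auto
qed

lemma C1_on_powr:
  assumes "C1_on U f" "\<And>x. x \<in> U \<Longrightarrow> f x > 0"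
  shows "C1_on U (\<lambda>x. f x powr a)"
proof (rule C1_on_compose_real[OF assms(1), where \<phi>'="\<lambda>y. a * y powr (a - 1)"])
  show "continuous_on (f ` U) (\<lambda>y. a * y powr (a - 1))"
    by (intro continuous_intros) (auto dest: assms(2))
qed (use assms(2) in \<open>auto intro!: has_real_derivative_powr\<close>)

lemma C1_on_inverse:
  assumes "C1_on U f" "\<And>x. x \<in> U \<Longrightarrow> f x \<noteq> 0"
  shows "C1_on U (\<lambda>x. inverse (f x))"
proof (rule C1_on_compose_real[OF assms(1), where \<phi>'="\<lambda>y. - (inverse y ^ Suc (Suc 0))"])
  show "(inverse has_real_derivative - (inverse (f x) ^ Suc (Suc 0))) (at (f x))" if "x \<in> U" for x
    using DERIV_inverse assms(2) that by blast
qed (use assms in \<open>auto intro!: continuous_intros\<close>)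

lemma C1_on_divide:
  assumes "C1_on U f" "C1_on U g" "\<And>x. x \<in> U \<Longrightarrow> g x \<noteq> 0"
  shows "C1_on U (\<lambda>x. f x / g x)"
  unfolding divide_inverse by (intro C1_on_mult C1_on_inverse assms)

lemma C1_on_cong:
  assumes "open U" "\<And>x. x \<in> U \<Longrightarrow> f x = g x" "C1_on U f"
  shows "C1_on U g"
proof (rule C1_onI)
  fix x assume x: "x \<in> U"
  show "(g has_derivative frechet_derivative f (at x)) (at x)"
    by (rule has_derivative_transform_within_open[OF C1_on_derivative[OF assms(3) x] assms(1) x])
      (use assms(2) in auto)
qed (rule C1_on_derivative_continuous[OF assms(3)])

section \<open>Matrix-valued functions of class C1\<close>

definition mC1_on :: "'a::real_normed_vector set \<Rightarrow> ('a \<Rightarrow> real^'n^'m) \<Rightarrow> bool" where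
  "mC1_on U M \<longleftrightarrow> (\<forall>i j. C1_on U (\<lambda>x. M x $ i $ j))"

lemma mC1_onD: "mC1_on U M \<Longrightarrow> C1_on U (\<lambda>x. M x $ i $ j)"
  by (simp add: mC1_on_def)

lemma mC1_on_const: "mC1_on U (\<lambda>x. M)"
  by (simp add: mC1_on_def C1_on_const)

lemma mC1_on_add: "mC1_on U M \<Longrightarrow> mC1_on U N \<Longrightarrow> mC1_on U (\<lambda>x. M x + N x)"
  by (simp add: mC1_on_def C1_on_add)

lemma mC1_on_sum: "(\<And>i. i \<in> I \<Longrightarrow> mC1_on U (M i)) \<Longrightarrow> mC1_on U (\<lambda>x. \<Sum>i\<in>I. M i x)"
  by (induction I rule: infinite_finite_induct) (auto intro: mC1_on_const mC1_on_add)

lemma mC1_on_mult: "mC1_on U M \<Longrightarrow> mC1_on U N \<Longrightarrow> mC1_on U (\<lambda>x. M x ** N x)"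
  by (simp add: mC1_on_def matrix_matrix_mult_def C1_on_sum C1_on_mult)

lemma mC1_on_scaleR: "C1_on U a \<Longrightarrow> mC1_on U M \<Longrightarrow> mC1_on U (\<lambda>x. a x *\<^sub>R M x)"
  by (simp add: mC1_on_def C1_on_mult)

lemma C1_on_det:
  fixes M :: "'a::real_normed_vector \<Rightarrow> real^'n^'n"
  assumes "mC1_on U M"
  shows "C1_on U (\<lambda>x. det (M x))"
  unfolding det_def by (intro C1_on_sum C1_on_mult C1_on_const C1_on_prod mC1_onD assms)

text \<open>Cramer's rule. It shows the entries of the inverse to be quotients of polynomials in the
  entries of \<open>M\<close>, which is how inversion preserves class C1.\<close>

lemma matrix_inv_component:
  fixes M N :: "real^'n^'n"
  assumes "det M \<noteq> 0"
  shows "matrix_inv M $ k $ j = det (\<chi> i l. if l = k then axis j 1 $ i else M $ i $ l) / det M"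
proof -
  have "invertible M" using assms invertible_det_nz by blast
  hence "M *v (matrix_inv M *v axis j 1) = axis j 1"
    by (simp add: matrix_vector_mul_assoc matrix_inv_mult)
  hence "matrix_inv M *v axis j 1 =
      (\<chi> k. det (\<chi> i l. if l = k then axis j 1 $ i else M $ i $ l) / det M)"
    using cramer[OF assms] by blast
  thus ?thesis by (simp add: matrix_vector_mult_basis column_def vec_eq_iff)
qed

lemma mC1_on_matrix_inv:
  fixes M :: "'a::real_normed_vector \<Rightarrow> real^'n^'n"
  assumes U: "open U" and M: "mC1_on U M" and d: "\<And>x. x \<in> U \<Longrightarrow> det (M x) \<noteq> 0"
  shows "mC1_on U (\<lambda>x. matrix_inv (M x))"
  unfolding mC1_on_def
proof (intro allI)
  fix k j
  have "mC1_on U (\<lambda>x. \<chi> i l. if l = k then axis j 1 $ i else M x $ i $ l)"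
    unfolding mC1_on_def
  proof (intro allI)
    fix i l
    show "C1_on U (\<lambda>x. (\<chi> i l. if l = k then axis j 1 $ i else M x $ i $ l) $ i $ l)"
      using mC1_onD[OF M] by (cases "l = k") (simp_all add: C1_on_const)
  qed
  hence "C1_on U (\<lambda>x. det (\<chi> i l. if l = k then axis j 1 $ i else M x $ i $ l) / det (M x))"
    by (intro C1_on_divide C1_on_det M d)
  thus "C1_on U (\<lambda>x. matrix_inv (M x) $ k $ j)"
    by (rule C1_on_cong[OF U, rotated]) (simp add: matrix_inv_component d)
qed

lemma mC1_on_matpow:
  assumes "mC1_on U M"
  shows "mC1_on U (\<lambda>x. matpow (M x) k)"
proof (induction k)
  case 0 show ?case by (simp add: matpow_def mC1_on_const)
next
  case (Suc k)
  have "mC1_on U (\<lambda>x. M x ** matpow (M x) k)" by (intro mC1_on_mult assms Suc)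
  thus ?case by (simp add: matpow_def)
qed

lemma C1_on_char_coeff:
  fixes M :: "'a::real_normed_vector \<Rightarrow> real^'n^'n"
  assumes M: "mC1_on U M"
  shows "C1_on U (\<lambda>x. char_coeff (M x) i)"
proof -
  \<comment> \<open>Polynomial-valued functions with C1 coefficients are closed under sums and
    products, so the property passes through the expansion of the determinant.\<close>
  define P where "P f \<longleftrightarrow> (\<forall>m. C1_on U (\<lambda>x. coeff (f x) m))" for f :: "'a \<Rightarrow> real poly"
  have P_const: "P (\<lambda>x. p)" for p by (simp add: P_def C1_on_const)
  have P_mult: "P (\<lambda>x. f x * g x)" if "P f" "P g" for f g
    using that by (auto simp: P_def coeff_mult intro!: C1_on_sum C1_on_mult)
  have P_sum: "P (\<lambda>x. \<Sum>i\<in>I. f i x)" if "\<And>i. i \<in> I \<Longrightarrow> P (f i)" for f :: "('n \<Rightarrow> 'n) \<Rightarrow> _" and I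
    using that by (auto simp: P_def coeff_sum intro!: C1_on_sum)
  have P_prod: "P (\<lambda>x. \<Prod>i\<in>I. f i x)" if "\<And>i. P (f i)" for f :: "'n \<Rightarrow> _" and I
    using that by (induction I rule: infinite_finite_induct) (auto intro: P_const P_mult)
  have P_entry: "P (\<lambda>x. ((\<chi> a b. [:M x $ a $ b:]) - mat [:0, 1:]) $ a $ b)" for a b
  proof -
    have "C1_on U (\<lambda>x. coeff [:M x $ a $ b:] m - coeff ((mat [:0, 1:] :: real poly^'n^'n) $ a $ b) m)" for m
      using mC1_onD[OF M, of a b]
      by (intro C1_on_diff C1_on_const, cases m) (simp_all add: C1_on_const)
    thus ?thesis by (simp add: P_def)
  qed
  have "P (\<lambda>x. det ((\<chi> a b. [:M x $ a $ b:]) - mat [:0, 1:]))"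
    unfolding det_def by (intro P_sum P_mult P_const P_prod P_entry)
  thus ?thesis by (simp add: P_def char_coeff_def)
qed

lemma bounded_bilinear_matrix_mult: "bounded_bilinear ((**) :: real^'n^'m \<Rightarrow> real^'k^'n \<Rightarrow> real^'k^'m)"
proof -
  have "bilinear ((**) :: real^'n^'m \<Rightarrow> real^'k^'n \<Rightarrow> real^'k^'m)"
    unfolding bilinear_def linear_iff
    by (simp add: vec_eq_iff matrix_matrix_mult_def algebra_simps sum.distrib sum_distrib_left)
  thus ?thesis by (simp add: bilinear_conv_bounded_bilinear)
qed

lemma bounded_bilinear_matrix_vector_mult: "bounded_bilinear ((*v) :: real^'n^'m \<Rightarrow> real^'n \<Rightarrow> real^'m)"
proof -
  have "bilinear ((*v) :: real^'n^'m \<Rightarrow> real^'n \<Rightarrow> real^'m)"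
    unfolding bilinear_def linear_iff
    by (simp add: vec_eq_iff matrix_vector_mult_def algebra_simps sum.distrib sum_distrib_left)
  thus ?thesis by (simp add: bilinear_conv_bounded_bilinear)
qed

lemma has_derivative_vec_nth:
  fixes f :: "'a::real_normed_vector \<Rightarrow> ('b::euclidean_space)^'n"
  assumes "\<And>i. ((\<lambda>x. f x $ i) has_derivative (\<lambda>v. f' v $ i)) (at x)"
  shows "(f has_derivative f') (at x)"
proof -
  have "((\<lambda>x. f x \<bullet> b) has_derivative (\<lambda>v. f' v \<bullet> b)) (at x)" if "b \<in> Basis" for b
  proof -
    obtain i u where "b = axis i u" using \<open>b \<in> Basis\<close> by (auto simp: Basis_vec_def)
    thus ?thesis using has_derivative_inner_left[OF assms, of i u] by (simp add: inner_axis)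
  qed
  thus ?thesis using has_derivative_componentwise_within by blast
qed

lemma mC1_on_derivative:
  fixes M :: "'a::real_normed_vector \<Rightarrow> real^'n^'m"
  assumes "mC1_on U M" "x \<in> U"
  shows "(M has_derivative (\<lambda>v. \<chi> i j. frechet_derivative (\<lambda>q. M q $ i $ j) (at x) v)) (at x)"
  by (intro has_derivative_vec_nth) (simp add: C1_on_derivative[OF mC1_onD[OF assms(1)] assms(2)])

lemma vector_derivative_quotient:
  fixes F :: "real \<Rightarrow> 'a::real_normed_vector"
  assumes "(F has_vector_derivative D) (at 0)"
  shows "((\<lambda>e. (F e - F 0) /\<^sub>R e) \<longlongrightarrow> D) (at 0)"
proof -
  have "((\<lambda>e. norm (F e - F 0 - e *\<^sub>R D) / norm e) \<longlongrightarrow> 0) (at 0)"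
    using assms unfolding has_vector_derivative_def has_derivative_at by (simp add: field_simps)
  moreover have "\<forall>\<^sub>F e in at 0. norm (F e - F 0 - e *\<^sub>R D) / norm e = norm ((F e - F 0) /\<^sub>R e - D)"
    using eventually_neq_at_within[of 0]
  proof eventually_elim
    case (elim e)
    have "(F e - F 0) /\<^sub>R e - D = (F e - F 0 - e *\<^sub>R D) /\<^sub>R e" using elim by (simp add: algebra_simps)
    thus ?case by (simp add: divide_inverse)
  qed
  ultimately have "((\<lambda>e. norm ((F e - F 0) /\<^sub>R e - D)) \<longlongrightarrow> 0) (at 0)" by (simp add: tendsto_cong)
  thus ?thesis by (simp add: tendsto_norm_zero_iff LIM_zero_cancel)
qed


section \<open>Simultaneous diagonalization\<close>

lemma sum_matrix_vector: "finite I \<Longrightarrow> (\<Sum>i\<in>I. B i) *v (x::real^'n) = (\<Sum>i\<in>I. B i *v x)"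
  for B :: "nat \<Rightarrow> real^'n^'n"
  by (induction I rule: finite_induct) (simp_all add: matrix_vector_mult_add_rdistrib)

lemma matrix_vector_mult_uminus: "(- A) *v x = - (A *v x)" for A :: "real^'n^'n"
  by (simp add: vec_eq_iff matrix_vector_mult_def sum_negf)

lemma transpose_add: "transpose (A + B) = transpose A + transpose B" for A B :: "real^'n^'n"
  by (simp add: vec_eq_iff transpose_def)

lemma transpose_diff: "transpose (A - B) = transpose A - transpose B" for A B :: "real^'n^'n"
  by (simp add: vec_eq_iff transpose_def)

lemma matrix_matrix_add_rdistrib: "(A + B) ** D = A ** D + B ** D" for A B D :: "real^'n^'n"
  by (simp add: vec_eq_iff matrix_matrix_mult_def algebra_simps sum.distrib)

lemma linear_matrix_mult:
  fixes A :: "real^'n^'n"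
  assumes "linear F"
  shows "linear (\<lambda>u. F u ** A)" "linear (\<lambda>u. A ** F u)" "linear (\<lambda>u. transpose (F u))"
  using assms unfolding linear_iff
  by (simp_all add: vec_eq_iff matrix_matrix_mult_def transpose_def algebra_simps sum.distrib sum_distrib_left)

section \<open>Eigenbases of a symmetric form relative to an inner product\<close>

definition spd :: "real^'n^'n \<Rightarrow> bool" where
  "spd g \<longleftrightarrow> transpose g = g \<and> (\<forall>x. x \<noteq> 0 \<longrightarrow> x \<bullet> (g *v x) > 0)"

text \<open>The \<open>v j\<close> are eigenvectors of the endomorphism
  \<open>matrix_inv g ** N\<close>. Writing the equation between covectors keeps both matrices
  symmetric, and the covectors \<open>g *v v j\<close> form the dual basis.\<close>

definition g_eigenbasis ::
  "real^'n^'n \<Rightarrow> real^'n^'n \<Rightarrow> ('n \<Rightarrow> real^'n) \<Rightarrow> ('n \<Rightarrow> real) \<Rightarrow> bool" where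
  "g_eigenbasis g N v \<kappa> \<longleftrightarrow> (\<forall>i j. v i \<bullet> (g *v v j) = (if i = j then 1 else 0)) \<and>
     (\<forall>j. N *v v j = \<kappa> j *\<^sub>R (g *v v j))"

lemma symmetric_dot:
  fixes M :: "real^'n^'n"
  assumes "transpose M = M"
  shows "x \<bullet> (M *v y) = y \<bullet> (M *v x)"
  by (metis assms dot_lmul_matrix inner_commute transpose_matrix_vector)

lemma transpose_dot:
  fixes M :: "real^'n^'n"
  shows "x \<bullet> (transpose M *v y) = (M *v x) \<bullet> y"
  by (metis dot_lmul_matrix inner_commute transpose_matrix_vector)

lemma transpose_matrix_inv:
  fixes M :: "real^'n^'n"
  assumes "transpose M = M" "invertible M"
  shows "transpose (matrix_inv M) = matrix_inv M"
  by (metis assms matrix_inv_mult(2) matrix_inv_unique matrix_transpose_mul transpose_mat)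

lemma spd_invertible: "spd g \<Longrightarrow> invertible g"
  by (metis inner_zero_right invertible_left_inverse less_irrefl matrix_left_invertible_ker spd_def)

text \<open>The first-order condition at a minimum: for \<gamma> > 0 the minimizer e = - \<beta> /
  \<gamma> gives the value - \<beta>^2 / \<gamma>.\<close>

lemma zero_if_quadratic_nonneg:
  fixes \<beta> \<gamma> :: real
  assumes "\<And>e. 0 \<le> 2 * e * \<beta> + e^2 * \<gamma>" "\<gamma> \<ge> 0"
  shows "\<beta> = 0"
proof (rule ccontr)
  assume \<beta>: "\<beta> \<noteq> 0"
  show False
  proof (cases "\<gamma> = 0")
    case True
    with assms(1)[of "- \<beta>"] \<beta> show False
      by (simp add: power2_eq_square) (smt (verit) mult_pos_pos mult_neg_neg)
  next
    case False
    have "2 * (- \<beta> / \<gamma>) * \<beta> + (- \<beta> / \<gamma>)^2 * \<gamma> = - (\<beta>^2 / \<gamma>)"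
      using False by (simp add: field_simps power2_eq_square)
    moreover have "\<beta>^2 / \<gamma> > 0" using False \<beta> assms(2) by simp
    ultimately show False using assms(1)[of "- \<beta> / \<gamma>"] by linarith
  qed
qed

lemma matrix_expand_dot:
  fixes M :: "real^'n^'n"
  assumes "transpose M = M"
  shows "(x + e *\<^sub>R y) \<bullet> (M *v (x + e *\<^sub>R y)) = x \<bullet> (M *v x) + 2 * e * (y \<bullet> (M *v x)) + e^2 * (y \<bullet> (M *v y))"
  using symmetric_dot[OF assms, of x y]
  by (simp add: matrix_vector_right_distrib inner_add_left inner_add_right power2_eq_square
      matrix_vector_mult_scaleR algebra_simps)

text \<open>The Rayleigh quotient \<open>R\<close> attains a maximum on the unit sphere of the
  g-orthogonal complement \<open>W\<close> of the eigenvectors found so far. Its first variation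
  vanishes on \<open>W\<close>, and it vanishes on \<open>B\<close> because \<open>N\<close> maps
  each member of \<open>B\<close> to a multiple of its dual covector.\<close>

lemma g_eigenvector_step:
  fixes g N :: "real^'n^'n" and B :: "(real^'n) set"
  assumes g: "spd g" and N: "transpose N = N" and fin: "finite B" and card: "card B < CARD('n)"
    and orth: "\<And>b c. b \<in> B \<Longrightarrow> c \<in> B \<Longrightarrow> b \<bullet> (g *v c) = (if b = c then 1 else 0)"
    and eig: "\<And>b. b \<in> B \<Longrightarrow> \<exists>\<kappa>. N *v b = \<kappa> *\<^sub>R (g *v b)"
  obtains u \<kappa> where "u \<bullet> (g *v u) = 1" "\<And>b. b \<in> B \<Longrightarrow> b \<bullet> (g *v u) = 0" "N *v u = \<kappa> *\<^sub>R (g *v u)"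
proof -
  have gs: "transpose g = g" and gp: "\<And>x. x \<noteq> 0 \<Longrightarrow> x \<bullet> (g *v x) > 0" using g by (auto simp: spd_def)
  define W where "W = {w. \<forall>b\<in>B. b \<bullet> (g *v w) = 0}"
  define R where "R w = (w \<bullet> (N *v w)) / (w \<bullet> (g *v w))" for w
  have "dim ((\<lambda>b. g *v b) ` B) < DIM(real^'n)"
    using dim_le_card'[of "(\<lambda>b. g *v b) ` B"] card_image_le[OF fin, of "\<lambda>b. g *v b"] fin card by simp
  then obtain x where x: "x \<noteq> 0" "\<And>y. y \<in> span ((\<lambda>b. g *v b) ` B) \<Longrightarrow> orthogonal x y"
    using orthogonal_to_subspace_exists by blast
  have "x \<in> W" unfolding W_def
    using x(2)[OF span_base] symmetric_dot[OF gs, of _ x] by (auto simp: orthogonal_def)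
  have W_scale: "w \<in> W \<Longrightarrow> e *\<^sub>R w \<in> W" for w e by (simp add: W_def matrix_vector_mult_scaleR)
  have W_add: "w \<in> W \<Longrightarrow> y \<in> W \<Longrightarrow> w + y \<in> W" for w y
    by (simp add: W_def matrix_vector_right_distrib inner_add_right)
  have cont: "continuous_on S (\<lambda>w. A *v w)" for S and A :: "real^'n^'n"
    by (intro linear_continuous_on matrix_vector_mul_bounded_linear)
  have "closed W"
  proof -
    have "W = (\<Inter>b\<in>B. {w. b \<bullet> (g *v w) = 0})" by (auto simp: W_def)
    moreover have "closed {w. b \<bullet> (g *v w) = 0}" for b
      by (intro closed_Collect_eq continuous_intros cont)
    ultimately show ?thesis by auto
  qed
  hence comp: "compact (W \<inter> sphere 0 1)" by (simp add: closed_Int_compact)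
  have ne: "W \<inter> sphere 0 1 \<noteq> {}"
    using \<open>x \<in> W\<close> x(1) W_scale[of x "1 / norm x"] by (force simp: sphere_def)
  have "continuous_on (W \<inter> sphere 0 1) R" unfolding R_def
  proof (intro continuous_intros cont ballI)
    fix w :: "real^'n" assume "w \<in> W \<inter> sphere 0 1"
    hence "w \<noteq> 0" by auto
    thus "w \<bullet> (g *v w) \<noteq> 0" using gp by fastforce
  qed
  from continuous_attains_sup[OF comp ne this]
  obtain u0 where u0: "u0 \<in> W" "norm u0 = 1" "\<And>w. w \<in> W \<Longrightarrow> norm w = 1 \<Longrightarrow> R w \<le> R u0"
    by (auto simp: sphere_def)
  define \<kappa> where "\<kappa> = R u0"
  have "u0 \<noteq> 0" using u0 by auto
  hence pos: "u0 \<bullet> (g *v u0) > 0" by (rule gp)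
  \<comment> \<open>Nonnegative on \<open>W\<close> and zero at the maximizer; half the gradient of
    this form at \<open>u0\<close> is the vector \<open>z\<close> below.\<close>
  define q where "q w = \<kappa> * (w \<bullet> (g *v w)) - w \<bullet> (N *v w)" for w
  have q_nonneg: "q w \<ge> 0" if "w \<in> W" for w
  proof (cases "w = 0")
    case False
    have "R ((1 / norm w) *\<^sub>R w) \<le> \<kappa>" unfolding \<kappa>_def using u0(3) W_scale[OF that] False by simp
    moreover have "R ((1 / norm w) *\<^sub>R w) = R w" using False
      by (simp add: R_def matrix_vector_mult_scaleR)
    ultimately have "R w \<le> \<kappa>" by simp
    thus ?thesis using gp[OF False] by (simp add: q_def R_def field_simps)
  qed (simp add: q_def)
  have q0: "q u0 = 0" using pos by (simp add: q_def \<kappa>_def R_def)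
  define z where "z = \<kappa> *\<^sub>R (g *v u0) - N *v u0"
  have zW: "w \<bullet> z = 0" if "w \<in> W" for w
  proof (rule zero_if_quadratic_nonneg[where \<gamma>="q w"])
    fix e
    have "q (u0 + e *\<^sub>R w) = q u0 + 2 * e * (w \<bullet> z) + e^2 * q w"
      unfolding q_def z_def matrix_expand_dot[OF gs] matrix_expand_dot[OF N]
      by (simp add: inner_diff_right algebra_simps)
    thus "0 \<le> 2 * e * (w \<bullet> z) + e^2 * q w"
      using q_nonneg[OF W_add[OF u0(1) W_scale[OF that]], of e] q0 by simp
  qed (rule q_nonneg[OF that])
  have zB: "b \<bullet> z = 0" if "b \<in> B" for b
  proof -
    from eig[OF that] obtain \<mu> where \<mu>: "N *v b = \<mu> *\<^sub>R (g *v b)" by blast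
    have 1: "b \<bullet> (g *v u0) = 0" using u0(1) that by (simp add: W_def)
    have "b \<bullet> (N *v u0) = u0 \<bullet> (N *v b)" by (rule symmetric_dot[OF N])
    also have "\<dots> = \<mu> * (b \<bullet> (g *v u0))" using symmetric_dot[OF gs, of u0 b] by (simp add: \<mu>)
    finally show ?thesis using 1 by (simp add: z_def inner_diff_right)
  qed
  have "y \<bullet> z = 0" for y
  proof -
    \<comment> \<open>Subtracting the g-orthogonal projection to the span of \<open>B\<close> lands
      in \<open>W\<close>, so \<open>z\<close>, orthogonal to both, is orthogonal to
      everything.\<close>
    define w where "w = y - (\<Sum>b\<in>B. (b \<bullet> (g *v y)) *\<^sub>R b)"
    have "c \<bullet> (g *v w) = 0" if "c \<in> B" for c
    proof -
      have "g *v w = g *v y - (\<Sum>b\<in>B. (b \<bullet> (g *v y)) *\<^sub>R (g *v b))"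
        unfolding w_def
        by (simp add: matrix_vector_mult_diff_distrib linear_sum matrix_vector_mult_scaleR)
      hence "c \<bullet> (g *v w) = c \<bullet> (g *v y) - (\<Sum>b\<in>B. (b \<bullet> (g *v y)) * (c \<bullet> (g *v b)))"
        by (simp add: inner_diff_right inner_sum_right)
      also have "(\<Sum>b\<in>B. (b \<bullet> (g *v y)) * (c \<bullet> (g *v b))) = (\<Sum>b\<in>B. if c = b then b \<bullet> (g *v y) else 0)"
        by (rule sum.cong) (auto simp: orth that)
      finally show ?thesis using fin that by simp
    qed
    hence "w \<bullet> z = 0" by (intro zW) (simp add: W_def)
    thus ?thesis using zB by (simp add: w_def inner_diff_left inner_sum_left)
  qed
  hence "z = 0" using inner_eq_zero_iff by blast
  hence eig0: "N *v u0 = \<kappa> *\<^sub>R (g *v u0)" by (simp add: z_def)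
  define s where "s = 1 / sqrt (u0 \<bullet> (g *v u0))"
  have s2: "s * s * (u0 \<bullet> (g *v u0)) = 1" using pos by (simp add: s_def)
  show thesis
  proof (rule that[of "s *\<^sub>R u0" \<kappa>])
    show "(s *\<^sub>R u0) \<bullet> (g *v (s *\<^sub>R u0)) = 1" using s2 by (simp add: matrix_vector_mult_scaleR)
    show "b \<bullet> (g *v (s *\<^sub>R u0)) = 0" if "b \<in> B" for b
      using u0(1) that by (simp add: W_def matrix_vector_mult_scaleR)
    show "N *v (s *\<^sub>R u0) = \<kappa> *\<^sub>R (g *v (s *\<^sub>R u0))" by (simp add: matrix_vector_mult_scaleR eig0)
  qed
qed

lemma g_eigenbasis_exists:
  fixes g N :: "real^'n^'n"
  assumes g: "spd g" and N: "transpose N = N"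
  obtains v \<kappa> where "g_eigenbasis g N v \<kappa>"
proof -
  have gs: "transpose g = g" using g by (auto simp: spd_def)
  have "\<exists>B. finite B \<and> card B = m \<and> (\<forall>b\<in>B. \<forall>c\<in>B. b \<bullet> (g *v c) = (if b = c then 1 else 0)) \<and>
     (\<forall>b\<in>B. \<exists>\<kappa>. N *v b = \<kappa> *\<^sub>R (g *v b))" if "m \<le> CARD('n)" for m
    using that
  proof (induction m)
    case 0 show ?case by (rule exI[of _ "{}"]) simp
  next
    case (Suc m)
    then obtain B where B: "finite B" "card B = m"
      "\<And>b c. b \<in> B \<Longrightarrow> c \<in> B \<Longrightarrow> b \<bullet> (g *v c) = (if b = c then 1 else 0)"
      "\<And>b. b \<in> B \<Longrightarrow> \<exists>\<kappa>. N *v b = \<kappa> *\<^sub>R (g *v b)" by auto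
    obtain u \<kappa> where u: "u \<bullet> (g *v u) = 1" "\<And>b. b \<in> B \<Longrightarrow> b \<bullet> (g *v u) = 0" "N *v u = \<kappa> *\<^sub>R (g *v u)"
      using g_eigenvector_step[OF g N B(1) _ B(3,4)] B(2) Suc.prems by auto
    have "u \<notin> B" using u(1,2) by force
    moreover have "u \<bullet> (g *v b) = 0" if "b \<in> B" for b using u(2)[OF that] symmetric_dot[OF gs] by metis
    ultimately show ?case using B u by (intro exI[of _ "insert u B"]) auto
  qed
  from this[OF order_refl] obtain B where B: "finite B" "card B = CARD('n)"
      "\<And>b c. b \<in> B \<Longrightarrow> c \<in> B \<Longrightarrow> b \<bullet> (g *v c) = (if b = c then 1 else 0)"
      "\<And>b. b \<in> B \<Longrightarrow> \<exists>\<kappa>. N *v b = \<kappa> *\<^sub>R (g *v b)" by auto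
  obtain v where v: "bij_betw v (UNIV :: 'n set) B"
    using finite_same_card_bij[of "UNIV :: 'n set" B] B by auto
  obtain \<kappa> where \<kappa>: "\<And>b. b \<in> B \<Longrightarrow> N *v b = \<kappa> b *\<^sub>R (g *v b)" using B(4) by metis
  have vB: "v i \<in> B" for i using v by (auto simp: bij_betw_def)
  have "v i = v j \<longleftrightarrow> i = j" for i j using v by (auto simp: bij_betw_def inj_on_def)
  hence "g_eigenbasis g N v (\<lambda>j. \<kappa> (v j))" unfolding g_eigenbasis_def using B(3) \<kappa> vB by auto
  thus thesis by (rule that)
qed

lemma matrix_eq_axisI:
  fixes A B :: "real^'n^'m"
  assumes "\<And>j. A *v axis j 1 = B *v axis j 1"
  shows "A = B"
  using assms unfolding matrix_vector_mult_basis by (simp add: column_def vec_eq_iff)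

text \<open>Orthonormality makes \<open>transpose V ** g\<close> a left inverse of \<open>V\<close>.
  For square matrices it is then also a right inverse, and reading this identity on vectors and on
  covectors gives the two expansions.\<close>

lemma g_eigenbasis_expand:
  fixes g N :: "real^'n^'n"
  assumes "g_eigenbasis g N v \<kappa>"
  shows "x = (\<Sum>j\<in>UNIV. (v j \<bullet> (g *v x)) *\<^sub>R v j)" "p = (\<Sum>j\<in>UNIV. (v j \<bullet> p) *\<^sub>R (g *v v j))"
proof -
  define V where "V = (\<chi> i j. v j $ i)"
  have Vx: "V *v y = (\<Sum>j\<in>UNIV. (y $ j) *\<^sub>R v j)" for y
    by (simp add: V_def vec_eq_iff matrix_vector_mult_def mult.commute)
  have tV: "transpose V *v y = (\<chi> j. v j \<bullet> y)" for y
    by (simp add: V_def vec_eq_iff transpose_def matrix_vector_mult_def inner_vec_def)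
  have "(transpose V ** (g ** V)) = mat 1"
  proof -
    have "(transpose V ** (g ** V)) *v axis j 1 = axis j 1" for j
    proof -
      have "V *v axis j 1 = v j" by (simp add: matrix_vector_mult_basis column_def V_def vec_eq_iff)
      hence "(transpose V ** (g ** V)) *v axis j 1 = transpose V *v (g *v v j)"
        by (simp add: matrix_vector_mul_assoc[symmetric] del: transpose_matrix_vector)
      thus ?thesis using assms unfolding tV by (simp add: g_eigenbasis_def vec_eq_iff axis_def)
    qed
    thus ?thesis by (intro matrix_eq_axisI) simp
  qed
  hence 1: "(transpose V ** g) ** V = mat 1" by (simp add: matrix_mul_assoc)
  hence 2: "V ** (transpose V ** g) = mat 1" by (simp add: matrix_left_right_inverse)
  hence "(V ** transpose V) ** g = mat 1" by (simp add: matrix_mul_assoc)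
  hence 3: "g ** (V ** transpose V) = mat 1" by (simp add: matrix_left_right_inverse)
  have "x = V *v (transpose V *v (g *v x))" using 2
    by (simp add: matrix_vector_mul_assoc del: transpose_matrix_vector)
  thus "x = (\<Sum>j\<in>UNIV. (v j \<bullet> (g *v x)) *\<^sub>R v j)" by (simp add: Vx tV del: transpose_matrix_vector)
  have "p = g *v (V *v (transpose V *v p))" using 3
    by (simp add: matrix_vector_mul_assoc matrix_mul_assoc del: transpose_matrix_vector)
  also have "\<dots> = (\<Sum>j\<in>UNIV. (v j \<bullet> p) *\<^sub>R (g *v v j))"
    by (simp add: Vx tV linear_sum matrix_vector_mult_scaleR del: transpose_matrix_vector)
  finally show "p = (\<Sum>j\<in>UNIV. (v j \<bullet> p) *\<^sub>R (g *v v j))" .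
qed

lemma g_eigenbasis_matrix_eqI:
  fixes g N A B :: "real^'n^'n"
  assumes "g_eigenbasis g N v \<kappa>"
  shows "(\<And>j. A *v v j = B *v v j) \<Longrightarrow> A = B"
    and "(\<And>j. A *v (g *v v j) = B *v (g *v v j)) \<Longrightarrow> A = B"
proof -
  show "A = B" if "\<And>j. A *v v j = B *v v j"
  proof -
    have "A *v x = B *v x" for x
      by (subst (1 2) g_eigenbasis_expand(1)[OF assms, of x])
        (simp add: linear_sum matrix_vector_mult_scaleR that)
    thus ?thesis by (metis matrix_eq)
  qed
  show "A = B" if "\<And>j. A *v (g *v v j) = B *v (g *v v j)"
  proof -
    have "A *v x = B *v x" for x
      by (subst (1 2) g_eigenbasis_expand(2)[OF assms, of x])
        (simp add: linear_sum matrix_vector_mult_scaleR that)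
    thus ?thesis by (metis matrix_eq)
  qed
qed

lemma poly_det:
  fixes P :: "real poly^'n^'n"
  shows "poly (det P) x = det (\<chi> i j. poly (P $ i $ j) x)"
  by (simp add: det_def poly_sum poly_prod)

text \<open>\<open>char_coeff\<close> counts coefficients from the top degree n, so the bound on the
  degree of the determinant is needed for the reversed sum to be the whole polynomial.\<close>

lemma char_coeff_eval:
  fixes M :: "real^'n^'n"
  shows "(\<Sum>i\<le>CARD('n). char_coeff M i * x ^ (CARD('n) - i)) = det (M - x *\<^sub>R mat 1)"
proof -
  let ?P = "(\<chi> a b. [:M $ a $ b:]) - mat [:0, 1:] :: real poly^'n^'n"
  let ?n = "CARD('n)"
  have "degree (det ?P) \<le> ?n"
    unfolding det_def
  proof (rule degree_sum_le)
    fix p assume "p \<in> {p. p permutes (UNIV :: 'n set)}"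
    have "degree (\<Prod>i\<in>UNIV. ?P $ i $ p i) \<le> (\<Sum>i\<in>(UNIV::'n set). degree (?P $ i $ p i))"
      using degree_prod_sum_le[of "UNIV :: 'n set" "\<lambda>i. ?P $ i $ p i"] by (simp only: o_def finite)
    also have "\<dots> \<le> (\<Sum>i\<in>(UNIV::'n set). 1)"
      by (rule sum_mono) (auto simp: mat_def intro: degree_diff_le)
    finally have "degree (\<Prod>i\<in>UNIV. ?P $ i $ p i) \<le> ?n" by simp
    moreover have "degree (of_int (sign p) * (\<Prod>i\<in>UNIV. ?P $ i $ p i)) \<le> degree (\<Prod>i\<in>UNIV. ?P $ i $ p i)"
      by (cases "sign p = 1") (auto simp: sign_def split: if_splits)
    ultimately show "degree (of_int (sign p) * (\<Prod>i\<in>UNIV. ?P $ i $ p i)) \<le> ?n" by linarith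
  qed (simp add: finite_permutations)
  hence "poly (det ?P) x = (\<Sum>i\<le>?n. coeff (det ?P) i * x ^ i)"
    unfolding poly_altdef by (intro sum.mono_neutral_left) (auto simp: coeff_eq_0)
  also have "\<dots> = (\<Sum>i\<le>?n. coeff (det ?P) (?n - i) * x ^ (?n - i))"
    by (rule sum.reindex_bij_witness[of _ "\<lambda>i. ?n - i" "\<lambda>i. ?n - i"]) auto
  finally have "(\<Sum>i\<le>?n. char_coeff M i * x ^ (?n - i)) = poly (det ?P) x" by (simp add: char_coeff_def)
  also have "\<dots> = det (\<chi> i j. poly (?P $ i $ j) x)" by (rule poly_det)
  also have "(\<chi> i j. poly (?P $ i $ j) x) = M - x *\<^sub>R mat 1" by (simp add: vec_eq_iff mat_def)
  finally show ?thesis .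
qed

lemma det_diagonalizable:
  fixes M g N :: "real^'n^'n"
  assumes v: "g_eigenbasis g N v \<kappa>" and M: "\<And>j. M *v v j = \<gamma> j *\<^sub>R v j"
  shows "det M = (\<Prod>j\<in>UNIV. \<gamma> j)"
proof -
  define V where "V = (\<chi> i j. v j $ i)"
  define D where "D = (\<chi> i j. if i = j then \<gamma> j else 0)"
  have Vx: "V *v y = (\<Sum>j\<in>UNIV. (y $ j) *\<^sub>R v j)" for y
    by (simp add: V_def vec_eq_iff matrix_vector_mult_def mult.commute)
  have Va: "V *v axis j 1 = v j" for j by (simp add: matrix_vector_mult_basis column_def V_def vec_eq_iff)
  have "V *v (\<chi> j. v j \<bullet> (g *v x)) = x" for x
    using g_eigenbasis_expand(1)[OF v, of x] by (simp add: Vx)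
  hence "surj ((*v) V)" by (metis surjI)
  hence "invertible V" by (metis invertible_right_inverse matrix_right_invertible_surjective)
  hence "det V \<noteq> 0" using invertible_det_nz by blast
  have "(M ** V) *v axis j 1 = (V ** D) *v axis j 1" for j
  proof -
    have "D *v axis j 1 = \<gamma> j *\<^sub>R axis j 1"
      unfolding matrix_vector_mult_basis by (simp add: D_def column_def vec_eq_iff axis_def)
    thus ?thesis by (simp add: matrix_vector_mul_assoc[symmetric] Va M matrix_vector_mult_scaleR)
  qed
  hence "M ** V = V ** D" by (rule matrix_eq_axisI)
  hence "det M * det V = det V * det D" by (metis det_mul)
  hence "det M = det D" using \<open>det V \<noteq> 0\<close> by simp
  also have "\<dots> = (\<Prod>j\<in>UNIV. \<gamma> j)" by (subst det_diagonal) (auto simp: D_def)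
  finally show ?thesis .
qed

text \<open>Carries identities obtained by dividing by t - a over to the excluded value t =
  a.\<close>

lemma isCont_eq_limit:
  fixes f g :: "real \<Rightarrow> real"
  assumes "isCont f a" "isCont g a" "\<forall>\<^sub>F t in at a. f t = g t"
  shows "f a = g a"
proof -
  have "(g \<longlongrightarrow> f a) (at a)" using assms(1,3) unfolding isCont_def by (metis tendsto_cong)
  thus ?thesis using assms(2) unfolding isCont_def by (metis tendsto_unique at_neq_bot)
qed


section \<open>The Benenti tensor and its pencil\<close>

text \<open>With \<open>L\<close> the Benenti endomorphism, \<open>det_weight\<close> is \<open>det L\<close> and \<open>benenti\<close> is the symmetric bilinear
  form \<open>g L\<close>.\<close>

definition det_weight :: "real^'n^'n \<Rightarrow> real^'n^'n \<Rightarrow> real" where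
  "det_weight g h = (det g / det h) powr (1 / real (CARD('n) + 1))"

definition benenti :: "real^'n^'n \<Rightarrow> real^'n^'n \<Rightarrow> real^'n^'n" where
  "benenti g h = (1 / det_weight g h) *\<^sub>R (g ** matrix_inv h ** g)"

text \<open>The symmetric matrix of I_k as a quadratic form in the momenta: I_k is p \<bullet> K_k
  p.\<close>

definition K_mat :: "real^'n^'n \<Rightarrow> real^'n^'n \<Rightarrow> nat \<Rightarrow> real^'n^'n" where
  "K_mat g h k = S_mat g h k ** matrix_inv g"

definition pencil :: "real^'n^'n \<Rightarrow> real^'n^'n \<Rightarrow> real \<Rightarrow> real^'n^'n" where
  "pencil g h t = (\<Sum>k<CARD('n). t ^ k *\<^sub>R K_mat g h k)"

text \<open>This is det (t - L) for L the inverse of w G, expressed by the coefficients of G: it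
  expands w (t w)^n det (G - 1 / (t w)).\<close>

definition benenti_charpoly :: "real^'n^'n \<Rightarrow> real^'n^'n \<Rightarrow> real \<Rightarrow> real" where
  "benenti_charpoly g h t =
     (\<Sum>k\<le>CARD('n). t ^ k * (det_weight g h ^ (k + 1) * char_coeff (G_mat g h) k))"

lemma spd_det_pos:
  fixes g h :: "real^'n^'n"
  assumes g: "spd g" and h: "spd h"
  shows "det g / det h > 0" "det h \<noteq> 0" "det g \<noteq> 0"
proof -
  show nz: "det h \<noteq> 0" "det g \<noteq> 0"
    using spd_invertible[OF h] spd_invertible[OF g] invertible_det_nz by blast+
  have gs: "transpose g = g" "transpose h = h" using g h by (auto simp: spd_def)
  obtain v \<gamma> where v: "g_eigenbasis g h v \<gamma>" using g_eigenbasis_exists[OF g gs(2)] .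
  have pos: "\<gamma> j > 0" for j
  proof -
    have "v j \<bullet> (h *v v j) = \<gamma> j" using v by (simp add: g_eigenbasis_def)
    moreover have "v j \<noteq> 0" using v by (metis g_eigenbasis_def inner_zero_left zero_neq_one)
    ultimately show ?thesis using h unfolding spd_def by metis
  qed
  have "(matrix_inv g ** h) *v v j = \<gamma> j *\<^sub>R v j" for j
  proof -
    have "(matrix_inv g ** h) *v v j = matrix_inv g *v (\<gamma> j *\<^sub>R (g *v v j))"
      using v by (simp add: g_eigenbasis_def matrix_vector_mul_assoc[symmetric])
    also have "\<dots> = \<gamma> j *\<^sub>R v j"
      by (simp add: matrix_vector_mult_scaleR matrix_vector_mul_assoc matrix_inv_mult(2)[OF spd_invertible[OF g]])
    finally show ?thesis .
  qed
  from det_diagonalizable[OF v this] have "det (matrix_inv g ** h) > 0" using pos by (simp add: prod_pos)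
  moreover have "det (matrix_inv g) * det g = 1"
    by (metis det_I det_mul matrix_inv_mult(2) spd_invertible[OF g])
  moreover from this have "det (matrix_inv g) = 1 / det g" using nz by (simp add: field_simps)
  ultimately have "det h / det g > 0" by (simp add: det_mul)
  thus "det g / det h > 0" by (auto simp: zero_less_divide_iff)
qed

section \<open>Spectral data of the Benenti tensor at one point\<close>

locale spd_pair =
  fixes g h :: "real^'n^'n"
  assumes g: "spd g" and h: "spd h"
begin

abbreviation "w \<equiv> det_weight g h"
abbreviation "N \<equiv> benenti g h"
abbreviation "f \<equiv> benenti_charpoly g h"

lemma g_sym: "transpose g = g" and h_sym: "transpose h = h" using g h by (auto simp: spd_def)

lemma g_inv: "g ** matrix_inv g = mat 1" "matrix_inv g ** g = mat 1"
  using matrix_inv_mult[OF spd_invertible[OF g]] .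

lemma h_inv: "h ** matrix_inv h = mat 1" "matrix_inv h ** h = mat 1"
  using matrix_inv_mult[OF spd_invertible[OF h]] .

lemma w_pos: "w > 0" using spd_det_pos[OF g h] by (simp add: det_weight_def)

lemma w_power: "w ^ k = (det g / det h) powr (real k / real (CARD('n) + 1))"
proof -
  have "w ^ k = w powr real k" using w_pos by (simp add: powr_realpow)
  thus ?thesis by (simp add: det_weight_def powr_powr mult.commute)
qed

lemma w_power_det: "w ^ (CARD('n) + 1) = det g / det h"
proof -
  have "real (CARD('n) + 1) / real (CARD('n) + 1) = 1" by simp
  thus ?thesis unfolding w_power using powr_one[OF less_imp_le[OF spd_det_pos(1)[OF g h]]] by simp
qed

lemma N_sym: "transpose N = N"
proof -
  have "transpose (g ** matrix_inv h ** g) = g ** matrix_inv h ** g"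
    by (simp add: matrix_transpose_mul g_sym transpose_matrix_inv[OF h_sym spd_invertible[OF h]] matrix_mul_assoc)
  thus ?thesis by (simp add: benenti_def transpose_scalar)
qed

lemma eigenbasis_exists: obtains v \<kappa> where "g_eigenbasis g N v \<kappa>"
  using g_eigenbasis_exists[OF g N_sym] .

context
  fixes v \<kappa> assumes v: "g_eigenbasis g N v \<kappa>"
begin

lemma gv_nonzero: "g *v v j \<noteq> 0"
  using v by (metis g_eigenbasis_def inner_zero_right zero_neq_one)

lemma g_inv_v: "matrix_inv g *v (g *v v j) = v j"
  by (simp add: matrix_vector_mul_assoc g_inv)

lemma g_h: "g *v v j = (w * \<kappa> j) *\<^sub>R (h *v v j)"
proof -
  have "g *v (matrix_inv h *v (g *v v j)) = w *\<^sub>R (N *v v j)"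
    using w_pos by (simp add: benenti_def scaleR_matrix_vector_assoc[symmetric] matrix_vector_mul_assoc matrix_mul_assoc)
  also have "\<dots> = g *v ((w * \<kappa> j) *\<^sub>R v j)"
    using v by (simp add: g_eigenbasis_def matrix_vector_mult_scaleR)
  finally have "matrix_inv g *v (g *v (matrix_inv h *v (g *v v j))) = matrix_inv g *v (g *v ((w * \<kappa> j) *\<^sub>R v j))"
    by simp
  hence "matrix_inv h *v (g *v v j) = (w * \<kappa> j) *\<^sub>R v j"
    by (simp only: matrix_vector_mul_assoc[of "matrix_inv g" g] g_inv matrix_vector_mul_lid)
  hence "h *v (matrix_inv h *v (g *v v j)) = h *v ((w * \<kappa> j) *\<^sub>R v j)" by simp
  thus ?thesis
    by (simp only: matrix_vector_mul_assoc[of h "matrix_inv h"] h_inv matrix_vector_mul_lid matrix_vector_mult_scaleR)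
qed

lemma kappa_nonzero: "\<kappa> j \<noteq> 0"
  using g_h[of j] gv_nonzero[of j] by auto

lemma h_eigen: "h *v v j = (1 / (w * \<kappa> j)) *\<^sub>R (g *v v j)"
  using w_pos kappa_nonzero[of j] by (simp add: g_h)

lemma G_eigen: "G_mat g h *v v j = (1 / (w * \<kappa> j)) *\<^sub>R v j"
proof -
  have "G_mat g h *v v j = matrix_inv g *v (h *v v j)"
    by (simp add: G_mat_def matrix_vector_mul_assoc)
  thus ?thesis unfolding h_eigen by (simp add: matrix_vector_mult_scaleR g_inv_v)
qed

lemma det_G: "det (G_mat g h) * w ^ (CARD('n) + 1) = 1"
proof -
  have "det (matrix_inv g) * det g = 1" by (metis det_I det_mul g_inv(2))
  thus ?thesis unfolding w_power_det using spd_det_pos[OF g h] by (simp add: G_mat_def det_mul)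
qed

lemma w_eq_prod: "w = (\<Prod>j\<in>UNIV. \<kappa> j)"
proof -
  have "det (G_mat g h) = (\<Prod>j\<in>UNIV. 1 / (w * \<kappa> j))" by (rule det_diagonalizable[OF v G_eigen])
  also have "\<dots> = 1 / (w ^ CARD('n) * (\<Prod>j\<in>UNIV. \<kappa> j))" by (simp add: prod_dividef prod.distrib)
  finally have "det (G_mat g h) = 1 / (w ^ CARD('n) * (\<Prod>j\<in>UNIV. \<kappa> j))" .
  with det_G show ?thesis using w_pos kappa_nonzero by (simp add: field_simps)
qed

lemma char_coeff_prod:
  "(\<Sum>i\<le>CARD('n). char_coeff (G_mat g h) i * x ^ (CARD('n) - i)) = (\<Prod>j\<in>UNIV. 1 / (w * \<kappa> j) - x)"
  unfolding char_coeff_eval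
proof (rule det_diagonalizable[OF v])
  show "(G_mat g h - x *\<^sub>R mat 1) *v v j = (1 / (w * \<kappa> j) - x) *\<^sub>R v j" for j
    by (simp add: matrix_vector_mult_diff_rdistrib G_eigen scaleR_matrix_vector_assoc[symmetric] scaleR_diff_left)
qed

text \<open>Substitute x = 1 / (t w) in det (G - x) and absorb the prefactor w = det L into the
  product. The substitution is singular at t = 0, where continuity takes over.\<close>

lemma charpoly_prod: "f t = (\<Prod>j\<in>UNIV. t - \<kappa> j)"
proof -
  have *: "f t = (\<Prod>j\<in>UNIV. t - \<kappa> j)" if t: "t \<noteq> 0" for t
  proof -
    let ?x = "1 / (t * w)" and ?n = "CARD('n)"
    have wt: "w \<noteq> 0" using w_pos by simp
    have e: "t ^ k * (w ^ (k + 1) * c) = w * (t * w) ^ ?n * (c * ?x ^ (?n - k))" if "k \<le> ?n" for k c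
    proof -
      have "(t * w) ^ ?n = (t * w) ^ k * (t * w) ^ (?n - k)" using that by (simp flip: power_add)
      thus ?thesis using t wt by (simp add: power_mult_distrib power_one_over)
    qed
    have "f t = (\<Sum>k\<le>?n. w * (t * w) ^ ?n * (char_coeff (G_mat g h) k * ?x ^ (?n - k)))"
      unfolding benenti_charpoly_def by (rule sum.cong[OF refl]) (simp only: e atMost_iff)
    also have "\<dots> = w * (t * w) ^ ?n * (\<Prod>j\<in>UNIV. 1 / (w * \<kappa> j) - ?x)"
      by (simp add: char_coeff_prod flip: sum_distrib_left)
    also have "(t * w) ^ ?n = (\<Prod>j\<in>(UNIV::'n set). t * w)" by simp
    also have "w * (\<Prod>j\<in>(UNIV::'n set). t * w) * (\<Prod>j\<in>UNIV. 1 / (w * \<kappa> j) - ?x) =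
        (\<Prod>j\<in>UNIV. \<kappa> j) * ((\<Prod>j\<in>(UNIV::'n set). t * w) * (\<Prod>j\<in>UNIV. 1 / (w * \<kappa> j) - ?x))"
      using w_eq_prod by (simp add: mult.assoc)
    also have "\<dots> = (\<Prod>j\<in>UNIV. \<kappa> j * (t * w * (1 / (w * \<kappa> j) - ?x)))"
      by (simp only: prod.distrib)
    also have "\<dots> = (\<Prod>j\<in>UNIV. t - \<kappa> j)"
      by (rule prod.cong) (use t wt kappa_nonzero in \<open>auto simp: field_simps\<close>)
    finally show ?thesis .
  qed
  have "f 0 = (\<Prod>j\<in>UNIV. 0 - \<kappa> j)"
  proof (rule isCont_eq_limit[where a=0])
    show "\<forall>\<^sub>F t in at 0. f t = (\<Prod>j\<in>UNIV. t - \<kappa> j)" using * by (simp add: eventually_at_filter)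
  qed (auto simp: benenti_charpoly_def[abs_def] intro!: continuous_intros)
  with * show ?thesis by (cases "t = 0") auto
qed

lemma matpow_eigen: "matpow (G_mat g h) k *v v j = (1 / (w * \<kappa> j)) ^ k *\<^sub>R v j"
proof (induction k)
  case (Suc k)
  have "matpow (G_mat g h) (Suc k) *v v j = G_mat g h *v (matpow (G_mat g h) k *v v j)"
    by (simp add: matpow_def matrix_vector_mul_assoc)
  thus ?case by (simp add: Suc matrix_vector_mult_scaleR G_eigen mult.commute)
qed (simp add: matpow_def)

definition "s_eig k j = w ^ (k + 2) * (\<Sum>i\<le>k. char_coeff (G_mat g h) i * (1 / (w * \<kappa> j)) ^ (k - i + 1))"

lemma S_eigen: "S_mat g h k *v v j = s_eig k j *\<^sub>R v j"
proof -
  have "S_mat g h k *v v j = w ^ (k + 2) *\<^sub>R (\<Sum>i\<le>k. char_coeff (G_mat g h) i *\<^sub>R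
      ((1 / (w * \<kappa> j)) ^ (k - i + 1) *\<^sub>R v j))"
    unfolding S_mat_def w_power
    by (simp only: scaleR_matrix_vector_assoc[symmetric] sum_matrix_vector[OF finite_atMost] matpow_eigen)
  thus ?thesis by (simp add: s_eig_def flip: scaleR_sum_left)
qed

lemma K_eigen: "K_mat g h k *v (g *v v j) = s_eig k j *\<^sub>R v j"
proof -
  have "K_mat g h k *v (g *v v j) = S_mat g h k *v (matrix_inv g *v (g *v v j))"
    by (simp only: K_mat_def matrix_vector_mul_assoc matrix_mul_assoc)
  thus ?thesis by (simp only: g_inv_v S_eigen)
qed

text \<open>The Horner sums for the characteristic polynomial of G at its eigenvalue 1 / (w
  \<kappa>_j); the n-th one is the value of the polynomial there, hence zero.\<close>

definition "b_eig k j = (\<Sum>i\<le>k. char_coeff (G_mat g h) i * (1 / (w * \<kappa> j)) ^ (k - i))"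

lemma s_b: "s_eig k j = w ^ (k + 2) * (1 / (w * \<kappa> j)) * b_eig k j"
  by (simp add: s_eig_def b_eig_def sum_distrib_left mult_ac)

lemma b_Suc: "b_eig (Suc k) j = (1 / (w * \<kappa> j)) * b_eig k j + char_coeff (G_mat g h) (Suc k)"
proof -
  have "(\<Sum>i\<le>k. char_coeff (G_mat g h) i * (1 / (w * \<kappa> j)) ^ (Suc k - i)) =
      (\<Sum>i\<le>k. (1 / (w * \<kappa> j)) * (char_coeff (G_mat g h) i * (1 / (w * \<kappa> j)) ^ (k - i)))"
    by (rule sum.cong) (auto simp: Suc_diff_le mult_ac)
  thus ?thesis by (simp add: b_eig_def sum_distrib_left)
qed

lemma b_card: "b_eig CARD('n) j = 0"
  unfolding b_eig_def char_coeff_prod by (rule prod_zero) auto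

text \<open>By the Horner recursion, multiplying by \<kappa>_j - t makes the sum telescope. For m =
  n the remainder vanishes and the right-hand side is det (t - L).\<close>

lemma m_telescope:
  "(\<kappa> j - t) * (\<Sum>k<m. t ^ k * s_eig k j) =
     (\<Sum>k\<le>m. t ^ k * (w ^ (k + 1) * char_coeff (G_mat g h) k)) - t ^ m * w ^ (m + 1) * b_eig m j"
proof (induction m)
  case 0 show ?case by (simp add: b_eig_def)
next
  case (Suc m)
  have 1: "\<kappa> j * s_eig m j = w ^ (m + 1) * b_eig m j"
    using kappa_nonzero[of j] w_pos by (simp add: s_b)
  have 2: "s_eig m j = w ^ (m + 2) * (b_eig (Suc m) j - char_coeff (G_mat g h) (Suc m))"
    by (simp add: b_Suc s_b)
  have "(\<kappa> j - t) * (\<Sum>k<Suc m. t ^ k * s_eig k j) =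
     (\<kappa> j - t) * (\<Sum>k<m. t ^ k * s_eig k j) + t ^ m * (\<kappa> j * s_eig m j) - t ^ Suc m * s_eig m j"
    by (simp add: algebra_simps)
  also have "\<dots> = (\<kappa> j - t) * (\<Sum>k<m. t ^ k * s_eig k j) + t ^ m * (w ^ (m + 1) * b_eig m j) -
     t ^ Suc m * (w ^ (m + 2) * (b_eig (Suc m) j - char_coeff (G_mat g h) (Suc m)))"
    unfolding 1 2[symmetric] ..
  finally show ?case unfolding Suc by (simp add: algebra_simps)
qed

text \<open>For t \<noteq> \<kappa>_j divide the telescoped identity by \<kappa>_j - t; both sides
  are polynomials in t, so continuity covers t = \<kappa>_j.\<close>

lemma pencil_eigen: "pencil g h t *v (g *v v j) = - (\<Prod>i\<in>UNIV - {j}. t - \<kappa> i) *\<^sub>R v j"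
proof -
  define m where "m t = (\<Sum>k<CARD('n). t ^ k * s_eig k j)" for t
  have *: "m t = - (\<Prod>i\<in>UNIV - {j}. t - \<kappa> i)" if "t \<noteq> \<kappa> j" for t
  proof -
    have "(\<kappa> j - t) * m t = f t"
      unfolding m_def m_telescope by (simp add: benenti_charpoly_def b_card)
    also have "\<dots> = (t - \<kappa> j) * (\<Prod>i\<in>UNIV - {j}. t - \<kappa> i)"
      unfolding charpoly_prod by (simp add: prod.remove[of UNIV j])
    also have "\<dots> = (\<kappa> j - t) * - (\<Prod>i\<in>UNIV - {j}. t - \<kappa> i)" by (simp add: algebra_simps)
    finally show ?thesis using that by (simp only: mult_left_cancel)
  qed
  have "m (\<kappa> j) = - (\<Prod>i\<in>UNIV - {j}. \<kappa> j - \<kappa> i)"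
    by (rule isCont_eq_limit[where a="\<kappa> j"])
      (auto simp: m_def[abs_def] *[unfolded m_def] eventually_at_filter intro!: continuous_intros)
  with * have "m t = - (\<Prod>i\<in>UNIV - {j}. t - \<kappa> i)" by (cases "t = \<kappa> j") auto
  moreover have "pencil g h t *v (g *v v j) = m t *\<^sub>R v j"
    unfolding pencil_def sum_matrix_vector[OF finite_lessThan] scaleR_matrix_vector_assoc[symmetric]
    by (simp add: K_eigen m_def scaleR_sum_left)
  ultimately show ?thesis by simp
qed

lemma K_symmetric: "transpose (K_mat g h k) = K_mat g h k"
proof (rule g_eigenbasis_matrix_eqI(2)[OF v])
  fix j
  let ?p = "\<lambda>j. g *v v j"
  have vp: "v i \<bullet> ?p l = (if i = l then 1 else 0)" for i l using v by (simp add: g_eigenbasis_def)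
  have "?p i \<bullet> (transpose (K_mat g h k) *v ?p j) = ?p i \<bullet> (K_mat g h k *v ?p j)" for i
    unfolding transpose_dot K_eigen using vp[of i j] vp[of j i] by (simp add: inner_commute)
  hence "x \<bullet> (transpose (K_mat g h k) *v ?p j) = x \<bullet> (K_mat g h k *v ?p j)" for x
    by (subst (1 2) g_eigenbasis_expand(2)[OF v, of x]) (simp add: inner_sum_left del: transpose_matrix_vector)
  thus "transpose (K_mat g h k) *v ?p j = K_mat g h k *v ?p j"
    using vector_eq_ldot by blast
qed

text \<open>The last Horner step expresses the eigenvalue by the constant term c_n = det G, and det
  G is the inverse of w^(n+1). Thus I_{n-1} is minus the squared g-norm of the momentum.\<close>

lemma K_last: "K_mat g h (CARD('n) - 1) = - matrix_inv g"
proof (rule g_eigenbasis_matrix_eqI(2)[OF v])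
  fix j
  obtain m where m: "CARD('n) = Suc m" using not0_implies_Suc[of "CARD('n)"] by auto
  have "s_eig m j = - (w ^ (Suc m + 1) * char_coeff (G_mat g h) (Suc m))"
    using b_Suc[of m j] b_card[of j] by (simp add: s_b m add_eq_0_iff)
  moreover have "char_coeff (G_mat g h) (Suc m) = det (G_mat g h)"
  proof -
    have "det (G_mat g h) = (\<Sum>i\<le>Suc m. char_coeff (G_mat g h) i * 0 ^ (Suc m - i))"
      using char_coeff_eval[of "G_mat g h" 0] by (simp add: m)
    also have "\<dots> = (\<Sum>i\<le>Suc m. if i = Suc m then char_coeff (G_mat g h) i else 0)"
      by (rule sum.cong) (auto simp: power_0_left)
    finally show ?thesis by simp
  qed
  ultimately have "s_eig (CARD('n) - 1) j = - 1" using det_G by (simp add: m mult.commute)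
  thus "K_mat g h (CARD('n) - 1) *v (g *v v j) = - matrix_inv g *v (g *v v j)"
    by (simp add: K_eigen g_inv_v matrix_vector_mult_uminus)
qed

text \<open>The adjugate identity in tensor form. It mentions no eigenvectors and holds at every
  point, so it can be differentiated.\<close>

lemma pencil_benenti: "pencil g h t ** (N - t *\<^sub>R g) = f t *\<^sub>R mat 1"
proof (rule g_eigenbasis_matrix_eqI(1)[OF v])
  fix j
  have "(pencil g h t ** (N - t *\<^sub>R g)) *v v j = pencil g h t *v ((N - t *\<^sub>R g) *v v j)"
    by (simp add: matrix_vector_mul_assoc)
  also have "(N - t *\<^sub>R g) *v v j = (\<kappa> j - t) *\<^sub>R (g *v v j)"
    using v by (simp add: g_eigenbasis_def matrix_vector_mult_diff_rdistrib scaleR_matrix_vector_assoc[symmetric]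
        scaleR_diff_left)
  also have "pencil g h t *v \<dots> = ((t - \<kappa> j) * (\<Prod>i\<in>UNIV - {j}. t - \<kappa> i)) *\<^sub>R v j"
    by (simp add: matrix_vector_mult_scaleR pencil_eigen algebra_simps)
  also have "\<dots> = f t *\<^sub>R v j" unfolding charpoly_prod by (simp add: prod.remove[of UNIV j])
  also have "\<dots> = (f t *\<^sub>R mat 1) *v v j" by (simp add: scaleR_matrix_vector_assoc[symmetric])
  finally show "(pencil g h t ** (N - t *\<^sub>R g)) *v v j = (f t *\<^sub>R mat 1) *v v j" .
qed

end

end


section \<open>First derivatives at a point\<close>

text \<open>In the following two lemmas the indices refer to a \<open>g\<close>-orthonormal eigenbasis of the Benenti tensor with
  eigenvalues \<open>\<kappa>\<close>; \<open>dM t\<close> and \<open>T\<close> are the covariant derivatives of the pencil and of the tensor, the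
  first index being the direction of differentiation.  Everything is read off at \<open>t = \<kappa> i\<close>, where
  all but one of the eigenvalues \<open>m t j\<close> of the pencil vanish.\<close>

lemma simple_spectrum_jet:
  fixes \<kappa> :: "'n::finite \<Rightarrow> real" and dM :: "real \<Rightarrow> 'n \<Rightarrow> 'n \<Rightarrow> 'n \<Rightarrow> real"
    and T :: "'n \<Rightarrow> 'n \<Rightarrow> 'n \<Rightarrow> real" and df :: "real \<Rightarrow> 'n \<Rightarrow> real"
  defines "m \<equiv> \<lambda>t j. - (\<Prod>i\<in>UNIV - {j}. t - \<kappa> i)"
  assumes inj: "inj \<kappa>"
    and E1: "\<And>t l j k. dM t l j k * (\<kappa> k - t) + m t j * T l j k = (if j = k then df t l else 0)"
    and symM: "\<And>t l j k. dM t l j k = dM t l k j" and symT: "\<And>l j k. T l j k = T l k j"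
    and E2: "\<And>t l j k. dM t l j k + dM t j l k + dM t k l j = 0"
    and E3: "\<And>s t l j k. (m s l * dM t l j k - m t l * dM s l j k) + (m s j * dM t j l k - m t j * dM s j l k) +
               (m s k * dM t k l j - m t k * dM s k l j) = 0"
  shows "\<exists>\<l>. (\<forall>l j k. T l j k = (if l = k then \<l> j else 0) + (if l = j then \<l> k else 0)) \<and>
           (\<forall>l. df 0 l = m 0 l * (2 * \<l> l))"
proof -
  have mz: "m (\<kappa> i) j = 0" if "i \<noteq> j" for i j
    unfolding m_def using that by (auto intro: prod_zero)
  have mnz: "m (\<kappa> j) j \<noteq> 0" for j
    unfolding m_def using inj by (auto simp: inj_eq)
  have \<kappa>: "\<kappa> i - \<kappa> j \<noteq> 0" if "i \<noteq> j" for i j using inj that by (auto simp: inj_eq)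
  \<comment> \<open>With three equal indices \<open>E2\<close> gives dM t l l l = 0, so only the
    second term of \<open>E1\<close> is left.\<close>
  have df: "df t l = m t l * T l l l" for t l
    using E1[of t l l l] E2[of t l l l] by simp
  have a: "T j i i = 0" if "i \<noteq> j" for i j
  proof -
    have "m (\<kappa> i) i * T j i i = 0" using E1[of "\<kappa> i" j i i] df[of "\<kappa> i" j] mz[OF that] by simp
    thus ?thesis using mnz by simp
  qed
  have b: "T j l j = T l l l / 2" if "l \<noteq> j" for l j
  proof -
    have "dM (\<kappa> l) l j j * (\<kappa> j - \<kappa> l) = m (\<kappa> l) l * T l l l"
      using E1[of "\<kappa> l" l j j] df[of "\<kappa> l" l] mz[OF that] by simp
    moreover have "dM (\<kappa> l) j l j * (\<kappa> j - \<kappa> l) = - m (\<kappa> l) l * T j l j"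
      using E1[of "\<kappa> l" j l j] that by simp
    moreover have "dM (\<kappa> l) l j j = - 2 * dM (\<kappa> l) j l j" using E2[of "\<kappa> l" l j j] by simp
    ultimately have "m (\<kappa> l) l * (T l l l - 2 * T j l j) = 0" by algebra
    thus ?thesis using mnz by simp
  qed
  \<comment> \<open>At \<open>t = \<kappa> k\<close> the component with derivative index k drops out
    of the Killing relation, which then links the two components of \<open>T\<close> obtained by
    exchanging l and j.\<close>
  have K: "T l j k * (\<kappa> l - \<kappa> k) + T j l k * (\<kappa> j - \<kappa> k) = 0"
    if d: "l \<noteq> j" "l \<noteq> k" "j \<noteq> k" for l j k
  proof -
    let ?m = "m (\<kappa> k) k"
    have 1: "dM (\<kappa> k) l j k * (\<kappa> j - \<kappa> k) = - ?m * T l j k"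
      using E1[of "\<kappa> k" l k j] d symM[of "\<kappa> k" l j k] symT[of l j k] by simp
    have 2: "dM (\<kappa> k) j l k * (\<kappa> l - \<kappa> k) = - ?m * T j l k"
      using E1[of "\<kappa> k" j k l] d symM[of "\<kappa> k" j l k] symT[of j l k] by simp
    have "dM (\<kappa> k) k l j = 0"
      using E1[of "\<kappa> k" k l j] d mz[of k l] \<kappa>[of j k] by simp
    hence 3: "dM (\<kappa> k) j l k = - dM (\<kappa> k) l j k" using E2[of "\<kappa> k" l j k] by linarith
    have "?m * (T l j k * (\<kappa> l - \<kappa> k) + T j l k * (\<kappa> j - \<kappa> k)) = 
      - (dM (\<kappa> k) l j k * (\<kappa> j - \<kappa> k)) * (\<kappa> l - \<kappa> k) - dM (\<kappa> k) j l k * (\<kappa> l - \<kappa> k) * (\<kappa> j - \<kappa> k)"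
      unfolding 1 2 by (simp add: algebra_simps)
    also have "\<dots> = 0" unfolding 3 by simp
    finally show ?thesis using mnz by simp
  qed
  \<comment> \<open>On three distinct indices the Killing relation still admits
    \<open>T l j k\<close> proportional to \<open>\<kappa> k - \<kappa> j\<close> and cyclically.
    The bracket of the members at \<open>\<kappa> j\<close> and \<open>\<kappa> k\<close> supplies
    the missing equation.\<close>
  have P: "T j l k * (\<kappa> l - \<kappa> j) = T k l j * (\<kappa> l - \<kappa> k)"
    if d: "l \<noteq> j" "l \<noteq> k" "j \<noteq> k" for l j k
  proof -
    let ?mj = "m (\<kappa> j) j" and ?mk = "m (\<kappa> k) k"
    have 1: "dM (\<kappa> k) j l k * (\<kappa> l - \<kappa> k) = - ?mk * T j l k"
      using E1[of "\<kappa> k" j k l] d symM[of "\<kappa> k" j l k] symT[of j l k] by simp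
    have 2: "dM (\<kappa> j) k l j * (\<kappa> l - \<kappa> j) = - ?mj * T k l j"
      using E1[of "\<kappa> j" k j l] d symM[of "\<kappa> j" k l j] symT[of k l j] by simp
    have 3: "?mk * dM (\<kappa> j) k l j = ?mj * dM (\<kappa> k) j l k"
      using E3[of "\<kappa> k" l "\<kappa> j" j k] d mz[of k l] mz[of j l] mz[of k j] mz[of j k] by simp
    have "?mj * ?mk * (T j l k * (\<kappa> l - \<kappa> j)) = - (?mj * dM (\<kappa> k) j l k) * (\<kappa> l - \<kappa> k) * (\<kappa> l - \<kappa> j)"
      using 1 by algebra
    also have "\<dots> = ?mj * ?mk * (T k l j * (\<kappa> l - \<kappa> k))" using 2 unfolding 3[symmetric] by algebra
    finally show ?thesis using mnz[of j] mnz[of k] by simp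
  qed
  \<comment> \<open>With its indices renamed, \<open>P\<close> says that the two products in
    \<open>K\<close> are equal, while \<open>K\<close> says that they add up to zero.\<close>
  have c: "T l j k = 0" if d: "l \<noteq> j" "l \<noteq> k" "j \<noteq> k" for l j k
  proof -
    have "T l k j * (\<kappa> k - \<kappa> l) = T j k l * (\<kappa> k - \<kappa> j)" by (rule P) (use d in auto)
    hence "T l j k * (\<kappa> l - \<kappa> k) = T j l k * (\<kappa> j - \<kappa> k)"
      using symT[of l j k] symT[of j l k] by (simp add: algebra_simps)
    hence "T l j k * (\<kappa> l - \<kappa> k) = 0" using K[OF d] by simp
    thus ?thesis using \<kappa> d by simp
  qed
  show ?thesis
  proof (intro exI[of _ "\<lambda>l. T l l l / 2"] conjI allI)
    fix l j k
    show "T l j k = (if l = k then T j j j / 2 else 0) + (if l = j then T k k k / 2 else 0)"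
      using a[of j l] b[of j k] b[of k j] c[of l j k] symT[of l j k] by (cases "l = j"; cases "l = k"; cases "j = k") auto
  qed (simp add: df)
qed

lemma multiple_eigenvalue_jet:
  fixes \<kappa> :: "'n::finite \<Rightarrow> real" and dM :: "real \<Rightarrow> 'n \<Rightarrow> 'n \<Rightarrow> 'n \<Rightarrow> real"
    and T :: "'n \<Rightarrow> 'n \<Rightarrow> 'n \<Rightarrow> real" and df :: "real \<Rightarrow> 'n \<Rightarrow> real"
  defines "m \<equiv> \<lambda>t j. - (\<Prod>i\<in>UNIV - {j}. t - \<kappa> i)"
  assumes mult: "i0 \<noteq> j0" "\<kappa> i0 = \<mu>" "\<kappa> j0 = \<mu>"
    and E1: "\<And>t l j k. dM t l j k * (\<kappa> k - t) + m t j * T l j k = (if j = k then df t l else 0)"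
    and symM: "\<And>t l j k. dM t l j k = dM t l k j"
    and E2: "\<And>t l j k. dM t l j k + dM t j l k + dM t k l j = 0"
    and block: "\<And>l j k. \<kappa> j = \<mu> \<Longrightarrow> \<kappa> k = \<mu> \<Longrightarrow> T l j k = (if j = k then \<theta> l else 0)"
    and cont: "\<And>l j k. isCont (\<lambda>t. dM t l j k) \<mu>"
  shows "dM \<mu> l j k = 0" "m \<mu> j = 0"
proof -
  have m0: "m \<mu> j = 0" for j
  proof -
    have "\<exists>i. i \<noteq> j \<and> \<kappa> i = \<mu>" using mult by metis
    then obtain i where "i \<noteq> j" "\<mu> - \<kappa> i = 0" by auto
    hence "(\<Prod>i\<in>UNIV - {j}. \<mu> - \<kappa> i) = 0" by (intro prod_zero) auto
    thus ?thesis by (simp add: m_def)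
  qed
  thus "m \<mu> j = 0" .
  have "df \<mu> l = 0" for l using E1[of \<mu> l i0 i0] mult m0 by simp
  hence out: "dM \<mu> l j k = 0" if "\<kappa> k \<noteq> \<mu>" for l j k using E1[of \<mu> l j k] m0 that by (auto split: if_splits)
  \<comment> \<open>Inside the block both factors multiplying dM and \<open>T\<close> in
    \<open>E1\<close> vanish at t = \<mu>. The equation is therefore used for t \<noteq> \<mu>,
    followed by a limit.\<close>
  have off: "dM \<mu> l j k = 0" if "j \<noteq> k" for l j k
  proof (cases "\<kappa> j = \<mu> \<and> \<kappa> k = \<mu>")
    case True
    have "dM t l j k = 0" if "t \<noteq> \<mu>" for t
      using E1[of t l j k] True that block[of j k l] \<open>j \<noteq> k\<close> by simp
    hence "\<forall>\<^sub>F t in at \<mu>. dM t l j k = (\<lambda>t. 0) t" by (simp add: eventually_at_filter)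
    from isCont_eq_limit[OF cont _ this] show ?thesis by simp
  next
    case False
    thus ?thesis using out[of k l j] out[of j l k] symM[of \<mu> l j k] by auto
  qed
  have diag: "dM \<mu> l j j = dM \<mu> l k k" if "\<kappa> j = \<mu>" "\<kappa> k = \<mu>" for l j k
  proof (rule isCont_eq_limit[OF cont cont])
    have "dM t l j j = dM t l k k" if "t \<noteq> \<mu>" for t
    proof -
      have mt: "(t - \<mu>) * m t i = - (\<Prod>i\<in>UNIV. t - \<kappa> i)" if "\<kappa> i = \<mu>" for i
        using that by (simp add: m_def prod.remove[of UNIV i])
      have "m t j = m t k" using mt[OF \<open>\<kappa> j = \<mu>\<close>] mt[OF \<open>\<kappa> k = \<mu>\<close>] that
        by (metis mult_left_cancel right_minus_eq)
      moreover have "dM t l i i * (\<mu> - t) = df t l - m t i * \<theta> l" if "\<kappa> i = \<mu>" for i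
        using E1[of t l i i] block[OF that that] that by (simp add: eq_diff_eq)
      ultimately have "dM t l j j * (\<mu> - t) = dM t l k k * (\<mu> - t)"
        using \<open>\<kappa> j = \<mu>\<close> \<open>\<kappa> k = \<mu>\<close> by simp
      thus ?thesis using that by simp
    qed
    thus "\<forall>\<^sub>F t in at \<mu>. dM t l j j = dM t l k k" by (simp add: eventually_at_filter)
  qed
  have "dM \<mu> l j j = 0" for l j
  proof (cases "\<kappa> j = \<mu>")
    case True
    \<comment> \<open>Multiplicity at least two leaves a block index different from the direction l.
      Then \<open>E2\<close> on (l, i, i) ties a diagonal entry to off-diagonal ones, which are
      already zero.\<close>
    obtain i where i: "\<kappa> i = \<mu>" "i \<noteq> l" using mult by metis
    have "dM \<mu> l i i = 0" using E2[of \<mu> l i i] off[of l i i] i by simp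
    thus ?thesis using diag[OF True i(1)] by simp
  qed (rule out)
  with off show "dM \<mu> l j k = 0" by (cases "j = k") auto
qed

text \<open>The Poisson relations are cubic in one momentum. Full polarization sums over six
  orderings, and the symmetry in the last two slots leaves each choice of first slot twice.\<close>

lemma cubic_polarization:
  fixes Q :: "'a::real_vector \<Rightarrow> 'a \<Rightarrow> 'a \<Rightarrow> real"
  assumes add: "\<And>a b x y. Q (a + b) x y = Q a x y + Q b x y" "\<And>x a b y. Q x (a + b) y = Q x a y + Q x b y"
    and sym: "\<And>a x y. Q a x y = Q a y x" and zero: "\<And>p. Q p p p = 0"
  shows "Q a b c + Q b a c + Q c a b = 0"
proof -
  have add': "Q x y (a + b) = Q x y a + Q x y b" for x y a b using add(2) sym by metis
  note A = add add'
  have pair: "Q a a b + Q a b a + Q b a a + Q a b b + Q b a b + Q b b a = 0" for a b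
    using zero[of "a + b"] zero[of a] zero[of b] by (simp add: A)
  show ?thesis
    using zero[of "a + b + c"] zero[of a] zero[of b] zero[of c] pair[of a b] pair[of a c] pair[of b c]
      sym[of a b c] sym[of b a c] sym[of c a b] by (simp add: A)
qed

text \<open>The first derivatives at a point of all the tensors involved, in the direction of a vector.  The
  matrices \<open>C v\<close> are those of the Levi-Civita connection of \<open>g\<close>.\<close>

locale metric_jet = spd_pair g h for g h :: "real^'n^'n" +
  fixes C g' N' :: "real^'n \<Rightarrow> real^'n^'n" and K' :: "nat \<Rightarrow> real^'n \<Rightarrow> real^'n^'n"
    and f' :: "real \<Rightarrow> real^'n \<Rightarrow> real"
  assumes lin: "linear C" "linear N'" "\<And>k. linear (K' k)"
    and metric: "\<And>u. g' u = transpose (C u) ** g + g ** C u"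
    and torsion: "\<And>u x. C u *v x = C x *v u"
    and sym': "\<And>u. transpose (N' u) = N' u" "\<And>k u. transpose (K' k u) = K' k u"
    and leibniz: "\<And>t u. (\<Sum>k<CARD('n). t ^ k *\<^sub>R K' k u) ** (N - t *\<^sub>R g) + pencil g h t ** (N' u - t *\<^sub>R g' u) =
                    f' t u *\<^sub>R mat 1"
    and K_last': "\<And>u. K' (CARD('n) - 1) u = matrix_inv g ** g' u ** matrix_inv g"
    and poisson: "\<And>k l p. k < CARD('n) \<Longrightarrow> l < CARD('n) \<Longrightarrow>
        p \<bullet> (K' k (K_mat g h l *v p) *v p) = p \<bullet> (K' l (K_mat g h k *v p) *v p)"
begin

abbreviation "M \<equiv> pencil g h"

definition "M' t u = (\<Sum>k<CARD('n). t ^ k *\<^sub>R K' k u)"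

text \<open>The covariant derivative of a tensor with two upper indices, hence the plus signs; in
  \<open>nabla_N\<close> both indices are lower.\<close>

definition "nabla_M t u = M' t u + C u ** M t + M t ** transpose (C u)"

definition "nabla_N u = N' u - transpose (C u) ** N - N ** C u"

lemma M_mv: "M t *v p = (\<Sum>k<CARD('n). t ^ k *\<^sub>R (K_mat g h k *v p))"
  by (simp add: pencil_def sum_matrix_vector scaleR_matrix_vector_assoc)

lemma M'_mv: "M' t u *v p = (\<Sum>k<CARD('n). t ^ k *\<^sub>R (K' k u *v p))"
  by (simp add: M'_def sum_matrix_vector scaleR_matrix_vector_assoc)

lemma linear_M': "linear (M' t)"
  unfolding M'_def by (intro linear_compose_sum linear_compose_scale_right lin ballI)

lemma M_sym: "transpose (M t) = M t"
proof -
  obtain v \<kappa> where v: "g_eigenbasis g N v \<kappa>" by (rule eigenbasis_exists)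
  show ?thesis using K_symmetric[OF v]
    by (simp add: vec_eq_iff pencil_def transpose_def)
qed

lemma M'_sym: "transpose (M' t u) = M' t u"
  using sym'(2) by (simp add: vec_eq_iff M'_def transpose_def)

lemma nabla_M_sym: "transpose (nabla_M t u) = nabla_M t u"
  by (simp add: nabla_M_def transpose_add M_sym M'_sym matrix_transpose_mul)

lemma nabla_N_sym: "transpose (nabla_N u) = nabla_N u"
  by (simp add: nabla_N_def transpose_diff N_sym sym' matrix_transpose_mul)

lemma linear_nabla_M: "linear (nabla_M t)"
  unfolding nabla_M_def by (intro linear_compose_add linear_M' linear_matrix_mult lin)

lemma poisson_M: "p \<bullet> (M' t (M s *v p) *v p) = p \<bullet> (M' s (M t *v p) *v p)"
proof -
  have expand: "p \<bullet> (M' t (M s *v p) *v p) =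
      (\<Sum>k<CARD('n). \<Sum>l<CARD('n). t ^ k * s ^ l * (p \<bullet> (K' k (K_mat g h l *v p) *v p)))" for s t
  proof -
    have "K' k (M s *v p) = (\<Sum>l<CARD('n). s ^ l *\<^sub>R K' k (K_mat g h l *v p))" for k
      unfolding M_mv by (simp add: linear_sum[OF lin(3)] linear_scale[OF lin(3)])
    thus ?thesis
      by (simp add: M'_mv sum_matrix_vector inner_sum_right scaleR_sum_right scaleR_matrix_vector_assoc[symmetric] mult.assoc)
  qed
  show ?thesis unfolding expand
    by (subst sum.swap) (intro sum.cong refl, simp add: poisson)
qed

lemma nabla_M_quad: "p \<bullet> (nabla_M t u *v p) = p \<bullet> (M' t u *v p) + 2 * (p \<bullet> (C u *v (M t *v p)))"
proof -
  have "p \<bullet> ((M t ** transpose (C u)) *v p) = (M t *v p) \<bullet> (transpose (C u) *v p)"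
    using symmetric_dot[OF M_sym, of p t "transpose (C u) *v p"]
    by (simp add: matrix_vector_mul_assoc[symmetric] inner_commute)
  also have "\<dots> = p \<bullet> (C u *v (M t *v p))" unfolding transpose_dot by (rule inner_commute)
  finally show ?thesis
    by (simp add: nabla_M_def matrix_vector_mult_add_rdistrib inner_add_right matrix_vector_mul_assoc)
qed

text \<open>Passing from partial to covariant derivatives adds twice p \<bullet> C (M s p) (M t p)
  on one side and the same with s and t exchanged on the other; these agree because the connection
  has no torsion.\<close>

lemma bracket: "p \<bullet> (nabla_M t (M s *v p) *v p) = p \<bullet> (nabla_M s (M t *v p) *v p)"
  unfolding nabla_M_quad poisson_M[of p t s] torsion[of "M s *v p" "M t *v p"] ..

text \<open>The counterpart of \<open>bracket\<close> with \<open>K_mat g h (CARD('n) - 1)\<close>,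
  that is minus the inverse metric, in place of \<open>M s\<close>. The metric is parallel, so the
  other side contributes nothing.\<close>

lemma killing: "p \<bullet> (nabla_M t (matrix_inv g *v p) *v p) = 0"
proof -
  let ?i = "matrix_inv g" and ?n = "CARD('n) - 1"
  have K: "K' ?n u = ?i ** transpose (C u) + C u ** ?i" for u
  proof -
    have "K' ?n u = ?i ** transpose (C u) ** (g ** ?i) + (?i ** g) ** C u ** ?i"
      unfolding K_last' metric by (simp add: matrix_add_ldistrib matrix_matrix_add_rdistrib matrix_mul_assoc)
    thus ?thesis by (simp add: g_inv)
  qed
  have quad: "p \<bullet> (K' ?n u *v p) = 2 * (p \<bullet> (C u *v (?i *v p)))" for u
  proof -
    have "p \<bullet> ((?i ** transpose (C u)) *v p) = (?i *v p) \<bullet> (transpose (C u) *v p)"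
      using symmetric_dot[OF transpose_matrix_inv[OF g_sym spd_invertible[OF g]], of p "transpose (C u) *v p"]
      by (simp add: matrix_vector_mul_assoc[symmetric] inner_commute)
    also have "\<dots> = p \<bullet> (C u *v (?i *v p))" unfolding transpose_dot by (rule inner_commute)
    finally show ?thesis unfolding K
      by (simp add: matrix_vector_mult_add_rdistrib inner_add_right matrix_vector_mul_assoc)
  qed
  obtain v \<kappa> where v: "g_eigenbasis g N v \<kappa>" by (rule eigenbasis_exists)
  have "p \<bullet> (M' t (K_mat g h ?n *v p) *v p) = p \<bullet> (K' ?n (M t *v p) *v p)"
  proof -
    have "p \<bullet> (M' t (K_mat g h ?n *v p) *v p) =
        (\<Sum>k<CARD('n). t ^ k * (p \<bullet> (K' ?n (K_mat g h k *v p) *v p)))"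
      by (simp add: M'_mv inner_sum_right poisson)
    also have "\<dots> = p \<bullet> (K' ?n (M t *v p) *v p)"
      unfolding M_mv by (simp add: linear_sum[OF lin(3)] linear_scale[OF lin(3)] sum_matrix_vector inner_sum_right
          scaleR_matrix_vector_assoc[symmetric])
    finally show ?thesis .
  qed
  hence "- (p \<bullet> (M' t (?i *v p) *v p)) = 2 * (p \<bullet> (C (M t *v p) *v (?i *v p)))"
    unfolding quad K_last[OF v] by (simp add: matrix_vector_mult_uminus linear_neg[OF linear_M'])
  thus ?thesis unfolding nabla_M_quad torsion[of "?i *v p" "M t *v p"] by simp
qed

section \<open>Covariant derivatives in components of an eigenbasis\<close>

context
  fixes v \<kappa> assumes v: "g_eigenbasis g N v \<kappa>"
begin

definition "m t j = - (\<Prod>i\<in>UNIV - {j}. t - \<kappa> i)"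
definition "dM t l j k = (g *v v j) \<bullet> (nabla_M t (v l) *v (g *v v k))"
definition "T l j k = v j \<bullet> (nabla_N (v l) *v v k)"
definition "c l j k = (g *v v j) \<bullet> (C (v l) *v v k)"

lemma gv: "v j \<bullet> (g *v v k) = (if j = k then 1 else 0)" "(g *v v j) \<bullet> v k = (if j = k then 1 else 0)"
  using v unfolding g_eigenbasis_def by (auto simp: inner_commute)

lemma Nv: "N *v v k = \<kappa> k *\<^sub>R (g *v v k)" using v unfolding g_eigenbasis_def by auto

lemma Mgv: "M t *v (g *v v j) = m t j *\<^sub>R v j"
  unfolding m_def by (rule pencil_eigen[OF v])

lemma gM_dot: "(g *v v j) \<bullet> (M t *v x) = m t j * (v j \<bullet> x)"
  by (metis Mgv M_sym symmetric_dot inner_commute inner_scaleR_left)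

lemma dM_sym: "dM t l j k = dM t l k j"
  unfolding dM_def by (rule symmetric_dot[OF nabla_M_sym])

lemma T_sym: "T l j k = T l k j"
  unfolding T_def by (rule symmetric_dot[OF nabla_N_sym])

lemma CT_dot: "v j \<bullet> (transpose (C (v l)) *v (g *v v k)) = c l k j"
  unfolding transpose_dot c_def by (rule inner_commute)

lemma g'_comp: "v j \<bullet> (g' (v l) *v v k) = c l j k + c l k j"
proof -
  have "v j \<bullet> (g *v (C (v l) *v v k)) = c l j k"
    unfolding c_def using symmetric_dot[OF g_sym] by (metis inner_commute)
  thus ?thesis
    by (simp add: metric matrix_vector_mult_add_rdistrib inner_add_right matrix_vector_mul_assoc[symmetric] CT_dot
        del: transpose_matrix_vector)
qed

lemma N'_comp: "v j \<bullet> (N' (v l) *v v k) = T l j k + \<kappa> k * c l k j + \<kappa> j * c l j k"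
proof -
  have "v j \<bullet> (N *v (C (v l) *v v k)) = \<kappa> j * c l j k"
    unfolding c_def using symmetric_dot[OF N_sym, of "v j"] Nv[of j] by (simp add: inner_commute)
  thus ?thesis
    by (simp add: T_def nabla_N_def matrix_vector_mult_diff_rdistrib inner_diff_right
        matrix_vector_mul_assoc[symmetric] Nv matrix_vector_mult_scaleR CT_dot del: transpose_matrix_vector)
qed

text \<open>The product rule is stated for partial derivatives. The connection coefficients cancel
  because (t - \<kappa>_j) m t j is the same for all j, namely minus the characteristic
  polynomial.\<close>

lemma jet_leibniz: "dM t l j k * (\<kappa> k - t) + m t j * T l j k = (if j = k then f' t (v l) else 0)"
proof -
  let ?p = "\<lambda>j. g *v v j"
  have "?p j \<bullet> (M' t (v l) *v ((N - t *\<^sub>R g) *v v k)) + ?p j \<bullet> (M t *v ((N' (v l) - t *\<^sub>R g' (v l)) *v v k)) =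
      ?p j \<bullet> ((f' t (v l) *\<^sub>R mat 1) *v v k)"
    unfolding leibniz[symmetric] M'_def
    by (simp add: matrix_vector_mult_add_rdistrib inner_add_right matrix_vector_mul_assoc)
  also have "\<dots> = (if j = k then f' t (v l) else 0)"
    by (simp add: scaleR_matrix_vector_assoc[symmetric] gv)
  also have "(N - t *\<^sub>R g) *v v k = (\<kappa> k - t) *\<^sub>R ?p k"
    by (simp add: Nv matrix_vector_mult_diff_rdistrib scaleR_matrix_vector_assoc[symmetric] scaleR_diff_left)
  also have "?p j \<bullet> (M t *v ((N' (v l) - t *\<^sub>R g' (v l)) *v v k)) =
      m t j * (T l j k + \<kappa> k * c l k j + \<kappa> j * c l j k - t * (c l j k + c l k j))"
    unfolding gM_dot N'_comp[symmetric] g'_comp[symmetric]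
    by (simp add: matrix_vector_mult_diff_rdistrib scaleR_matrix_vector_assoc[symmetric] inner_diff_right)
  also have "?p j \<bullet> (M' t (v l) *v ((\<kappa> k - t) *\<^sub>R ?p k)) = (\<kappa> k - t) * (dM t l j k - m t k * c l j k - m t j * c l k j)"
  proof -
    have "?p j \<bullet> ((M t ** transpose (C (v l))) *v ?p k) = m t j * c l k j"
      by (simp add: matrix_vector_mul_assoc[symmetric] gM_dot CT_dot del: transpose_matrix_vector)
    moreover have "?p j \<bullet> ((C (v l) ** M t) *v ?p k) = m t k * c l j k"
      by (simp add: matrix_vector_mul_assoc[symmetric] Mgv matrix_vector_mult_scaleR c_def)
    ultimately show ?thesis
      by (simp add: dM_def nabla_M_def matrix_vector_mult_add_rdistrib inner_add_right matrix_vector_mult_scaleR)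
  qed
  finally have 1: "(\<kappa> k - t) * (dM t l j k - m t k * c l j k - m t j * c l k j) +
    m t j * (T l j k + \<kappa> k * c l k j + \<kappa> j * c l j k - t * (c l j k + c l k j)) = (if j = k then f' t (v l) else 0)" .
  have "(t - \<kappa> i) * m t i = - (\<Prod>i\<in>UNIV. t - \<kappa> i)" for i
    by (simp add: m_def prod.remove[of UNIV i])
  hence "(t - \<kappa> k) * m t k = (t - \<kappa> j) * m t j" by simp
  hence 2: "(\<kappa> k - t) * m t k = (\<kappa> j - t) * m t j" by (simp add: algebra_simps)
  have "(\<kappa> k - t) * (dM t l j k - m t k * c l j k - m t j * c l k j) +
    m t j * (T l j k + \<kappa> k * c l k j + \<kappa> j * c l j k - t * (c l j k + c l k j)) = 
    dM t l j k * (\<kappa> k - t) + m t j * T l j k + ((\<kappa> j - t) * m t j - (\<kappa> k - t) * m t k) * c l j k"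
    by (simp add: algebra_simps)
  with 1 2 show ?thesis by simp
qed

lemma jet_killing: "dM t l j k + dM t j l k + dM t k l j = 0"
proof -
  define Q where "Q a x y = x \<bullet> (nabla_M t (matrix_inv g *v a) *v y)" for a x y
  have "Q (g *v v l) (g *v v j) (g *v v k) + Q (g *v v j) (g *v v l) (g *v v k) +
     Q (g *v v k) (g *v v l) (g *v v j) = 0"
  proof (rule cubic_polarization[of Q])
    show "Q (a + b) x y = Q a x y + Q b x y" for a b x y
      by (simp add: Q_def matrix_vector_right_distrib linear_add[OF linear_nabla_M]
          matrix_vector_mult_add_rdistrib inner_add_right)
    show "Q a x y = Q a y x" for a x y unfolding Q_def by (rule symmetric_dot[OF nabla_M_sym])
  qed (simp_all add: Q_def inner_add_left killing)
  thus ?thesis by (simp add: Q_def dM_def matrix_vector_mul_assoc[of "matrix_inv g"] g_inv)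
qed

lemma jet_bracket:
  "(m s l * dM t l j k - m t l * dM s l j k) + (m s j * dM t j l k - m t j * dM s j l k) +
     (m s k * dM t k l j - m t k * dM s k l j) = 0"
proof -
  define Q where "Q a x y = x \<bullet> (nabla_M t (M s *v a) *v y) - x \<bullet> (nabla_M s (M t *v a) *v y)" for a x y
  have "Q (g *v v l) (g *v v j) (g *v v k) + Q (g *v v j) (g *v v l) (g *v v k) +
     Q (g *v v k) (g *v v l) (g *v v j) = 0"
  proof (rule cubic_polarization[of Q])
    show "Q (a + b) x y = Q a x y + Q b x y" for a b x y
      by (simp add: Q_def matrix_vector_right_distrib linear_add[OF linear_nabla_M]
          matrix_vector_mult_add_rdistrib inner_add_right)
    show "Q a x y = Q a y x" for a x y unfolding Q_def
      using symmetric_dot[OF nabla_M_sym] by metis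
  qed (simp_all add: Q_def inner_add_left bracket)
  thus ?thesis
    by (simp add: Q_def dM_def Mgv linear_scale[OF linear_nabla_M] scaleR_matrix_vector_assoc[symmetric])
qed

lemma linear_zero_on_eigenbasis:
  fixes F :: "real^'n \<Rightarrow> real"
  assumes "linear F" "\<And>j. F (v j) = 0"
  shows "F x = 0"
  by (subst g_eigenbasis_expand(1)[OF v, of x])
    (simp add: linear_sum[OF assms(1)] linear_scale[OF assms(1)] assms(2))

lemma linear_zero_on_dual_eigenbasis:
  fixes F :: "real^'n \<Rightarrow> real"
  assumes "linear F" "\<And>j. F (g *v v j) = 0"
  shows "F x = 0"
  by (subst g_eigenbasis_expand(2)[OF v, of x])
    (simp add: linear_sum[OF assms(1)] linear_scale[OF assms(1)] assms(2))

text \<open>Between eigenvectors for \<mu> the connection terms of \<open>N'\<close> and of \<mu>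
  \<open>g'\<close> cancel, so \<open>block\<close> is a statement on the covariant derivative
  although it does not mention the connection. In the other direction, \<open>M \<mu> = 0\<close>
  makes the covariant derivative of the pencil equal to the partial one.\<close>

lemma pencil_zero_at_multiple_eigenvalue:
  assumes mult: "i0 \<noteq> j0" "\<kappa> i0 = \<mu>" "\<kappa> j0 = \<mu>"
    and block: "\<And>u j k. \<kappa> j = \<mu> \<Longrightarrow> \<kappa> k = \<mu> \<Longrightarrow>
       v j \<bullet> ((N' u - \<mu> *\<^sub>R g' u) *v v k) = (if j = k then \<theta> u else 0)"
  shows "M \<mu> = 0" "M' \<mu> u = 0"
proof -
  have T: "T l j k = (if j = k then \<theta> (v l) else 0)" if "\<kappa> j = \<mu>" "\<kappa> k = \<mu>" for l j k
    unfolding block[OF that, symmetric]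
    by (simp add: matrix_vector_mult_diff_rdistrib inner_diff_right scaleR_matrix_vector_assoc[symmetric]
        N'_comp g'_comp that algebra_simps)
  have cont: "isCont (\<lambda>t. dM t l j k) \<mu>" for l j k
  proof -
    have "dM t l j k = (\<Sum>i<CARD('n). t ^ i * ((g *v v j) \<bullet> (K' i (v l) *v (g *v v k)))) +
        m t k * c l j k + m t j * c l k j" for t
      by (simp add: dM_def nabla_M_def matrix_vector_mult_add_rdistrib inner_add_right M'_mv inner_sum_right
        matrix_vector_mul_assoc[symmetric] Mgv matrix_vector_mult_scaleR c_def[symmetric] gM_dot CT_dot
        del: transpose_matrix_vector)
    thus ?thesis by (auto simp: m_def intro!: continuous_intros)
  qed
  note J = multiple_eigenvalue_jet[OF mult, of dM T "\<lambda>t l. f' t (v l)" "\<lambda>l. \<theta> (v l)", folded m_def]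
  have R: "dM \<mu> l j k = 0" "m \<mu> j = 0" for l j k
    by (rule J; (rule jet_leibniz dM_sym jet_killing cont | erule (1) T))+
  show M0: "M \<mu> = 0" by (rule g_eigenbasis_matrix_eqI(2)[OF v]) (simp add: Mgv R(2))
  have "x \<bullet> (M' \<mu> u *v y) = 0" for x y
  proof (rule linear_zero_on_eigenbasis[of "\<lambda>u. x \<bullet> (M' \<mu> u *v y)"])
    show "linear (\<lambda>u. x \<bullet> (M' \<mu> u *v y))"
      using linear_M'[of \<mu>] unfolding linear_iff
      by (simp add: matrix_vector_mult_add_rdistrib inner_add_right scaleR_matrix_vector_assoc[symmetric])
    fix l
    show "x \<bullet> (M' \<mu> (v l) *v y) = 0"
    proof (rule linear_zero_on_dual_eigenbasis[of "\<lambda>x. x \<bullet> (M' \<mu> (v l) *v y)"])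
      show "linear (\<lambda>x. x \<bullet> (M' \<mu> (v l) *v y))" by (simp add: linear_iff inner_add_left)
      fix j
      show "(g *v v j) \<bullet> (M' \<mu> (v l) *v y) = 0"
      proof (rule linear_zero_on_dual_eigenbasis[of "\<lambda>y. (g *v v j) \<bullet> (M' \<mu> (v l) *v y)"])
        show "linear (\<lambda>y. (g *v v j) \<bullet> (M' \<mu> (v l) *v y))"
          by (simp add: linear_iff inner_add_right matrix_vector_right_distrib matrix_vector_mult_scaleR)
        have "nabla_M \<mu> (v l) = M' \<mu> (v l)"
          unfolding nabla_M_def M0 by (simp add: vec_eq_iff matrix_matrix_mult_def)
        thus "(g *v v j) \<bullet> (M' \<mu> (v l) *v (g *v v k)) = 0" for k
          using R(1)[of l j k] unfolding dM_def by simp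
      qed
    qed
  qed
  hence "M' \<mu> u *v y = 0" for y using inner_eq_zero_iff by blast
  thus "M' \<mu> u = 0" by (metis matrix_eq matrix_vector_mult_0)
qed

text \<open>\<open>hZ\<close> and \<open>wN\<close> are the product rules for h Z = g and w N = g Z,
  where Z is the inverse of h times g; eliminating \<open>Z'\<close> expresses \<open>h'\<close> by
  \<open>T\<close> and \<open>w'\<close>. The conclusion says that h is compatible with the
  connection C u x + \<phi> u x + \<phi> x u.\<close>

lemma derivative_at_simple_spectrum:
  assumes inj: "inj \<kappa>" and lin': "linear h'" "linear w'"
    and hZ: "\<And>u. h' u ** (matrix_inv h ** g) + h ** Z' u = g' u"
    and wN: "\<And>u. w' u *\<^sub>R N + w *\<^sub>R N' u = g' u ** (matrix_inv h ** g) + g ** Z' u"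
    and f0: "\<And>u. f' 0 u = (-1) ^ CARD('n) * w' u"
  defines "\<phi> \<equiv> \<lambda>u. - w' u / (2 * w)"
  shows "x \<bullet> (h' u *v y) = (C u *v x + \<phi> u *\<^sub>R x + \<phi> x *\<^sub>R u) \<bullet> (h *v y) + (h *v x) \<bullet> (C u *v y + \<phi> u *\<^sub>R y + \<phi> y *\<^sub>R u)"
proof -
  obtain \<l> where l: "\<And>l j k. T l j k = (if l = k then \<l> j else 0) + (if l = j then \<l> k else 0)"
    "\<And>l. f' 0 (v l) = m 0 l * (2 * \<l> l)"
    using simple_spectrum_jet[OF inj, of dM T "\<lambda>t l. f' t (v l)", folded m_def,
      OF jet_leibniz dM_sym T_sym jet_killing jet_bracket] by blast
  have wpos: "w > 0" by (rule w_pos)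
  have \<kappa>: "\<kappa> j \<noteq> 0" for j by (rule kappa_nonzero[OF v])
  \<comment> \<open>Both \<open>f 0\<close> and \<open>\<kappa> l * m 0 l\<close> equal (-1)^n w, so
    the formula for the derivative of \<open>f 0\<close> becomes one for the logarithmic derivative
    of w.\<close>
  have w'l: "w' (v l) = 2 * w * \<l> l / \<kappa> l" for l
  proof -
    have "(-1) ^ CARD('n) * w = (\<Prod>j\<in>UNIV. - 1 * \<kappa> j)"
      unfolding w_eq_prod[OF v] prod.distrib by simp
    also have "\<dots> = - \<kappa> l * (\<Prod>j\<in>UNIV - {l}. - 1 * \<kappa> j)" by (simp add: prod.remove[of UNIV l])
    finally have "\<kappa> l * m 0 l = (-1) ^ CARD('n) * w" by (simp add: m_def)
    hence "\<kappa> l * ((-1) ^ CARD('n) * w' (v l)) = (-1) ^ CARD('n) * w * (2 * \<l> l)"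
      unfolding f0[symmetric] l(2) by (simp add: mult.assoc[symmetric])
    hence "(-1) ^ CARD('n) * (\<kappa> l * w' (v l)) = (-1) ^ CARD('n) * (w * (2 * \<l> l))" by (simp only: mult_ac)
    hence "\<kappa> l * w' (v l) = w * (2 * \<l> l)" by simp
    thus ?thesis using \<kappa>[of l] by (simp add: field_simps)
  qed
  hence \<phi>l: "\<phi> (v l) = - \<l> l / \<kappa> l" for l using wpos by (simp add: \<phi>_def)
  let ?e = "\<lambda>j. 1 / (w * \<kappa> j)"
  have hv: "h *v v j = ?e j *\<^sub>R (g *v v j)" for j by (rule h_eigen[OF v])
  have Zv: "(matrix_inv h ** g) *v v j = (w * \<kappa> j) *\<^sub>R v j" for j
  proof -
    have "(matrix_inv h ** g) *v v j = matrix_inv h *v ((w * \<kappa> j) *\<^sub>R (h *v v j))"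
      by (simp add: matrix_vector_mul_assoc[symmetric] g_h[OF v])
    thus ?thesis by (simp add: matrix_vector_mult_scaleR matrix_vector_mul_assoc h_inv)
  qed
  have h'_comp: "v j \<bullet> (h' (v l) *v v k) = ?e j * c l j k + ?e k * c l k j -
      T l j k / (w * \<kappa> j * \<kappa> k) - (if j = k then w' (v l) / (w * w * \<kappa> k) else 0)" for l j k
  proof -
    have "v j \<bullet> ((h' (v l) ** (matrix_inv h ** g) + h ** Z' (v l)) *v v k) = c l j k + c l k j"
      unfolding hZ g'_comp ..
    moreover have "v j \<bullet> ((h ** Z' (v l)) *v v k) = ?e j * ((g *v v j) \<bullet> (Z' (v l) *v v k))"
      using symmetric_dot[OF h_sym, of "v j"] by (simp add: matrix_vector_mul_assoc[symmetric] hv inner_commute)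
    ultimately have 1: "w * \<kappa> k * (v j \<bullet> (h' (v l) *v v k)) + ?e j * ((g *v v j) \<bullet> (Z' (v l) *v v k)) = c l j k + c l k j"
      by (simp add: matrix_vector_mult_add_rdistrib inner_add_right matrix_vector_mul_assoc[of "h' (v l)", symmetric]
          Zv matrix_vector_mult_scaleR)
    have "v j \<bullet> ((w' (v l) *\<^sub>R N + w *\<^sub>R N' (v l)) *v v k) =
       v j \<bullet> ((g' (v l) ** (matrix_inv h ** g) + g ** Z' (v l)) *v v k)" unfolding wN ..
    moreover have "v j \<bullet> ((g ** Z' (v l)) *v v k) = (g *v v j) \<bullet> (Z' (v l) *v v k)"
      using symmetric_dot[OF g_sym, of "v j"] by (simp add: matrix_vector_mul_assoc[symmetric] inner_commute)
    ultimately have 2: "w' (v l) * (\<kappa> k * (if j = k then 1 else 0)) + w * (T l j k + \<kappa> k * c l k j + \<kappa> j * c l j k) =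
        w * \<kappa> k * (c l j k + c l k j) + (g *v v j) \<bullet> (Z' (v l) *v v k)"
      by (simp add: matrix_vector_mult_add_rdistrib inner_add_right matrix_vector_mul_assoc[of "g' (v l)", symmetric]
          Zv matrix_vector_mult_scaleR scaleR_matrix_vector_assoc[symmetric] Nv gv N'_comp g'_comp)
    have "v j \<bullet> (h' (v l) *v v k) = w * \<kappa> k * (v j \<bullet> (h' (v l) *v v k)) / (w * \<kappa> k)"
      using \<kappa>[of k] wpos by simp
    also have "w * \<kappa> k * (v j \<bullet> (h' (v l) *v v k)) = c l j k + c l k j - ?e j * (w' (v l) * (\<kappa> k * (if j = k then 1 else 0)) +
        w * (T l j k + \<kappa> k * c l k j + \<kappa> j * c l j k) - w * \<kappa> k * (c l j k + c l k j))"
      using 1 unfolding 2 by (simp add: algebra_simps)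
    finally have h'_jk: "v j \<bullet> (h' (v l) *v v k) = (c l j k + c l k j - ?e j * (w' (v l) * (\<kappa> k * (if j = k then 1 else 0)) +
        w * (T l j k + \<kappa> k * c l k j + \<kappa> j * c l j k) - w * \<kappa> k * (c l j k + c l k j))) / (w * \<kappa> k)" .
    show ?thesis unfolding h'_jk using \<kappa>[of j] \<kappa>[of k] wpos by (cases "j = k") (auto simp: field_simps)
  qed
  \<comment> \<open>The defect of the claim is linear in each of its three arguments, so it may be
    tested on eigenvectors.\<close>
  define R where "R u x y = x \<bullet> (h' u *v y) - (C u *v x + \<phi> u *\<^sub>R x + \<phi> x *\<^sub>R u) \<bullet> (h *v y) -
      (h *v x) \<bullet> (C u *v y + \<phi> u *\<^sub>R y + \<phi> y *\<^sub>R u)" for u x y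
  have lin\<phi>: "linear \<phi>"
    using linear_compose_scale_right[OF lin'(2), of "- 1 / (2 * w)"] by (simp add: \<phi>_def)
  note L = linear_add[OF lin\<phi>] linear_scale[OF lin\<phi>] linear_add[OF lin(1)] linear_scale[OF lin(1)]
    linear_add[OF lin'(1)] linear_scale[OF lin'(1)]
  have R_lin: "linear (\<lambda>u. R u x y)" "linear (\<lambda>x. R u x y)" "linear (\<lambda>y. R u x y)" for u x y
    unfolding linear_iff R_def
    by (simp_all add: L algebra_simps inner_add_left inner_add_right matrix_vector_right_distrib
        matrix_vector_mult_add_rdistrib scaleR_matrix_vector_assoc[symmetric] matrix_vector_mult_scaleR)
  have "R (v l) (v j) (v k) = 0" for l j k
  proof -
    have 1: "(C (v l) *v v j) \<bullet> (h *v v k) = ?e k * c l k j"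
      by (simp add: hv c_def inner_commute)
    have 2: "(h *v v j) \<bullet> (C (v l) *v v k) = ?e j * c l j k"
      by (simp add: hv c_def)
    have 3: "v i \<bullet> (h *v v k) = (if i = k then ?e k else 0)" "(h *v v i) \<bullet> v k = (if i = k then ?e k else 0)" for i k
      by (auto simp: hv gv)
    have "R (v l) (v j) (v k) = - T l j k / (w * \<kappa> j * \<kappa> k) - (if j = k then w' (v l) / (w * w * \<kappa> k) else 0)
       - (if j = k then \<phi> (v l) * ?e k else 0) - (if l = k then \<phi> (v j) * ?e k else 0)
       - (if j = k then \<phi> (v l) * ?e k else 0) - (if l = j then \<phi> (v k) * ?e j else 0)"
      unfolding R_def h'_comp by (simp add: inner_add_left inner_add_right 1 2 3)
    also have "\<dots> = 0" unfolding l(1) w'l \<phi>l using wpos \<kappa>[of j] \<kappa>[of k] \<kappa>[of l]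
      by (cases "j = k"; cases "l = k"; cases "l = j") (auto simp: field_simps)
    finally show ?thesis .
  qed
  hence "R u x y = 0"
    using linear_zero_on_eigenbasis[OF R_lin(1)] linear_zero_on_eigenbasis[OF R_lin(2)]
      linear_zero_on_eigenbasis[OF R_lin(3)] by metis
  thus ?thesis by (simp add: R_def)
qed

end

end


section \<open>Metrics on an open set of coordinates\<close>

definition mderiv :: "('a::real_normed_vector \<Rightarrow> real^'n^'m) \<Rightarrow> 'a \<Rightarrow> 'a \<Rightarrow> real^'n^'m" where
  "mderiv M q u = (\<chi> i j. frechet_derivative (\<lambda>q. M q $ i $ j) (at q) u)"

lemma mderiv_has_derivative: "mC1_on U M \<Longrightarrow> q \<in> U \<Longrightarrow> (M has_derivative mderiv M q) (at q)"
  using mC1_on_derivative[of U M q] unfolding mderiv_def[abs_def] .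

lemma linear_mderiv: "mC1_on U M \<Longrightarrow> q \<in> U \<Longrightarrow> linear (mderiv M q)"
  using mderiv_has_derivative has_derivative_linear by blast

lemma transpose_mderiv:
  assumes "open U" "q \<in> U" "mC1_on U M" "\<And>q. q \<in> U \<Longrightarrow> transpose (M q) = M q"
  shows "transpose (mderiv M q u) = mderiv M q u"
proof -
  have "frechet_derivative (\<lambda>q. M q $ j $ i) (at q) = frechet_derivative (\<lambda>q. M q $ i $ j) (at q)" for i j
  proof (rule frechet_derivative_transform_within_open[OF _ assms(1,2)])
    show "(\<lambda>q. M q $ j $ i) differentiable at q"
      using mC1_onD[OF assms(3)] assms(2) unfolding C1_on_iff by blast
    show "M x $ j $ i = M x $ i $ j" if "x \<in> U" for x
      by (subst assms(4)[OF that, symmetric]) (simp add: transpose_def)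
  qed
  thus ?thesis by (simp add: mderiv_def transpose_def vec_eq_iff)
qed

section \<open>The Levi-Civita connection in coordinates\<close>

definition local_christoffel :: "(real^'n \<Rightarrow> real^'n^'n) \<Rightarrow> real^'n \<Rightarrow> 'n \<Rightarrow> 'n \<Rightarrow> 'n \<Rightarrow> real" where
  "local_christoffel g q k i j = (1/2) * (\<Sum>l\<in>UNIV. matrix_inv (g q) $ k $ l *
     (mderiv g q (axis i 1) $ j $ l + mderiv g q (axis j 1) $ i $ l - mderiv g q (axis l 1) $ i $ j))"

definition connection :: "(real^'n \<Rightarrow> real^'n^'n) \<Rightarrow> real^'n \<Rightarrow> real^'n \<Rightarrow> real^'n^'n" where
  "connection g q u = (\<chi> k j. \<Sum>i\<in>UNIV. local_christoffel g q k i j * u $ i)"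

lemma linear_connection: "linear (connection g q)"
  unfolding linear_iff connection_def by (simp add: vec_eq_iff algebra_simps sum.distrib sum_distrib_left)

lemma connection_axis: "(connection g q (axis i 1) *v axis j 1) $ k = local_christoffel g q k i j"
proof -
  have "(\<Sum>i'\<in>UNIV. local_christoffel g q k i' j * axis i 1 $ i') = local_christoffel g q k i j"
    by (simp add: axis_def if_distrib cong: if_cong)
  thus ?thesis by (simp add: connection_def matrix_vector_mult_basis column_def)
qed

locale local_metric =
  fixes U :: "(real^'n) set" and g :: "real^'n \<Rightarrow> real^'n^'n"
  assumes U: "open U" and C1: "mC1_on U g" and spd: "\<And>q. q \<in> U \<Longrightarrow> spd (g q)"
begin

context fixes q assumes q: "q \<in> U" begin

abbreviation "g' \<equiv> mderiv g q"

lemma g'_linear: "linear g'" by (rule linear_mderiv[OF C1 q])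

lemma g'_sym: "transpose (g' u) = g' u"
  by (rule transpose_mderiv[OF U q C1]) (use spd in \<open>auto simp: spd_def\<close>)

text \<open>The one place where the index sums of the Christoffel symbols are handled; absence of
  torsion, compatibility with the metric and uniqueness are all read off from this formula.\<close>

lemma koszul:
  "x \<bullet> (g q *v (connection g q u *v y)) = (1/2) * (x \<bullet> (g' u *v y) + x \<bullet> (g' y *v u) - u \<bullet> (g' x *v y))"
proof -
  define B where "B i j l = g' (axis i 1) $ j $ l + g' (axis j 1) $ i $ l - g' (axis l 1) $ i $ j" for i j l
  define \<beta> where "\<beta> = (\<chi> l. (1/2) * (\<Sum>i\<in>UNIV. \<Sum>j\<in>UNIV. B i j l * u $ i * y $ j))"
  have "(connection g q u *v y) $ k = (matrix_inv (g q) *v \<beta>) $ k" for k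
  proof -
    have "(connection g q u *v y) $ k =
        (\<Sum>j\<in>UNIV. \<Sum>i\<in>UNIV. \<Sum>l\<in>UNIV. (1/2) * (matrix_inv (g q) $ k $ l * B i j l * u $ i * y $ j))"
      by (simp add: connection_def matrix_vector_mult_def local_christoffel_def B_def sum_distrib_left sum_distrib_right mult_ac)
    also have "\<dots> = (\<Sum>i\<in>UNIV. \<Sum>j\<in>UNIV. \<Sum>l\<in>UNIV. (1/2) * (matrix_inv (g q) $ k $ l * B i j l * u $ i * y $ j))"
      by (rule sum.swap)
    also have "\<dots> = (\<Sum>i\<in>UNIV. \<Sum>l\<in>UNIV. \<Sum>j\<in>UNIV. (1/2) * (matrix_inv (g q) $ k $ l * B i j l * u $ i * y $ j))"
      by (rule sum.cong[OF refl], rule sum.swap)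
    also have "\<dots> = (\<Sum>l\<in>UNIV. \<Sum>i\<in>UNIV. \<Sum>j\<in>UNIV. (1/2) * (matrix_inv (g q) $ k $ l * B i j l * u $ i * y $ j))"
      by (rule sum.swap)
    also have "\<dots> = (matrix_inv (g q) *v \<beta>) $ k"
      by (simp add: matrix_vector_mult_def \<beta>_def sum_distrib_left mult_ac)
    finally show ?thesis .
  qed
  hence "connection g q u *v y = matrix_inv (g q) *v \<beta>" by (simp add: vec_eq_iff)
  hence 1: "g q *v (connection g q u *v y) = \<beta>"
    by (simp add: matrix_vector_mul_assoc matrix_inv_mult(1)[OF spd_invertible[OF spd[OF q]]])
  have expand: "g' z $ a $ b = (\<Sum>i\<in>UNIV. z $ i * g' (axis i 1) $ a $ b)" for z a b
  proof -
    have "g' z = g' (\<Sum>i\<in>UNIV. (z $ i) *\<^sub>R axis i 1)"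
      using basis_expansion[of z] by (simp add: scalar_mult_eq_scaleR)
    thus ?thesis by (simp add: linear_sum[OF g'_linear] linear_scale[OF g'_linear])
  qed
  have e1: "x \<bullet> (g' u *v y) = (\<Sum>l\<in>UNIV. \<Sum>i\<in>UNIV. \<Sum>j\<in>UNIV. g' (axis i 1) $ j $ l * x $ l * u $ i * y $ j)"
  proof -
    have "x \<bullet> (g' u *v y) = (\<Sum>l\<in>UNIV. \<Sum>j\<in>UNIV. \<Sum>i\<in>UNIV. g' (axis i 1) $ l $ j * x $ l * u $ i * y $ j)"
      by (simp add: inner_vec_def matrix_vector_mult_def expand[of u] sum_distrib_left sum_distrib_right mult_ac)
    also have "\<dots> = (\<Sum>l\<in>UNIV. \<Sum>i\<in>UNIV. \<Sum>j\<in>UNIV. g' (axis i 1) $ l $ j * x $ l * u $ i * y $ j)"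
      by (rule sum.cong[OF refl], rule sum.swap)
    also have "\<dots> = (\<Sum>l\<in>UNIV. \<Sum>i\<in>UNIV. \<Sum>j\<in>UNIV. g' (axis i 1) $ j $ l * x $ l * u $ i * y $ j)"
    proof -
      have "g' (axis i 1) $ l $ j = g' (axis i 1) $ j $ l" for i j l
        by (subst g'_sym[symmetric]) (simp add: transpose_def)
      thus ?thesis by simp
    qed
    finally show ?thesis .
  qed
  have e2: "x \<bullet> (g' y *v u) = (\<Sum>l\<in>UNIV. \<Sum>i\<in>UNIV. \<Sum>j\<in>UNIV. g' (axis j 1) $ i $ l * x $ l * u $ i * y $ j)"
  proof -
    have "g' (axis i 1) $ l $ j = g' (axis i 1) $ j $ l" for i j l
      by (subst g'_sym[symmetric]) (simp add: transpose_def)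
    thus ?thesis
      by (simp add: inner_vec_def matrix_vector_mult_def expand[of y] sum_distrib_left sum_distrib_right mult_ac)
  qed
  have e3: "u \<bullet> (g' x *v y) = (\<Sum>l\<in>UNIV. \<Sum>i\<in>UNIV. \<Sum>j\<in>UNIV. g' (axis l 1) $ i $ j * x $ l * u $ i * y $ j)"
  proof -
    have "u \<bullet> (g' x *v y) = (\<Sum>i\<in>UNIV. \<Sum>j\<in>UNIV. \<Sum>l\<in>UNIV. g' (axis l 1) $ i $ j * x $ l * u $ i * y $ j)"
      by (simp add: inner_vec_def matrix_vector_mult_def expand[of x] sum_distrib_left sum_distrib_right mult_ac)
    also have "\<dots> = (\<Sum>i\<in>UNIV. \<Sum>l\<in>UNIV. \<Sum>j\<in>UNIV. g' (axis l 1) $ i $ j * x $ l * u $ i * y $ j)"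
      by (rule sum.cong[OF refl], rule sum.swap)
    also have "\<dots> = (\<Sum>l\<in>UNIV. \<Sum>i\<in>UNIV. \<Sum>j\<in>UNIV. g' (axis l 1) $ i $ j * x $ l * u $ i * y $ j)"
      by (rule sum.swap)
    finally show ?thesis .
  qed
  have "x \<bullet> \<beta> = (\<Sum>l\<in>UNIV. \<Sum>i\<in>UNIV. \<Sum>j\<in>UNIV. (1/2) * (B i j l * x $ l * u $ i * y $ j))"
    by (simp add: \<beta>_def inner_vec_def sum_distrib_left mult_ac)
  also have "\<dots> = (1/2) * (\<Sum>l\<in>UNIV. \<Sum>i\<in>UNIV. \<Sum>j\<in>UNIV. g' (axis i 1) $ j $ l * x $ l * u $ i * y $ j
      + g' (axis j 1) $ i $ l * x $ l * u $ i * y $ j - g' (axis l 1) $ i $ j * x $ l * u $ i * y $ j)"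
    by (simp add: B_def sum_distrib_left algebra_simps)
  also have "\<dots> = (1/2) * (x \<bullet> (g' u *v y) + x \<bullet> (g' y *v u) - u \<bullet> (g' x *v y))"
    unfolding e1 e2 e3 by (simp add: sum.distrib sum_subtractf)
  finally show ?thesis unfolding 1 .
qed

lemma g_cancel:
  assumes "\<And>x. x \<bullet> (g q *v y) = x \<bullet> (g q *v z)"
  shows "y = z"
proof -
  have "g q *v y = g q *v z" using assms vector_eq_ldot by blast
  hence "matrix_inv (g q) *v (g q *v y) = matrix_inv (g q) *v (g q *v z)" by simp
  thus ?thesis by (simp add: matrix_vector_mul_assoc matrix_inv_mult(2)[OF spd_invertible[OF spd[OF q]]])
qed

lemma connection_torsion: "connection g q u *v x = connection g q x *v u"
proof (rule g_cancel)
  fix z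
  show "z \<bullet> (g q *v (connection g q u *v x)) = z \<bullet> (g q *v (connection g q x *v u))"
    unfolding koszul using symmetric_dot[OF g'_sym, of u z x] by simp
qed

lemma g_sym: "transpose (g q) = g q" using spd[OF q] by (simp add: spd_def)

lemma connection_metric: "g' u = transpose (connection g q u) ** g q + g q ** connection g q u"
proof -
  have "x \<bullet> (g' u *v y) = x \<bullet> ((transpose (connection g q u) ** g q + g q ** connection g q u) *v y)" for x y
  proof -
    have "x \<bullet> ((transpose (connection g q u) ** g q + g q ** connection g q u) *v y) =
        y \<bullet> (g q *v (connection g q u *v x)) + x \<bullet> (g q *v (connection g q u *v y))"
      using symmetric_dot[OF g_sym, of "connection g q u *v x" y]
      by (simp add: matrix_vector_mult_add_rdistrib inner_add_right matrix_vector_mul_assoc[symmetric] transpose_dot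
          del: transpose_matrix_vector)
    also have "\<dots> = x \<bullet> (g' u *v y)" unfolding koszul
      using symmetric_dot[OF g'_sym, of y u x] symmetric_dot[OF g'_sym, of y x u] symmetric_dot[OF g'_sym, of x y u]
      by (simp add: field_simps)
    finally show ?thesis by simp
  qed
  hence "g' u *v y = (transpose (connection g q u) ** g q + g q ** connection g q u) *v y" for y
    using vector_eq_ldot by blast
  thus ?thesis by (metis matrix_eq)
qed

text \<open>Inserting the compatibility of \<open>D\<close> into the Koszul formula, the terms
  cancel in pairs by the symmetry of \<open>D\<close> and leave x \<bullet> g (D u y).\<close>

lemma connection_unique:
  assumes "\<And>u x y. x \<bullet> (g' u *v y) = D u x \<bullet> (g q *v y) + (g q *v x) \<bullet> D u y" and "\<And>u x. D u x = D x u"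
  shows "connection g q u *v y = D u y"
proof (rule g_cancel)
  fix x
  have a: "d \<bullet> (g q *v a) = a \<bullet> (g q *v d)" and b: "(g q *v a) \<bullet> d = a \<bullet> (g q *v d)" for a d
    using symmetric_dot[OF g_sym, of a d] by (simp_all add: inner_commute)
  show "x \<bullet> (g q *v (connection g q u *v y)) = x \<bullet> (g q *v D u y)"
    unfolding koszul assms(1) b
    using a[of "D u x" y] a[of "D y x" u] a[of "D x u" y] assms(2)[of x u] assms(2)[of y x] assms(2)[of y u]
    by (simp add: field_simps)
qed

end

lemma continuous_local_christoffel: "continuous_on U (\<lambda>q. local_christoffel g q k i j)"
proof -
  have inv: "mC1_on U (\<lambda>q. matrix_inv (g q))"
    by (rule mC1_on_matrix_inv[OF U C1]) (use spd spd_invertible invertible_det_nz in blast)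
  show ?thesis unfolding local_christoffel_def mderiv_def vec_lambda_beta
    by (intro continuous_intros C1_on_derivative_continuous C1_on_continuous mC1_onD C1 inv)
qed

end

text \<open>The list indexes the factors by the eigenvalues at a fixed point, while \<open>r\<close>
  moves each shift to a nearby point; the list therefore stays constant in the limit.\<close>

definition shifted_product :: "real^'n^'n \<Rightarrow> (real \<Rightarrow> real) \<Rightarrow> real list \<Rightarrow> real^'n^'n" where
  "shifted_product L r xs = foldr (\<lambda>a B. (L - r a *\<^sub>R mat 1) ** B) xs (mat 1)"

lemma shifted_product_eigen:
  assumes "L *v b = \<kappa> *\<^sub>R b"
  shows "shifted_product L r xs *v b = (\<Prod>a\<leftarrow>xs. \<kappa> - r a) *\<^sub>R b"
proof (induction xs)
  case (Cons a xs)
  have "shifted_product L r (a # xs) *v b = (L - r a *\<^sub>R mat 1) *v (shifted_product L r xs *v b)"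
    by (simp add: shifted_product_def matrix_vector_mul_assoc)
  also have "\<dots> = (\<kappa> - r a) *\<^sub>R ((\<Prod>a\<leftarrow>xs. \<kappa> - r a) *\<^sub>R b)"
    unfolding Cons by (simp add: matrix_vector_mult_scaleR matrix_vector_mult_diff_rdistrib assms
        scaleR_matrix_vector_assoc[symmetric] algebra_simps)
  finally show ?case by simp
qed (simp add: shifted_product_def)

lemma tendsto_shifted_product:
  assumes "(L \<longlongrightarrow> L0) F" "\<And>a. a \<in> set xs \<Longrightarrow> ((\<lambda>e. r e a) \<longlongrightarrow> r0 a) F"
  shows "((\<lambda>e. shifted_product (L e) (r e) xs) \<longlongrightarrow> shifted_product L0 r0 xs) F"
  using assms(2)
proof (induction xs)
  case (Cons a xs)
  have "((\<lambda>e. (L e - r e a *\<^sub>R mat 1) ** shifted_product (L e) (r e) xs) \<longlongrightarrow>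
      (L0 - r0 a *\<^sub>R mat 1) ** shifted_product L0 r0 xs) F"
    by (intro bounded_bilinear.tendsto[OF bounded_bilinear_matrix_mult] tendsto_intros assms(1) Cons) (use Cons in auto)
  thus ?case by (simp add: shifted_product_def)
qed (simp add: shifted_product_def)

section \<open>A pair of metrics in coordinates and its first derivatives\<close>

locale two_local_metrics = G: local_metric U g + H: local_metric U h
  for U and g h :: "real^'n \<Rightarrow> real^'n^'n"
begin

abbreviation "\<omega> q \<equiv> det_weight (g q) (h q)"
abbreviation "BT q \<equiv> benenti (g q) (h q)"
abbreviation "K k q \<equiv> K_mat (g q) (h q) k"
abbreviation "chp t q \<equiv> benenti_charpoly (g q) (h q) t"

lemma pair: "q \<in> U \<Longrightarrow> spd_pair (g q) (h q)" by (simp add: spd_pair_def G.spd H.spd)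

lemma det_nz: "q \<in> U \<Longrightarrow> det (g q) \<noteq> 0" "q \<in> U \<Longrightarrow> det (h q) \<noteq> 0"
  using spd_det_pos G.spd H.spd by blast+

lemmas C1_rules = G.C1 H.C1 C1_on_det mC1_on_matrix_inv[OF G.U] mC1_on_mult mC1_on_scaleR mC1_on_sum C1_on_sum
  C1_on_mult C1_on_const C1_on_power C1_on_divide mC1_on_matpow C1_on_char_coeff

lemma C1_det_ratio: "C1_on U (\<lambda>q. det (g q) / det (h q))"
  by (intro C1_rules det_nz)

lemma C1_w: "C1_on U \<omega>"
  unfolding det_weight_def
  by (intro C1_on_powr C1_det_ratio) (use spd_det_pos(1) G.spd H.spd in blast)

lemma omega_pos: "q \<in> U \<Longrightarrow> \<omega> q > 0" using spd_pair.w_pos[OF pair] .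

lemma C1_G: "mC1_on U (\<lambda>q. G_mat (g q) (h q))"
  unfolding G_mat_def by (intro C1_rules det_nz)

lemma C1_N: "mC1_on U BT"
  unfolding benenti_def by (intro C1_rules det_nz C1_w) (use omega_pos in force)

lemma C1_K: "mC1_on U (K k)"
  unfolding K_mat_def S_mat_def
  by (intro C1_rules det_nz C1_G C1_on_powr C1_det_ratio) (use spd_det_pos(1) G.spd H.spd in blast)

lemma C1_f: "C1_on U (chp t)"
  unfolding benenti_charpoly_def by (intro C1_rules C1_G C1_w)

end

text \<open>The assumption is the vanishing of the bracket of I_k and I_l at (q, p): the momentum
  gradient of I_l is 2 K_l p, and the common factor 2 is dropped.\<close>

locale local_metric_pair = two_local_metrics U g h for U and g h :: "real^'n \<Rightarrow> real^'n^'n" +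
  assumes poisson: "\<And>q k l p. q \<in> U \<Longrightarrow> k < CARD('n) \<Longrightarrow> l < CARD('n) \<Longrightarrow>
      p \<bullet> (mderiv (\<lambda>q. K_mat (g q) (h q) k) q (K_mat (g q) (h q) l *v p) *v p) =
      p \<bullet> (mderiv (\<lambda>q. K_mat (g q) (h q) l) q (K_mat (g q) (h q) k *v p) *v p)"
begin

text \<open>The \<open>leibniz\<close> clause is the derivative of \<open>pencil_benenti\<close>;
  the clause on the last K is the derivative of K_{n-1} g = - 1.\<close>

lemma jet:
  assumes q: "q \<in> U"
  shows "metric_jet (g q) (h q) (connection g q) (mderiv g q) (mderiv BT q) (\<lambda>k. mderiv (K k) q)
    (\<lambda>t. frechet_derivative (chp t) (at q))"
proof -
  interpret spd_pair "g q" "h q" by (rule pair[OF q])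
  note mult = bounded_bilinear.FDERIV[OF bounded_bilinear_matrix_mult]
  note dg = mderiv_has_derivative[OF G.C1 q] and dN = mderiv_has_derivative[OF C1_N q]
    and dK = mderiv_has_derivative[OF C1_K q] and df = C1_on_derivative[OF C1_f q]
  have symN: "transpose (BT q) = BT q" if "q \<in> U" for q using spd_pair.N_sym[OF pair[OF that]] .
  have symK: "transpose (K k q) = K k q" if "q \<in> U" for k q
    using spd_pair.K_symmetric[OF pair[OF that]] spd_pair.eigenbasis_exists[OF pair[OF that]] by metis
  show ?thesis
  proof (unfold_locales)
    fix t u
    have "((\<lambda>q. pencil (g q) (h q) t ** (BT q - t *\<^sub>R g q)) has_derivative
       (\<lambda>u. pencil (g q) (h q) t ** (mderiv BT q u - t *\<^sub>R mderiv g q u) +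
         (\<Sum>k<CARD('n). t ^ k *\<^sub>R mderiv (K k) q u) ** (BT q - t *\<^sub>R g q))) (at q)"
      unfolding pencil_def by (intro mult derivative_intros dK dN dg)
    moreover have "((\<lambda>q. pencil (g q) (h q) t ** (BT q - t *\<^sub>R g q)) has_derivative
       (\<lambda>u. frechet_derivative (chp t) (at q) u *\<^sub>R mat 1)) (at q)"
    proof (rule has_derivative_transform_within_open[OF _ G.U q])
      show "((\<lambda>q. chp t q *\<^sub>R mat 1) has_derivative (\<lambda>u. frechet_derivative (chp t) (at q) u *\<^sub>R (mat 1 :: real^'n^'n))) (at q)"
        by (intro derivative_intros df)
      show "chp t x *\<^sub>R mat 1 = pencil (g x) (h x) t ** (BT x - t *\<^sub>R g x)" if "x \<in> U" for x
        using spd_pair.pencil_benenti[OF pair[OF that]] spd_pair.eigenbasis_exists[OF pair[OF that]] by metis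
    qed
    ultimately have "(\<lambda>u. pencil (g q) (h q) t ** (mderiv BT q u - t *\<^sub>R mderiv g q u) +
         (\<Sum>k<CARD('n). t ^ k *\<^sub>R mderiv (K k) q u) ** (BT q - t *\<^sub>R g q)) = 
         (\<lambda>u. frechet_derivative (chp t) (at q) u *\<^sub>R mat 1)" by (rule has_derivative_unique)
    from fun_cong[OF this, of u] show "(\<Sum>k<CARD('n). t ^ k *\<^sub>R mderiv (K k) q u) ** (BT q - t *\<^sub>R g q) +
       pencil (g q) (h q) t ** (mderiv BT q u - t *\<^sub>R mderiv g q u) = frechet_derivative (chp t) (at q) u *\<^sub>R mat 1"
      by (simp add: add.commute)
  next
    fix u
    let ?n = "CARD('n) - 1"
    have "((\<lambda>q. K ?n q ** g q) has_derivative (\<lambda>u. K ?n q ** mderiv g q u + mderiv (K ?n) q u ** g q)) (at q)"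
      by (intro mult dK dg)
    moreover have "((\<lambda>q. K ?n q ** g q) has_derivative (\<lambda>u. 0)) (at q)"
    proof (rule has_derivative_transform_within_open[OF has_derivative_const G.U q])
      show "- mat 1 = K ?n x ** g x" if "x \<in> U" for x
      proof -
        interpret x: spd_pair "g x" "h x" by (rule pair[OF that])
        have "K ?n x = - matrix_inv (g x)" using x.K_last x.eigenbasis_exists by metis
        moreover have "(- A) ** B = - (A ** B)" for A B :: "real^'n^'n"
          by (simp add: vec_eq_iff matrix_matrix_mult_def sum_negf)
        ultimately show ?thesis by (simp add: x.g_inv)
      qed
    qed
    ultimately have "(\<lambda>u. K ?n q ** mderiv g q u + mderiv (K ?n) q u ** g q) = (\<lambda>u. 0)"
      by (rule has_derivative_unique)
    hence "K ?n q ** mderiv g q u + mderiv (K ?n) q u ** g q = 0" by (rule fun_cong)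
    moreover have "K ?n q = - matrix_inv (g q)" using K_last eigenbasis_exists by metis
    moreover have "(- A) ** B = - (A ** B)" for A B :: "real^'n^'n"
      by (simp add: vec_eq_iff matrix_matrix_mult_def sum_negf)
    ultimately have "mderiv (K ?n) q u ** g q = matrix_inv (g q) ** mderiv g q u"
      by simp
    hence "mderiv (K ?n) q u ** (g q ** matrix_inv (g q)) = matrix_inv (g q) ** mderiv g q u ** matrix_inv (g q)"
      by (simp add: matrix_mul_assoc)
    thus "mderiv (K ?n) q u = matrix_inv (g q) ** mderiv g q u ** matrix_inv (g q)" by (simp add: g_inv)
  qed (use poisson[OF q] in \<open>auto intro: linear_add[OF linear_connection] linear_scale[OF linear_connection]
        linear_add[OF linear_mderiv[OF C1_N q]] linear_scale[OF linear_mderiv[OF C1_N q]]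
        linear_add[OF linear_mderiv[OF C1_K q]] linear_scale[OF linear_mderiv[OF C1_K q]]
        G.connection_metric[OF q] G.connection_torsion[OF q] transpose_mderiv[OF G.U q C1_N symN]
        transpose_mderiv[OF G.U q C1_K symK]\<close>)
qed

text \<open>The Levi-Civita connection of h is unique, so it is the shifted connection found in the
  eigenbasis. Clearing the factor 2 \<omega> gives a form whose two sides are defined and continuous
  on all of \<open>U\<close>.\<close>

lemma connection_at_simple_spectrum:
  assumes q: "q \<in> U" and v: "g_eigenbasis (g q) (BT q) v \<kappa>" and inj: "inj \<kappa>"
  shows "2 * \<omega> q * (local_christoffel h q k i j - local_christoffel g q k i j) =
    - ((if k = j then frechet_derivative \<omega> (at q) (axis i 1) else 0) +
       (if k = i then frechet_derivative \<omega> (at q) (axis j 1) else 0))"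
proof -
  interpret metric_jet "g q" "h q" "connection g q" "mderiv g q" "mderiv BT q" "\<lambda>k. mderiv (K k) q"
    "\<lambda>t. frechet_derivative (chp t) (at q)" by (rule jet[OF q])
  note mult = bounded_bilinear.FDERIV[OF bounded_bilinear_matrix_mult]
  note dg = mderiv_has_derivative[OF G.C1 q] and dN = mderiv_has_derivative[OF C1_N q]
    and dh = mderiv_has_derivative[OF H.C1 q] and df = C1_on_derivative[OF C1_f q]
    and dw = C1_on_derivative[OF C1_w q]
  let ?\<omega>' = "frechet_derivative \<omega> (at q)"
  define Z where "Z q = matrix_inv (h q) ** g q" for q
  have CZ: "mC1_on U Z" unfolding Z_def by (intro C1_rules det_nz)
  note dZ = mderiv_has_derivative[OF CZ q]
  have hZ: "mderiv h q u ** (matrix_inv (h q) ** g q) + h q ** mderiv Z q u = mderiv g q u" for u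
  proof -
    have "((\<lambda>q. h q ** Z q) has_derivative (\<lambda>u. h q ** mderiv Z q u + mderiv h q u ** Z q)) (at q)"
      by (intro mult dh dZ)
    moreover have "((\<lambda>q. h q ** Z q) has_derivative mderiv g q) (at q)"
      by (rule has_derivative_transform_within_open[OF dg G.U q])
        (simp add: Z_def matrix_mul_assoc matrix_inv_mult(1)[OF spd_invertible[OF H.spd]])
    ultimately have "(\<lambda>u. h q ** mderiv Z q u + mderiv h q u ** Z q) = mderiv g q" by (rule has_derivative_unique)
    from fun_cong[OF this, of u] show ?thesis by (simp add: Z_def add.commute)
  qed
  have wN: "?\<omega>' u *\<^sub>R BT q + \<omega> q *\<^sub>R mderiv BT q u = mderiv g q u ** (matrix_inv (h q) ** g q) + g q ** mderiv Z q u" for u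
  proof -
    have "((\<lambda>q. \<omega> q *\<^sub>R BT q) has_derivative (\<lambda>u. \<omega> q *\<^sub>R mderiv BT q u + ?\<omega>' u *\<^sub>R BT q)) (at q)"
      by (intro has_derivative_scaleR dw dN)
    moreover have "((\<lambda>q. \<omega> q *\<^sub>R BT q) has_derivative (\<lambda>u. g q ** mderiv Z q u + mderiv g q u ** Z q)) (at q)"
    proof (rule has_derivative_transform_within_open[OF _ G.U q])
      show "((\<lambda>q. g q ** Z q) has_derivative (\<lambda>u. g q ** mderiv Z q u + mderiv g q u ** Z q)) (at q)"
        by (intro mult dg dZ)
      show "g x ** Z x = \<omega> x *\<^sub>R BT x" if "x \<in> U" for x
        using omega_pos[OF that] by (simp add: benenti_def Z_def matrix_mul_assoc)
    qed
    ultimately have "(\<lambda>u. \<omega> q *\<^sub>R mderiv BT q u + ?\<omega>' u *\<^sub>R BT q) = (\<lambda>u. g q ** mderiv Z q u + mderiv g q u ** Z q)"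
      by (rule has_derivative_unique)
    from fun_cong[OF this, of u] show ?thesis by (simp add: Z_def add.commute)
  qed
  have f0: "frechet_derivative (chp 0) (at q) u = (-1) ^ CARD('n) * ?\<omega>' u" for u
  proof -
    have "(chp 0 has_derivative (\<lambda>u. (-1) ^ CARD('n) * ?\<omega>' u)) (at q)"
    proof (rule has_derivative_transform_within_open[OF _ G.U q])
      show "((\<lambda>q. (-1) ^ CARD('n) * \<omega> q) has_derivative (\<lambda>u. (-1) ^ CARD('n) * ?\<omega>' u)) (at q)"
        by (intro has_derivative_mult_right dw)
      show "(-1) ^ CARD('n) * \<omega> x = chp 0 x" if "x \<in> U" for x
      proof -
        interpret x: spd_pair "g x" "h x" by (rule pair[OF that])
        obtain v \<kappa> where v: "g_eigenbasis (g x) (BT x) v \<kappa>" by (rule x.eigenbasis_exists)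
        have "(-1) ^ CARD('n) * \<omega> x = (\<Prod>j\<in>UNIV. - 1 * \<kappa> j)"
          unfolding x.w_eq_prod[OF v] prod.distrib by simp
        thus ?thesis by (simp add: x.charpoly_prod[OF v])
      qed
    qed
    from has_derivative_unique[OF this df] show ?thesis by metis
  qed
  define \<phi> where "\<phi> u = - ?\<omega>' u / (2 * \<omega> q)" for u
  define D where "D u x = connection g q u *v x + \<phi> u *\<^sub>R x + \<phi> x *\<^sub>R u" for u x
  have "connection h q (axis i 1) *v axis j 1 = D (axis i 1) (axis j 1)"
  proof (rule H.connection_unique[OF q])
    show "x \<bullet> (mderiv h q u *v y) = D u x \<bullet> (h q *v y) + (h q *v x) \<bullet> D u y" for u x y
      unfolding D_def \<phi>_def
      by (rule derivative_at_simple_spectrum[OF v inj H.g'_linear[OF q] has_derivative_linear[OF dw] hZ wN f0])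
    show "D u x = D x u" for u x
      unfolding D_def using G.connection_torsion[OF q, of u x] by (simp add: algebra_simps)
  qed
  hence "(connection h q (axis i 1) *v axis j 1) $ k = D (axis i 1) (axis j 1) $ k" by simp
  hence "local_christoffel h q k i j = local_christoffel g q k i j + \<phi> (axis i 1) * (axis j 1 $ k) + \<phi> (axis j 1) * (axis i 1 $ k)"
    by (simp add: D_def connection_axis)
  moreover have axis_nth: "axis l (1::real) $ k = (if k = l then 1 else 0)" for l by (simp add: axis_def)
  ultimately have "local_christoffel h q k i j - local_christoffel g q k i j =
      (if k = j then \<phi> (axis i 1) else 0) + (if k = i then \<phi> (axis j 1) else 0)"
    by (simp add: axis_nth)
  moreover have "2 * \<omega> q * \<phi> u = - ?\<omega>' u" for u using omega_pos[OF q] by (simp add: \<phi>_def)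
  ultimately show ?thesis by (simp add: distrib_left)
qed

section \<open>Behaviour of the eigenvalues near a point\<close>

definition "spectrum q = {t. chp t q = 0}"

lemma spectrum_range:
  assumes "q \<in> U" "g_eigenbasis (g q) (BT q) v \<kappa>"
  shows "spectrum q = range \<kappa>"
  by (auto simp: spectrum_def spd_pair.charpoly_prod[OF pair[OF assms(1)] assms(2)])

lemma spectrum_finite: "q \<in> U \<Longrightarrow> finite (spectrum q)"
  and card_spectrum_le: "q \<in> U \<Longrightarrow> card (spectrum q) \<le> CARD('n)"
proof -
  assume q: "q \<in> U"
  obtain v \<kappa> where "g_eigenbasis (g q) (BT q) v \<kappa>" by (rule spd_pair.eigenbasis_exists[OF pair[OF q]])
  note s = spectrum_range[OF q this]
  show "finite (spectrum q)" by (simp add: s)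
  show "card (spectrum q) \<le> CARD('n)" unfolding s by (rule card_image_le) simp
qed

text \<open>The value of the characteristic polynomial at t is, up to sign, the product of the n
  distances from t to the eigenvalues, each at least the smallest one. Applied at a root t of a
  fixed point, this gives convergence of eigenvalues.\<close>

lemma eigenvalue_near:
  assumes q: "q \<in> U"
  shows "\<exists>r\<in>spectrum q. \<bar>r - t\<bar> ^ CARD('n) \<le> \<bar>chp t q\<bar>"
proof -
  obtain v \<kappa> where v: "g_eigenbasis (g q) (BT q) v \<kappa>" by (rule spd_pair.eigenbasis_exists[OF pair[OF q]])
  obtain i where i: "\<And>j. \<bar>\<kappa> i - t\<bar> \<le> \<bar>\<kappa> j - t\<bar>"
    using ex_is_arg_min_if_finite[of "UNIV :: 'n set" "\<lambda>j. \<bar>\<kappa> j - t\<bar>"] by (auto simp: is_arg_min_linorder)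
  have "\<bar>\<kappa> i - t\<bar> ^ CARD('n) = (\<Prod>j\<in>(UNIV::'n set). \<bar>\<kappa> i - t\<bar>)" by simp
  also have "\<dots> \<le> (\<Prod>j\<in>UNIV. \<bar>\<kappa> j - t\<bar>)" by (rule prod_mono) (simp add: i)
  also have "\<dots> = \<bar>chp t q\<bar>"
    by (simp add: spd_pair.charpoly_prod[OF pair[OF q] v] abs_prod abs_minus_commute)
  finally show ?thesis using spectrum_range[OF q v] by auto
qed

text \<open>No smooth or even continuous branch of eigenvalues is selected: any choice within the
  bound converges to t as q tends to a point having t in its spectrum.\<close>

definition "near q t = (SOME r. r \<in> spectrum q \<and> \<bar>r - t\<bar> ^ CARD('n) \<le> \<bar>chp t q\<bar>)"

lemma near: "q \<in> U \<Longrightarrow> near q t \<in> spectrum q \<and> \<bar>near q t - t\<bar> ^ CARD('n) \<le> \<bar>chp t q\<bar>"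
  unfolding near_def by (rule someI_ex) (use eigenvalue_near in blast)

lemma tendsto_near:
  assumes x: "x \<in> U" and t: "t \<in> spectrum x"
  shows "((\<lambda>q. near q t) \<longlongrightarrow> t) (nhds x)"
proof -
  have "isCont (chp t) x" using C1_on_continuous[OF C1_f] G.U x by (simp add: continuous_on_eq_continuous_at)
  hence "(chp t \<longlongrightarrow> chp t x) (nhds x)"
    unfolding isCont_def by (rule tendsto_at_iff_tendsto_nhds[of "\<lambda>q. chp t q" x, THEN iffD1])
  hence "((\<lambda>q. root CARD('n) \<bar>chp t q\<bar>) \<longlongrightarrow> root CARD('n) \<bar>chp t x\<bar>) (nhds x)"
    by (intro tendsto_intros)
  hence 1: "((\<lambda>q. root CARD('n) \<bar>chp t q\<bar>) \<longlongrightarrow> 0) (nhds x)" using t by (simp add: spectrum_def)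
  have "\<forall>\<^sub>F q in nhds x. \<bar>near q t - t\<bar> \<le> root CARD('n) \<bar>chp t q\<bar>"
    using eventually_nhds_in_open[OF G.U x]
  proof eventually_elim
    case (elim q)
    have "root CARD('n) (\<bar>near q t - t\<bar> ^ CARD('n)) \<le> root CARD('n) \<bar>chp t q\<bar>"
      using near[OF elim, of t] by simp
    thus ?case by (simp add: real_root_power_cancel)
  qed
  hence "((\<lambda>q. near q t - t) \<longlongrightarrow> 0) (nhds x)"
    by (intro Lim_null_comparison[OF _ 1]) simp
  thus ?thesis by (rule LIM_zero_cancel)
qed

lemma near_inj:
  assumes x: "x \<in> U"
  shows "\<forall>\<^sub>F q in nhds x. inj_on (near q) (spectrum x)"
proof -
  have "\<forall>\<^sub>F q in nhds x. near q s \<noteq> near q t" if "s \<in> spectrum x" "t \<in> spectrum x" "s \<noteq> t" for s t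
  proof -
    have "((\<lambda>q. near q s - near q t) \<longlongrightarrow> s - t) (nhds x)"
      by (intro tendsto_diff tendsto_near x that)
    hence "\<forall>\<^sub>F q in nhds x. near q s - near q t \<noteq> 0"
      by (rule tendsto_imp_eventually_ne) (use that in simp)
    thus ?thesis by eventually_elim auto
  qed
  hence "\<forall>\<^sub>F q in nhds x. \<forall>s\<in>spectrum x. \<forall>t\<in>spectrum x. s \<noteq> t \<longrightarrow> near q s \<noteq> near q t"
    by (intro eventually_ball_finite spectrum_finite x ballI) (auto intro: always_eventually)
  thus ?thesis by eventually_elim (auto simp: inj_on_def)
qed

text \<open>Distinct eigenvalues at \<open>x\<close> have distinct continuations nearby, so
  eigenvalues can split near \<open>x\<close> but not merge.\<close>

lemma card_spectrum_lower:
  assumes x: "x \<in> U"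
  shows "\<forall>\<^sub>F q in nhds x. card (spectrum x) \<le> card (spectrum q)"
  using near_inj[OF x] eventually_nhds_in_open[OF G.U x]
proof eventually_elim
  case (elim q)
  have "card (spectrum x) = card (near q ` spectrum x)" using card_image[OF elim(1)] by simp
  also have "\<dots> \<le> card (spectrum q)"
    by (rule card_mono) (use near[OF elim(2)] spectrum_finite[OF elim(2)] in auto)
  finally show ?case .
qed

text \<open>Near a point \<open>x\<close> where the number of distinct eigenvalues is maximal, each eigenvalue \<open>\<mu>\<close> continues to
  a single eigenvalue \<open>r\<close>, so \<open>(L - r) Y = 0\<close> where \<open>Y\<close> is the product of the other factors of the minimal
  polynomial.  At \<open>x\<close> the factor \<open>Y\<close> is a nonzero scalar on the eigenspace of \<open>\<mu>\<close>, and the difference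
  quotient of this equation gives the claim.\<close>

lemma eigenvalue_block_scalar:
  fixes \<mu> :: real
  assumes x: "x \<in> W" and W: "open W" "W \<subseteq> U"
    and max: "\<And>q. q \<in> W \<Longrightarrow> card (spectrum q) \<le> card (spectrum x)"
    and v: "g_eigenbasis (g x) (BT x) v \<kappa>"
  defines "B \<equiv> \<lambda>u j k. v j \<bullet> ((mderiv BT x u - \<mu> *\<^sub>R mderiv g x u) *v v k)"
  assumes i: "\<kappa> i = \<mu>" and j: "\<kappa> j = \<mu>" and k: "\<kappa> k = \<mu>"
  shows "B u j k = (if j = k then B u i i else 0)"
proof -
  have xU: "x \<in> U" using x W by auto
  define y where "y e = x + e *\<^sub>R u" for e :: real
  have y0: "(y \<longlongrightarrow> x) (at 0)" unfolding y_def by (rule tendsto_eq_intros refl | simp)+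
  hence yn: "filterlim y (nhds x) (at 0)" .
  obtain xs where xs: "set xs = spectrum x - {\<mu>}" "distinct xs"
    using finite_distinct_list[of "spectrum x - {\<mu>}"] spectrum_finite[OF xU] by auto
  have mu: "\<mu> \<in> spectrum x" using spectrum_range[OF xU v] j by auto
  define L where "L q = matrix_inv (g q) ** BT q" for q
  have CL: "mC1_on U L" unfolding L_def by (intro C1_rules C1_N det_nz)
  define Y where "Y e = shifted_product (L (y e)) (near (y e)) xs" for e
  define Y0 where "Y0 = shifted_product (L x) (\<lambda>a. a) xs"
  define c where "c = (\<Prod>a\<leftarrow>xs. \<mu> - a)"
  have "\<mu> \<notin> set xs" using xs(1) by blast
  hence "0 \<notin> set (map (\<lambda>a. \<mu> - a) xs)" by auto
  hence c: "c \<noteq> 0" unfolding c_def prod_list_zero_iff .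
  have mtend: "((\<lambda>e. M (y e)) \<longlongrightarrow> M x) (at 0)" if "mC1_on U M" for M :: "_ \<Rightarrow> real^'n^'n"
    using has_derivative_continuous[OF mderiv_has_derivative[OF that xU]] y0
    by (simp add: isCont_tendsto_compose)
  have near_tend: "((\<lambda>e. near (y e) a) \<longlongrightarrow> a) (at 0)" if "a \<in> spectrum x" for a
    by (rule filterlim_compose[OF tendsto_near[OF xU that] yn])
  have Yt: "(Y \<longlongrightarrow> Y0) (at 0)" unfolding Y_def Y0_def
    by (intro tendsto_shifted_product mtend CL near_tend) (use xs in auto)
  have Lv: "L q *v b = \<nu> *\<^sub>R b" if "BT q *v b = \<nu> *\<^sub>R (g q *v b)" "q \<in> U" for q b \<nu>
  proof -
    have "L q *v b = matrix_inv (g q) *v (\<nu> *\<^sub>R (g q *v b))"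
      by (simp add: L_def matrix_vector_mul_assoc[symmetric] that(1))
    thus ?thesis
      by (simp add: matrix_vector_mult_scaleR matrix_vector_mul_assoc spd_pair.g_inv[OF pair[OF that(2)]])
  qed
  have Y0v: "Y0 *v v l = c *\<^sub>R v l" if "\<kappa> l = \<mu>" for l
  proof -
    have "BT x *v v l = \<mu> *\<^sub>R (g x *v v l)" using v that by (simp add: g_eigenbasis_def)
    thus ?thesis unfolding Y0_def c_def by (rule shifted_product_eigen[OF Lv[OF _ xU]])
  qed
  \<comment> \<open>Maximality at \<open>x\<close> makes \<open>near (y e)\<close> a bijection
    between the two spectra. Each eigenvector at \<open>y e\<close> is thus killed either by a
    factor of \<open>Y e\<close> or by the factor for \<mu>.\<close>
  have ev: "\<forall>\<^sub>F e in at 0. (BT (y e) - near (y e) \<mu> *\<^sub>R g (y e)) ** Y e = 0"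
    using filterlim_iff[THEN iffD1, rule_format, OF yn near_inj[OF xU]]
      filterlim_iff[THEN iffD1, rule_format, OF yn eventually_nhds_in_open[OF W(1) x]]
  proof eventually_elim
    case (elim e)
    have yU: "y e \<in> U" using elim W by auto
    obtain b \<nu> where b: "g_eigenbasis (g (y e)) (BT (y e)) b \<nu>" by (rule spd_pair.eigenbasis_exists[OF pair[OF yU]])
    have "near (y e) ` spectrum x = spectrum (y e)"
    proof (rule card_seteq)
      show "card (spectrum (y e)) \<le> card (near (y e) ` spectrum x)"
        using max[OF elim(2)] card_image[OF elim(1)] by simp
    qed (use near[OF yU] spectrum_finite[OF yU] in auto)
    hence roots: "\<nu> l \<in> near (y e) ` spectrum x" for l using spectrum_range[OF yU b] by auto
    show ?case
    proof (rule g_eigenbasis_matrix_eqI(1)[OF b])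
      fix l
      let ?P = "\<Prod>a\<leftarrow>xs. \<nu> l - near (y e) a"
      have Nb: "BT (y e) *v b l = \<nu> l *\<^sub>R (g (y e) *v b l)" using b by (simp add: g_eigenbasis_def)
      have "((BT (y e) - near (y e) \<mu> *\<^sub>R g (y e)) ** Y e) *v b l = (BT (y e) - near (y e) \<mu> *\<^sub>R g (y e)) *v (?P *\<^sub>R b l)"
        unfolding Y_def matrix_vector_mul_assoc[symmetric] shifted_product_eigen[OF Lv[OF Nb yU]] ..
      also have "\<dots> = (?P * (\<nu> l - near (y e) \<mu>)) *\<^sub>R (g (y e) *v b l)"
        by (simp add: matrix_vector_mult_scaleR matrix_vector_mult_diff_rdistrib Nb
            scaleR_matrix_vector_assoc[symmetric] algebra_simps)
      also have "?P * (\<nu> l - near (y e) \<mu>) = 0"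
      proof -
        from roots[of l] obtain a where a: "a \<in> spectrum x" "\<nu> l = near (y e) a" by auto
        show ?thesis using a xs(1) by (cases "a = \<mu>") (auto simp: prod_list_zero_iff)
      qed
      finally show "((BT (y e) - near (y e) \<mu> *\<^sub>R g (y e)) ** Y e) *v b l = 0 *v b l" by simp
    qed
  qed
  \<comment> \<open>The difference quotient of the continued eigenvalue. Its convergence is not
    assumed: it follows from the diagonal case a = b, where \<open>rhs\<close> tends to c \<noteq>
    0.\<close>
  define \<theta> where "\<theta> e = (near (y e) \<mu> - \<mu>) / e" for e
  define lhs where "lhs a b e = v a \<bullet> ((((BT (y e) - BT x) /\<^sub>R e) - \<mu> *\<^sub>R ((g (y e) - g x) /\<^sub>R e)) *v (Y e *v v b))" for a b e
  define rhs where "rhs a b e = v a \<bullet> (g (y e) *v (Y e *v v b))" for a b e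
  \<comment> \<open>\<open>v a\<close> lies in the kernel of the symmetric form BT x - \<mu> g x, so
    this form can be subtracted freely; that turns \<open>ev\<close> into an equation between
    difference quotients.\<close>
  have eq: "\<forall>\<^sub>F e in at 0. lhs a b e = \<theta> e * rhs a b e" if "\<kappa> a = \<mu>" for a b
    using ev eventually_neq_at_within[of 0]
  proof eventually_elim
    case (elim e)
    let ?z = "Y e *v v b"
    have "v a \<bullet> (BT x *v ?z) = ?z \<bullet> (BT x *v v a)"
      by (rule symmetric_dot[OF spd_pair.N_sym[OF pair[OF xU]]])
    also have "\<dots> = \<mu> * (v a \<bullet> (g x *v ?z))"
      using v that symmetric_dot[OF G.g_sym[OF xU], of ?z "v a"] by (simp add: g_eigenbasis_def)
    finally have 0: "v a \<bullet> (BT x *v ?z) = \<mu> * (v a \<bullet> (g x *v ?z))" .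
    have "(BT (y e) - near (y e) \<mu> *\<^sub>R g (y e)) *v ?z = 0"
      using elim(1) by (simp add: matrix_vector_mul_assoc)
    hence 1: "v a \<bullet> (BT (y e) *v ?z) = near (y e) \<mu> * (v a \<bullet> (g (y e) *v ?z))"
      by (simp add: matrix_vector_mult_diff_rdistrib scaleR_matrix_vector_assoc[symmetric])
    have "lhs a b e = ((v a \<bullet> (BT (y e) *v ?z) - v a \<bullet> (BT x *v ?z)) -
        \<mu> * (v a \<bullet> (g (y e) *v ?z) - v a \<bullet> (g x *v ?z))) / e"
      by (simp add: lhs_def matrix_vector_mult_diff_rdistrib scaleR_matrix_vector_assoc[symmetric] inner_diff_right
          divide_inverse algebra_simps)
    thus ?case unfolding 0 1 by (simp add: \<theta>_def rhs_def algebra_simps)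
  qed
  have dq: "((\<lambda>e. (M (y e) - M x) /\<^sub>R e) \<longlongrightarrow> mderiv M x u) (at 0)" if "mC1_on U M" for M :: "_ \<Rightarrow> real^'n^'n"
  proof -
    have "(M \<circ> y has_derivative mderiv M x \<circ> (\<lambda>e. e *\<^sub>R u)) (at 0)"
    proof (rule diff_chain_at)
      show "(y has_derivative (\<lambda>e. e *\<^sub>R u)) (at 0)" unfolding y_def by (auto intro!: derivative_eq_intros)
      show "(M has_derivative mderiv M x) (at (y 0))"
        using mderiv_has_derivative[OF that xU] by (simp add: y_def)
    qed
    hence "((\<lambda>e. M (y e)) has_vector_derivative mderiv M x u) (at 0)"
      by (simp add: has_vector_derivative_def o_def linear_scale[OF linear_mderiv[OF that xU]])
    from vector_derivative_quotient[OF this] show ?thesis by (simp add: y_def)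
  qed
  note mv = bounded_bilinear.tendsto[OF bounded_bilinear_matrix_vector_mult]
  have Yv: "((\<lambda>e. Y e *v v b) \<longlongrightarrow> c *\<^sub>R v b) (at 0)" if "\<kappa> b = \<mu>" for b
    using mv[OF Yt tendsto_const[of "v b"]] unfolding Y0v[OF that] .
  have lhs_lim: "(lhs a b \<longlongrightarrow> c * B u a b) (at 0)" if "\<kappa> b = \<mu>" for a b
  proof -
    have "(lhs a b \<longlongrightarrow> v a \<bullet> ((mderiv BT x u - \<mu> *\<^sub>R mderiv g x u) *v (c *\<^sub>R v b))) (at 0)"
      unfolding lhs_def by (intro mv tendsto_intros dq C1_N G.C1 Yv that)
    thus ?thesis by (simp add: B_def matrix_vector_mult_scaleR)
  qed
  have rhs_lim: "(rhs a b \<longlongrightarrow> c * (if a = b then 1 else 0)) (at 0)" if "\<kappa> b = \<mu>" for a b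
  proof -
    have "(rhs a b \<longlongrightarrow> v a \<bullet> (g x *v (c *\<^sub>R v b))) (at 0)"
      unfolding rhs_def by (intro mv tendsto_intros mtend G.C1 Yv that)
    thus ?thesis using v by (simp add: g_eigenbasis_def matrix_vector_mult_scaleR)
  qed
  have \<theta>_lim: "(\<theta> \<longlongrightarrow> B u a a) (at 0)" if a: "\<kappa> a = \<mu>" for a
  proof -
    have "((\<lambda>e. lhs a a e / rhs a a e) \<longlongrightarrow> c * B u a a / c) (at 0)"
      using tendsto_divide[OF lhs_lim[OF a] rhs_lim[OF a, of a]] c by simp
    moreover have "\<forall>\<^sub>F e in at 0. lhs a a e / rhs a a e = \<theta> e"
    proof -
      have "\<forall>\<^sub>F e in at 0. rhs a a e \<noteq> 0"
        using tendsto_imp_eventually_ne[OF rhs_lim[OF a, of a]] c by simp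
      with eq[OF a, of a] show ?thesis by eventually_elim simp
    qed
    ultimately show ?thesis using c by (simp add: tendsto_cong)
  qed
  show ?thesis
  proof (cases "j = k")
    case True
    thus ?thesis using tendsto_unique[OF _ \<theta>_lim[OF j] \<theta>_lim[OF i]] by simp
  next
    case False
    have "((\<lambda>e. \<theta> e * rhs j k e) \<longlongrightarrow> B u i i * (c * 0)) (at 0)"
      using tendsto_mult[OF \<theta>_lim[OF i] rhs_lim[OF k, of j]] False by simp
    hence "(lhs j k \<longlongrightarrow> 0) (at 0)" using eq[OF j, of k] by (simp add: tendsto_cong)
    from tendsto_unique[OF _ this lhs_lim[OF k]] show ?thesis using c False by simp
  qed
qed

end

text \<open>The form in which independence of the integrals is used: a value t violating
  \<open>generic\<close> at q yields the relation \<Sum> t^k dI_k = 0 at every momentum over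
  q.\<close>

locale generic_metric_pair = local_metric_pair U g h for U and g h :: "real^'n \<Rightarrow> real^'n^'n" +
  assumes generic: "\<And>W. open W \<Longrightarrow> W \<noteq> {} \<Longrightarrow> W \<subseteq> U \<Longrightarrow>
     \<exists>q\<in>W. \<forall>t. \<not> (pencil (g q) (h q) t = 0 \<and> (\<forall>u. (\<Sum>k<CARD('n). t ^ k *\<^sub>R mderiv (K k) q u) = 0))"
begin

lemma simple_spectrum_dense:
  assumes W: "open W" "W \<noteq> {}" "W \<subseteq> U"
  shows "\<exists>q\<in>W. card (spectrum q) = CARD('n)"
proof (rule ccontr)
  assume "\<not> ?thesis"
  hence less: "card (spectrum q) < CARD('n)" if "q \<in> W" for q
    using card_spectrum_le[of q] that W(3) by (metis le_neq_implies_less subsetD)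
  have "\<exists>x. x \<in> W \<and> (\<forall>q. q \<in> W \<longrightarrow> card (spectrum q) \<le> card (spectrum x))"
  proof -
    obtain x0 where "x0 \<in> W" using W(2) by auto
    from ex_has_greatest_nat[of "\<lambda>x. x \<in> W" x0 "\<lambda>q. card (spectrum q)" "CARD('n)", OF this]
    show ?thesis using less by (metis less_imp_le_nat)
  qed
  then obtain x where x: "x \<in> W" "\<And>q. q \<in> W \<Longrightarrow> card (spectrum q) \<le> card (spectrum x)" by blast
  \<comment> \<open>\<open>generic\<close> returns a point of its own choosing, so maximality must
    hold on a neighbourhood and not just at \<open>x\<close>; lower semicontinuity provides
    this.\<close>
  have "\<forall>\<^sub>F q in nhds x. q \<in> W \<and> card (spectrum x) \<le> card (spectrum q)"
    by (intro eventually_conj eventually_nhds_in_open card_spectrum_lower W x(1) subsetD[OF W(3)])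
  then obtain V where V: "open V" "x \<in> V" "\<And>q. q \<in> V \<Longrightarrow> q \<in> W \<and> card (spectrum x) \<le> card (spectrum q)"
    unfolding eventually_nhds by blast
  have "V \<subseteq> U" "V \<noteq> {}" using V W(3) by auto
  from generic[OF V(1) this(2,1)] obtain q where q: "q \<in> V"
    "\<And>t. \<not> (pencil (g q) (h q) t = 0 \<and> (\<forall>u. (\<Sum>k<CARD('n). t ^ k *\<^sub>R mderiv (K k) q u) = 0))" by blast
  have qW: "q \<in> W" and qU: "q \<in> U" using V(3)[OF q(1)] W(3) by auto
  have max: "card (spectrum y) \<le> card (spectrum q)" if "y \<in> W" for y
    using x(2)[OF that] V(3)[OF q(1)] by simp
  obtain v \<kappa> where v: "g_eigenbasis (g q) (BT q) v \<kappa>" by (rule spd_pair.eigenbasis_exists[OF pair[OF qU]])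
  have "\<not> inj \<kappa>" using less[OF qW] spectrum_range[OF qU v] card_image by fastforce
  then obtain i0 j0 where ij: "i0 \<noteq> j0" "\<kappa> i0 = \<kappa> j0" by (auto simp: inj_def)
  interpret J: metric_jet "g q" "h q" "connection g q" "mderiv g q" "mderiv BT q" "\<lambda>k. mderiv (K k) q"
    "\<lambda>t. frechet_derivative (chp t) (at q)" by (rule jet[OF qU])
  note Z = J.pencil_zero_at_multiple_eigenvalue[OF v ij(1) ij(2) refl
      eigenvalue_block_scalar[OF qW W(1,3) max v ij(2)]]
  show False using q(2)[of "\<kappa> j0"] Z unfolding J.M'_def by blast
qed

text \<open>The defect \<open>R\<close> is continuous, so the set where it is nonzero is open. If
  nonempty, that set would contain a point with simple spectrum, where the relation is
  known.\<close>

theorem christoffel_relation: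
  assumes q: "q \<in> U"
  shows "2 * \<omega> q * (local_christoffel h q k i j - local_christoffel g q k i j) =
    - ((if k = j then frechet_derivative \<omega> (at q) (axis i 1) else 0) +
       (if k = i then frechet_derivative \<omega> (at q) (axis j 1) else 0))"
proof (rule ccontr)
  define R where "R q = 2 * \<omega> q * (local_christoffel h q k i j - local_christoffel g q k i j) +
    ((if k = j then frechet_derivative \<omega> (at q) (axis i 1) else 0) +
       (if k = i then frechet_derivative \<omega> (at q) (axis j 1) else 0))" for q
  assume "\<not> ?thesis"
  hence "R q \<noteq> 0" by (simp add: R_def)
  have c: "continuous_on U (\<lambda>q. if b then frechet_derivative \<omega> (at q) a else 0)" for b a
    using C1_on_derivative_continuous[OF C1_w, of a] by (cases b) auto
  have "continuous_on U (\<lambda>q. 2 * \<omega> q * (local_christoffel h q k i j - local_christoffel g q k i j))"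
    by (intro continuous_intros G.continuous_local_christoffel H.continuous_local_christoffel C1_on_continuous C1_w)
  hence "continuous_on U R" unfolding R_def by (intro continuous_on_add c)
  hence "open (U \<inter> R -` (- {0}))" using G.U by (intro continuous_open_preimage) auto
  moreover have "U \<inter> R -` (- {0}) \<noteq> {}" using q \<open>R q \<noteq> 0\<close> by auto
  ultimately obtain y where y: "y \<in> U" "R y \<noteq> 0" "card (spectrum y) = CARD('n)"
    using simple_spectrum_dense by blast
  obtain v \<kappa> where v: "g_eigenbasis (g y) (BT y) v \<kappa>" by (rule spd_pair.eigenbasis_exists[OF pair[OF y(1)]])
  have "inj \<kappa>" using y(3) spectrum_range[OF y(1) v] by (intro eq_card_imp_inj_on) auto
  from connection_at_simple_spectrum[OF y(1) v this, of k i j] y(2) show False by (simp add: R_def)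
qed

end


section \<open>The cotangent bundle\<close>

lemma higher_differentiable_2_C1:
  assumes "higher_differentiable_on 2 U f"
  shows "C1_on U f"
  unfolding C1_on_iff
proof (intro conjI allI continuous_at_imp_continuous_on ballI)
  fix v x assume "x \<in> U"
  hence "(\<lambda>x. frechet_derivative f (at x) v) differentiable at x"
    using assms by (simp add: numeral_2_eq_2)
  thus "isCont (\<lambda>x. frechet_derivative f (at x) v) x" by (rule differentiable_imp_continuous_within)
qed (use assms in \<open>simp add: numeral_2_eq_2\<close>)

text \<open>Testing on pure position and pure momentum vectors determines the field. The minus sign
  sits on the momentum gradient because the form is dp \<and> dq.\<close>

lemma hamiltonian_vector_eq:
  assumes "(f has_derivative (\<lambda>w. \<alpha> \<bullet> fst w + \<beta> \<bullet> snd w)) (at \<zeta>)"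
  shows "hamiltonian_vector f \<zeta> = (- \<beta>, \<alpha>)"
  unfolding hamiltonian_vector_def
proof (rule the_equality)
  have D: "frechet_derivative f (at \<zeta>) = (\<lambda>w. \<alpha> \<bullet> fst w + \<beta> \<bullet> snd w)"
    using assms frechet_derivative_at by metis
  show "\<forall>w. standard_symplectic (- \<beta>, \<alpha>) w = frechet_derivative f (at \<zeta>) w"
    by (simp add: D standard_symplectic_def inner_commute)
  fix X assume X: "\<forall>w. standard_symplectic X w = frechet_derivative f (at \<zeta>) w"
  have "snd X \<bullet> a = \<alpha> \<bullet> a" for a using X[rule_format, of "(a, 0)"] by (simp add: D standard_symplectic_def)
  hence 1: "snd X = \<alpha>" by (metis vector_eq_rdot)
  have "- (fst X) \<bullet> b = \<beta> \<bullet> b" for b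
    using X[rule_format, of "(0, b)"] by (simp add: D standard_symplectic_def inner_commute)
  hence "- fst X = \<beta>" by (metis vector_eq_rdot)
  with 1 show "X = (- \<beta>, \<alpha>)" by (auto simp: prod_eq_iff)
qed

section \<open>Coordinates on the manifold and on its cotangent bundle\<close>

context
  fixes A :: "('m::{t2_space,second_countable_topology}, real^'n) chart set"
  assumes A: "smooth_atlas A"
begin

lemma atlas_chart: "c \<in> A \<Longrightarrow> is_chart c" using A by (simp add: smooth_atlas_def)

lemma chart_domain_open: "c \<in> A \<Longrightarrow> open (fst c)" "c \<in> A \<Longrightarrow> open (snd c ` fst c)"
  using atlas_chart by (auto simp: is_chart_def)

lemma chart_inv: "c \<in> A \<Longrightarrow> x \<in> fst c \<Longrightarrow> inv_chart c (snd c x) = x"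
  using inv_chart_apply atlas_chart by blast

lemma metric_comp_spd:
  assumes g: "riemannian_metric k A g" and c: "c \<in> A" "x \<in> fst c"
  shows "spd (metric_comp A g c x)"
proof -
  note t = coord_vec_tangent[OF A c]
  have lin: "linear_on_tangent A x (g x u)" if "u \<in> tangent_space A x" for u
    using g that unfolding riemannian_metric_def by auto
  have sym: "g x u v = g x v u" if "u \<in> tangent_space A x" "v \<in> tangent_space A x" for u v
    using g that unfolding riemannian_metric_def by auto
  have "w \<bullet> (metric_comp A g c x *v w) > 0" if "w \<noteq> 0" for w
  proof -
    define v where "v = (\<lambda>d. \<Sum>i\<in>UNIV. (w $ i) *\<^sub>R coord_vec A c x i d)"
    have v: "v \<in> tangent_space A x" and
      gv: "\<And>u. u \<in> tangent_space A x \<Longrightarrow> g x u v = (\<Sum>i\<in>UNIV. w $ i * g x u (coord_vec A c x i))"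
      using linear_on_tangent_sum[OF A lin, of _ UNIV "coord_vec A c x" "\<lambda>i. w $ i"] t
      unfolding v_def by auto
    have "v c = w"
      using basis_expansion[of w] c trans_deriv_id[OF A c]
      by (simp add: v_def coord_vec_def scalar_mult_eq_scaleR)
    hence "v \<noteq> (\<lambda>_. 0)" using \<open>w \<noteq> 0\<close> by auto
    hence "g x v v > 0" using g v unfolding riemannian_metric_def by auto
    also have "g x v v = (\<Sum>i\<in>UNIV. w $ i * (\<Sum>j\<in>UNIV. w $ j * g x (coord_vec A c x i) (coord_vec A c x j)))"
      unfolding gv[OF v] by (rule sum.cong[OF refl]) (simp add: sym[OF v t] gv[OF t])
    also have "\<dots> = w \<bullet> (metric_comp A g c x *v w)"
      by (simp add: inner_vec_def matrix_vector_mult_def metric_comp_def mult.commute)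
    finally show ?thesis .
  qed
  moreover have "transpose (metric_comp A g c x) = metric_comp A g c x"
    using sym[OF t t] by (simp add: metric_comp_def transpose_def vec_eq_iff)
  ultimately show ?thesis by (simp add: spd_def)
qed

lemma local_metric_chart:
  assumes g: "riemannian_metric 2 A g" and c: "c \<in> A"
  shows "local_metric (snd c ` fst c) (\<lambda>q. metric_comp A g c (inv_chart c q))"
proof
  show "open (snd c ` fst c)" by (rule chart_domain_open[OF c])
  show "mC1_on (snd c ` fst c) (\<lambda>q. metric_comp A g c (inv_chart c q))"
    using g c unfolding riemannian_metric_def mC1_on_def by (auto intro: higher_differentiable_2_C1)
  show "spd (metric_comp A g c (inv_chart c q))" if "q \<in> snd c ` fst c" for q
    using that chart_inv[OF c] metric_comp_spd[OF g c] by auto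
qed

text \<open>Every momentum occurs over every point of a chart, so the coordinate image of a set of
  full fibres is a product with the whole momentum space.\<close>

lemma covector_exists:
  assumes c: "c \<in> A" "x \<in> fst c"
  obtains z where "z \<in> cotangent_bundle A" "fst z = x" "covector_comp A c z = \<pi>"
proof
  define p where "p v = (if v \<in> tangent_space A x then \<pi> \<bullet> v c else 0)" for v :: "('m, 'n) tvec"
  have "p \<in> cotangent_space A x"
    unfolding cotangent_space_def linear_on_tangent_def
    by (auto simp: p_def tangent_lincomb[OF A] inner_add_right)
  thus "(x, p) \<in> cotangent_bundle A" by (simp add: cotangent_bundle_def)
  have cc: "coord_vec A c x i c = axis i 1" for i
    using c trans_deriv_id[OF A c, of "axis i 1"] by (simp add: coord_vec_def)
  show "covector_comp A c (x, p) = \<pi>"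
    by (simp add: covector_comp_def p_def coord_vec_tangent[OF A c] cc inner_axis)
qed simp

text \<open>Components determine a covector on the tangent space, and its extension by 0 fixes the
  remaining values. Hence \<open>inv_chart\<close> of the cotangent chart is a genuine
  inverse.\<close>

lemma cotangent_chart_inj:
  assumes c: "c \<in> A"
  shows "inj_on (snd (cotangent_chart A c)) (fst (cotangent_chart A c))"
proof (rule inj_onI)
  fix y z assume yz: "y \<in> fst (cotangent_chart A c)" "z \<in> fst (cotangent_chart A c)"
    "snd (cotangent_chart A c) y = snd (cotangent_chart A c) z"
  hence x: "fst y \<in> fst c" "fst z \<in> fst c" and e: "snd c (fst y) = snd c (fst z)"
    and comp: "covector_comp A c y = covector_comp A c z" by (auto simp: cotangent_chart_def)
  have fst: "fst y = fst z" using chart_inv[OF c x(1)] chart_inv[OF c x(2)] unfolding e by (rule trans[OF sym])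
  have co: "snd y \<in> cotangent_space A (fst y)" "snd z \<in> cotangent_space A (fst z)"
    using yz by (auto simp: cotangent_chart_def cotangent_bundle_def)
  have "snd y v = snd z v" for v
  proof (cases "v \<in> tangent_space A (fst y)")
    case True
    have lin: "linear_on_tangent A (fst y) (snd y)" "linear_on_tangent A (fst y) (snd z)"
      using co fst by (auto simp: cotangent_space_def)
    have "snd y (coord_vec A c (fst y) i) = snd z (coord_vec A c (fst y) i)" for i
      using comp fst by (simp add: covector_comp_def vec_eq_iff)
    thus ?thesis using linear_on_tangent_coord[OF A lin(1) c x(1) True] linear_on_tangent_coord[OF A lin(2) c x(1) True]
      by simp
  next
    case False
    thus ?thesis using co fst by (auto simp: cotangent_space_def)
  qed
  thus "y = z" using fst by (auto simp: prod_eq_iff)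
qed

end

section \<open>From the hypotheses on the manifold to a generic pair in each chart\<close>

locale commuting_metrics =
  fixes A :: "('m::{t2_space,second_countable_topology}, real^'n) chart set" and g h :: "('m, 'n) metric"
  assumes A: "smooth_atlas A" and g: "riemannian_metric 2 A g" and h: "riemannian_metric 2 A h"
    and independent: "functionally_independent_ae A CARD('n) (integral_I A g h)"
    and commute: "\<And>k l. k < CARD('n) \<Longrightarrow> l < CARD('n) \<Longrightarrow>
           poisson_commute A (integral_I A g h k) (integral_I A g h l)"
begin

context
  fixes c assumes c: "c \<in> A"
begin

abbreviation "U \<equiv> snd c ` fst c"
abbreviation "gq q \<equiv> metric_comp A g c (inv_chart c q)"
abbreviation "hq q \<equiv> metric_comp A h c (inv_chart c q)"
abbreviation "Kq k q \<equiv> K_mat (gq q) (hq q) k"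
abbreviation "\<kappa> \<equiv> cotangent_chart A c"

lemma two_metrics: "two_local_metrics U gq hq"
  unfolding two_local_metrics_def
  by (intro conjI local_metric_chart[OF A g c] local_metric_chart[OF A h c])

lemma point_of_coordinates:
  assumes "q \<in> U"
  obtains z where "z \<in> fst \<kappa>" "snd \<kappa> z = (q, \<pi>)"
proof -
  obtain x where x: "x \<in> fst c" "q = snd c x" using assms by auto
  obtain z where z: "z \<in> cotangent_bundle A" "fst z = x" "covector_comp A c z = \<pi>"
    by (rule covector_exists[OF A c x(1)])
  show thesis by (rule that[of z]) (use z x in \<open>auto simp: cotangent_chart_def\<close>)
qed

lemma local_rep_integral:
  assumes "q \<in> U"
  shows "local_rep \<kappa> (integral_I A g h k) (q, \<pi>) = \<pi> \<bullet> (Kq k q *v \<pi>)"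
proof -
  obtain z where z: "z \<in> fst \<kappa>" "snd \<kappa> z = (q, \<pi>)" by (rule point_of_coordinates[OF assms])
  hence z': "z \<in> cotangent_bundle A" "fst z \<in> fst c" "snd c (fst z) = q" "covector_comp A c z = \<pi>"
    by (auto simp: cotangent_chart_def)
  have "inv_chart \<kappa> (q, \<pi>) = z" using inv_into_f_f[OF cotangent_chart_inj[OF A c] z(1)] z(2) by simp
  hence "local_rep \<kappa> (integral_I A g h k) (q, \<pi>) = integral_I A g h k z" by (simp add: local_rep_def)
  also have "\<dots> = I_coord (metric_comp A g c (fst z)) (metric_comp A h c (fst z)) k \<pi>"
    using integral_I_eq[OF A g h z'(1) c z'(2), of k] z'(4) by simp
  also have "fst z = inv_chart c q" using chart_inv[OF A c z'(2)] z'(3) by simp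
  finally show ?thesis by (simp add: I_coord_eq K_mat_def)
qed

definition "dq k q \<pi> = (\<chi> i. \<pi> \<bullet> (mderiv (Kq k) q (axis i 1) *v \<pi>))"

lemma dq_dot:
  assumes "q \<in> U"
  shows "dq k q \<pi> \<bullet> a = \<pi> \<bullet> (mderiv (Kq k) q a *v \<pi>)"
proof -
  interpret two_local_metrics U gq hq by (rule two_metrics)
  have lin: "linear (mderiv (Kq k) q)" by (rule linear_mderiv[OF C1_K assms])
  have "linear (\<lambda>a. \<pi> \<bullet> (mderiv (Kq k) q a *v \<pi>))"
    using lin unfolding linear_iff
    by (simp add: matrix_vector_mult_add_rdistrib inner_add_right scaleR_matrix_vector_assoc[symmetric])
  note L = linear_sum[OF this] linear_scale[OF this]
  have "\<pi> \<bullet> (mderiv (Kq k) q a *v \<pi>) = \<pi> \<bullet> (mderiv (Kq k) q (\<Sum>i\<in>UNIV. (a $ i) *\<^sub>R axis i 1) *v \<pi>)"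
    using basis_expansion[of a] by (simp add: scalar_mult_eq_scaleR)
  also have "\<dots> = (\<Sum>i\<in>UNIV. a $ i * (\<pi> \<bullet> (mderiv (Kq k) q (axis i 1) *v \<pi>)))" by (simp add: L)
  also have "\<dots> = dq k q \<pi> \<bullet> a" unfolding inner_vec_def[of "dq k q \<pi>"] by (simp add: dq_def mult.commute)
  finally show ?thesis by simp
qed

lemma integral_derivative:
  assumes q: "q \<in> U"
  shows "(local_rep \<kappa> (integral_I A g h k) has_derivative
     (\<lambda>w. dq k q \<pi> \<bullet> fst w + (2 *\<^sub>R (Kq k q *v \<pi>)) \<bullet> snd w)) (at (q, \<pi>))"
proof -
  interpret two_local_metrics U gq hq by (rule two_metrics)
  have sym: "transpose (Kq k q) = Kq k q"
    using spd_pair.K_symmetric[OF pair[OF q]] spd_pair.eigenbasis_exists[OF pair[OF q]] by metis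
  have dK: "((\<lambda>\<zeta>. Kq k (fst \<zeta>)) has_derivative (\<lambda>w. mderiv (Kq k) q (fst w))) (at (q, \<pi>))"
    by (rule has_derivative_compose[OF has_derivative_fst[OF has_derivative_ident]])
      (use mderiv_has_derivative[OF C1_K q] in simp)
  have "((\<lambda>\<zeta>. snd \<zeta> \<bullet> (Kq k (fst \<zeta>) *v snd \<zeta>)) has_derivative
     (\<lambda>w. snd (q, \<pi>) \<bullet> (Kq k (fst (q, \<pi>)) *v snd w + mderiv (Kq k) q (fst w) *v snd (q, \<pi>)) +
        snd w \<bullet> (Kq k (fst (q, \<pi>)) *v snd (q, \<pi>)))) (at (q, \<pi>))"
    by (intro has_derivative_inner bounded_bilinear.FDERIV[OF bounded_bilinear_matrix_vector_mult] dK
        has_derivative_snd has_derivative_ident)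
  moreover have "snd (q, \<pi>) \<bullet> (Kq k (fst (q, \<pi>)) *v snd w + mderiv (Kq k) q (fst w) *v snd (q, \<pi>)) +
        snd w \<bullet> (Kq k (fst (q, \<pi>)) *v snd (q, \<pi>)) = dq k q \<pi> \<bullet> fst w + (2 *\<^sub>R (Kq k q *v \<pi>)) \<bullet> snd w" for w
    unfolding dq_dot[OF q] using symmetric_dot[OF sym, of \<pi> "snd w"]
    by (simp add: inner_add_right inner_commute[of "Kq k q *v \<pi>"])
  ultimately have D: "((\<lambda>\<zeta>. snd \<zeta> \<bullet> (Kq k (fst \<zeta>) *v snd \<zeta>)) has_derivative
     (\<lambda>w. dq k q \<pi> \<bullet> fst w + (2 *\<^sub>R (Kq k q *v \<pi>)) \<bullet> snd w)) (at (q, \<pi>))" by simp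
  show ?thesis
    by (rule has_derivative_transform_within_open[OF D, of "U \<times> UNIV"])
      (use q local_rep_integral G.U in \<open>auto intro: open_Times\<close>)
qed

lemma local_poisson:
  assumes q: "q \<in> U" and kl: "k < CARD('n)" "l < CARD('n)"
  shows "\<pi> \<bullet> (mderiv (Kq k) q (Kq l q *v \<pi>) *v \<pi>) = \<pi> \<bullet> (mderiv (Kq l) q (Kq k q *v \<pi>) *v \<pi>)"
proof -
  obtain z where z: "z \<in> fst \<kappa>" "snd \<kappa> z = (q, \<pi>)" by (rule point_of_coordinates[OF q])
  have "poisson_bracket \<kappa> (integral_I A g h k) (integral_I A g h l) z = 0"
    using commute[OF kl] z(1) c unfolding poisson_commute_def by blast
  hence "dq k q \<pi> \<bullet> (Kq l q *v \<pi>) = dq l q \<pi> \<bullet> (Kq k q *v \<pi>)"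
    unfolding poisson_bracket_def z(2) hamiltonian_vector_eq[OF integral_derivative[OF q]]
    by (simp add: standard_symplectic_def)
  thus ?thesis unfolding dq_dot[OF q] .
qed

text \<open>A failure of \<open>generic\<close> on \<open>W\<close> makes the differentials
  dependent over all of \<open>W \<times> UNIV\<close>, a nonempty open set, which cannot be
  negligible.\<close>

lemma generic_pair: "generic_metric_pair U gq hq"
proof -
  interpret two_local_metrics U gq hq by (rule two_metrics)
  show ?thesis
  proof
    show "p \<bullet> (mderiv (Kq k) q (Kq l q *v p) *v p) = p \<bullet> (mderiv (Kq l) q (Kq k q *v p) *v p)"
      if "q \<in> U" "k < CARD('n)" "l < CARD('n)" for q k l p
      by (rule local_poisson[OF that])
    fix W assume W: "open W" "W \<noteq> {}" "W \<subseteq> U"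
    show "\<exists>q\<in>W. \<forall>t. \<not> (pencil (gq q) (hq q) t = 0 \<and> (\<forall>u. (\<Sum>k<CARD('n). t ^ k *\<^sub>R mderiv (Kq k) q u) = 0))"
    proof (rule ccontr)
      assume "\<not> ?thesis"
      hence deg: "\<exists>t. pencil (gq q) (hq q) t = 0 \<and> (\<forall>u. (\<Sum>k<CARD('n). t ^ k *\<^sub>R mderiv (Kq k) q u) = 0)"
        if "q \<in> W" for q using that by blast
      let ?bad = "{z \<in> cotangent_bundle A. \<not> independent_differentials_at A CARD('n) (integral_I A g h) z}"
      have "W \<times> UNIV \<subseteq> snd \<kappa> ` (?bad \<inter> fst \<kappa>)"
      proof
        fix \<zeta> :: "(real^'n) \<times> (real^'n)" assume "\<zeta> \<in> W \<times> UNIV"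
        then obtain q \<pi> where q: "\<zeta> = (q, \<pi>)" "q \<in> W" by (cases \<zeta>) auto
        hence qU: "q \<in> U" using W(3) by auto
        obtain z where z: "z \<in> fst \<kappa>" "snd \<kappa> z = (q, \<pi>)" by (rule point_of_coordinates[OF qU])
        obtain t where t: "pencil (gq q) (hq q) t = 0" "\<And>u. (\<Sum>k<CARD('n). t ^ k *\<^sub>R mderiv (Kq k) q u) = 0"
          using deg[OF q(2)] by blast
        have D: "frechet_derivative (local_rep \<kappa> (integral_I A g h k)) (at (snd \<kappa> z)) =
            (\<lambda>w. dq k q \<pi> \<bullet> fst w + (2 *\<^sub>R (Kq k q *v \<pi>)) \<bullet> snd w)" for k
          unfolding z(2) by (rule frechet_derivative_at[OF integral_derivative[OF qU], symmetric])
        have "(\<Sum>k<CARD('n). t ^ k * frechet_derivative (local_rep \<kappa> (integral_I A g h k)) (at (snd \<kappa> z)) w) = 0" for w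
        proof -
          have "(\<Sum>k<CARD('n). t ^ k * (dq k q \<pi> \<bullet> fst w)) =
              \<pi> \<bullet> ((\<Sum>k<CARD('n). t ^ k *\<^sub>R mderiv (Kq k) q (fst w)) *v \<pi>)"
            by (simp add: dq_dot[OF qU] sum_matrix_vector inner_sum_right scaleR_matrix_vector_assoc[symmetric])
          hence 1: "(\<Sum>k<CARD('n). t ^ k * (dq k q \<pi> \<bullet> fst w)) = 0" unfolding t(2) by simp
          have "(\<Sum>k<CARD('n). t ^ k * ((2 *\<^sub>R (Kq k q *v \<pi>)) \<bullet> snd w)) =
              2 * ((pencil (gq q) (hq q) t *v \<pi>) \<bullet> snd w)"
            unfolding pencil_def by (simp add: sum_matrix_vector inner_sum_left sum_distrib_left
                scaleR_matrix_vector_assoc[symmetric] mult_ac)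
          hence 2: "(\<Sum>k<CARD('n). t ^ k * ((2 *\<^sub>R (Kq k q *v \<pi>)) \<bullet> snd w)) = 0" unfolding t(1) by simp
          show ?thesis unfolding D distrib_left sum.distrib 1 2 by simp
        qed
        hence S: "\<forall>w. (\<Sum>k<CARD('n). t ^ k * frechet_derivative (local_rep \<kappa> (integral_I A g h k)) (at (snd \<kappa> z)) w) = 0"
          by blast
        have "\<not> independent_differentials_at A CARD('n) (integral_I A g h) z"
        proof
          assume "independent_differentials_at A CARD('n) (integral_I A g h) z"
          moreover have "fst z \<in> fst c" using z(1) by (simp add: cotangent_chart_def)
          ultimately have "\<forall>a :: nat \<Rightarrow> real.
              (\<forall>w. (\<Sum>k<CARD('n). a k * frechet_derivative (local_rep \<kappa> (integral_I A g h k)) (at (snd \<kappa> z)) w) = 0) \<longrightarrow>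
              (\<forall>k<CARD('n). a k = 0)"
            using c unfolding independent_differentials_at_def Let_def by blast
          \<comment> \<open>The relation is nontrivial even for t = 0, since the coefficient at k =
            0 is 1.\<close>
          hence "\<forall>k<CARD('n). t ^ k = 0" by (rule mp[OF spec[of _ "\<lambda>k. t ^ k"]]) (rule S)
          thus False by (metis power_0 zero_less_card_finite zero_neq_one)
        qed
        hence "z \<in> ?bad \<inter> fst \<kappa>" using z(1) by (auto simp: cotangent_chart_def)
        thus "\<zeta> \<in> snd \<kappa> ` (?bad \<inter> fst \<kappa>)" using z(2) q(1) by force
      qed
      moreover have "negligible (snd \<kappa> ` (?bad \<inter> fst \<kappa>))"
        using independent c unfolding functionally_independent_ae_def cotangent_null_def by blast
      ultimately have "negligible (W \<times> (UNIV :: (real^'n) set))" by (rule negligible_subset[rotated])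
      moreover have "open (W \<times> (UNIV :: (real^'n) set))" "W \<times> (UNIV :: (real^'n) set) \<noteq> {}"
        using W by (auto intro: open_Times)
      ultimately show False using open_not_negligible by blast
    qed
  qed
qed

lemma christoffel_eq_local:
  assumes "riemannian_metric 2 A b" "x \<in> fst c"
  shows "christoffel A b c x k i j = local_christoffel (\<lambda>q. metric_comp A b c (inv_chart c q)) (snd c x) k i j"
  using chart_inv[OF A c assms(2)]
  by (simp add: christoffel_def metric_partial_def local_christoffel_def mderiv_def)

definition "weight q = det_weight (gq q) (hq q)"

lemma C1_weight: "C1_on U weight" and weight_pos: "q \<in> U \<Longrightarrow> weight q > 0"
proof -
  interpret two_local_metrics U gq hq by (rule two_metrics)
  show "C1_on U weight" unfolding weight_def[abs_def] by (rule C1_w)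
  show "q \<in> U \<Longrightarrow> weight q > 0" unfolding weight_def by (rule omega_pos)
qed

lemma christoffel_difference:
  assumes "x \<in> fst c"
  shows "2 * weight (snd c x) * (christoffel A h c x k i j - christoffel A g c x k i j) =
    - ((if k = j then frechet_derivative weight (at (snd c x)) (axis i 1) else 0) +
       (if k = i then frechet_derivative weight (at (snd c x)) (axis j 1) else 0))"
proof -
  interpret generic_metric_pair U gq hq by (rule generic_pair)
  show ?thesis
    unfolding christoffel_eq_local[OF g assms] christoffel_eq_local[OF h assms] weight_def[abs_def]
    by (rule christoffel_relation) (use assms in simp)
qed

end

text \<open>A change of chart multiplies both determinants by the square of the Jacobian
  determinant, so their quotient is a function on the manifold.\<close>

lemma weight_change:
  assumes c: "c \<in> A" "x \<in> fst c" and d: "d \<in> A" "x \<in> fst d"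
  shows "weight c (snd c x) = weight d (snd d x)"
proof -
  have "jacobian_matrix c d x ** jacobian_matrix d c x = mat 1" by (rule jacobian_inverse[OF A c d])
  hence "det (jacobian_matrix c d x) \<noteq> 0" by (metis det_I det_mul mult_zero_left zero_neq_one)
  thus ?thesis
    unfolding weight_def[OF c(1)] weight_def[OF d(1)] chart_inv[OF A c] chart_inv[OF A d] det_weight_def
      metric_comp_change[OF A g c d] metric_comp_change[OF A h c d]
    by (simp add: det_mul det_transpose)
qed

end


section \<open>Reparametrization of geodesics\<close>

lemma real_C2:
  fixes f :: "real \<Rightarrow> real"
  assumes J: "open J" and f: "\<And>s. s \<in> J \<Longrightarrow> (f has_real_derivative f1 s) (at s)"
    and f1: "\<And>s. s \<in> J \<Longrightarrow> (f1 has_real_derivative f2 s) (at s)" and f2: "continuous_on J f2"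
  shows "higher_differentiable_on 2 J f"
proof -
  have D1: "frechet_derivative f (at s) v = f1 s * v" if "s \<in> J" for s v
    using frechet_derivative_at[OF f[OF that, unfolded has_field_derivative_def]] by metis
  have D2: "((\<lambda>s. frechet_derivative f (at s) v) has_derivative (\<lambda>u. f2 s * u * v)) (at s)" if "s \<in> J" for s v
  proof (rule has_derivative_transform_within_open[OF _ J that])
    show "((\<lambda>s. f1 s * v) has_derivative (\<lambda>u. f2 s * u * v)) (at s)"
      by (intro has_derivative_mult_left f1[OF that, unfolded has_field_derivative_def])
  qed (simp add: D1)
  have "continuous_on J (\<lambda>s. frechet_derivative (\<lambda>s. frechet_derivative f (at s) v) (at s) u)" for u v
  proof -
    have "frechet_derivative (\<lambda>s. frechet_derivative f (at s) v) (at s) u = f2 s * u * v" if "s \<in> J" for s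
      using frechet_derivative_at[OF D2[OF that]] by metis
    hence "continuous_on J (\<lambda>s. frechet_derivative (\<lambda>s. frechet_derivative f (at s) v) (at s) u)
       \<longleftrightarrow> continuous_on J (\<lambda>s. f2 s * u * v)" by (intro continuous_on_cong) auto
    thus ?thesis using f2 by (auto intro!: continuous_intros)
  qed
  moreover have "f differentiable at s" if "s \<in> J" for s
    using f[OF that] unfolding has_field_derivative_def by (rule differentiableI)
  moreover have "(\<lambda>s. frechet_derivative f (at s) v) differentiable at s" if "s \<in> J" for s v
    using D2[OF that] by (rule differentiableI)
  ultimately show ?thesis by (simp add: numeral_2_eq_2)
qed

text \<open>The interval may be unbounded, hence endpoints in the extended reals.\<close>

lemma open_interval_antiderivative:
  fixes r :: "real \<Rightarrow> real"
  assumes I: "open_interval I" and r: "\<And>t. t \<in> I \<Longrightarrow> isCont r t"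
  obtains \<sigma> where "\<And>t. t \<in> I \<Longrightarrow> (\<sigma> has_real_derivative r t) (at t)"
proof -
  have oI: "open I" and iI: "is_interval I" and "I \<noteq> {}" using I by (auto simp: open_interval_def)
  define a where "a = Inf (ereal ` I)"
  define b where "b = Sup (ereal ` I)"
  have strict: "a < ereal t \<and> ereal t < b" if t: "t \<in> I" for t
  proof -
    obtain e where e: "e > 0" "cball t e \<subseteq> I" using oI t open_contains_cball by blast
    hence "t - e \<in> I" "t + e \<in> I" by (auto simp: cball_def dist_real_def)
    hence "a \<le> ereal (t - e)" "ereal (t + e) \<le> b" unfolding a_def b_def by (auto intro: Inf_lower Sup_upper)
    moreover have "ereal (t - e) < ereal t" "ereal t < ereal (t + e)" using e(1) by auto
    ultimately show ?thesis by (meson le_less_trans less_le_trans)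
  qed
  have mem: "t \<in> I" if lo: "a < ereal t" and up: "ereal t < b" for t
  proof -
    obtain s where s: "s \<in> I" "ereal s < ereal t" using lo unfolding a_def Inf_less_iff by auto
    obtain u where u: "u \<in> I" "ereal t < ereal u" using up unfolding b_def less_Sup_iff by auto
    show ?thesis by (rule mem_is_interval_1_I[OF iI s(1) u(1)]) (use s u in auto)
  qed
  have "a < b" using strict \<open>I \<noteq> {}\<close> by (meson ex_in_conv less_trans)
  from einterval_antiderivative[OF this, of r] obtain F
    where F: "\<And>x. a < ereal x \<Longrightarrow> ereal x < b \<Longrightarrow> (F has_vector_derivative r x) (at x)"
    using r mem by blast
  show thesis
  proof (rule that)
    show "(F has_real_derivative r t) (at t)" if "t \<in> I" for t
      using F[of t] strict[OF that] by (simp add: has_real_derivative_iff_has_vector_derivative)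
  qed
qed

context
  fixes A :: "('m::{t2_space,second_countable_topology}, real^'n) chart set"
    and g h :: "('m, 'n) metric" and \<rho> :: "'m \<Rightarrow> real"
  assumes A: "smooth_atlas A"
    and \<rho>_pos: "\<And>x. \<rho> x > 0"
    and \<rho>_C1: "\<And>c. c \<in> A \<Longrightarrow> C1_on (snd c ` fst c) (\<lambda>q. \<rho> (inv_chart c q))"
    and christoffel_shift: "\<And>c x k i j. c \<in> A \<Longrightarrow> x \<in> fst c \<Longrightarrow>
      2 * \<rho> x * (christoffel A h c x k i j - christoffel A g c x k i j) =
        (if k = j then frechet_derivative (\<lambda>q. \<rho> (inv_chart c q)) (at (snd c x)) (axis i 1) else 0) +
        (if k = i then frechet_derivative (\<lambda>q. \<rho> (inv_chart c q)) (at (snd c x)) (axis j 1) else 0)"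
begin

definition "acceleration b c x v = (\<chi> k. - (\<Sum>i\<in>UNIV. \<Sum>j\<in>UNIV. christoffel A b c x k i j * v $ i * v $ j))"
  for b :: "('m, 'n) metric" and v :: "real^'n"

text \<open>Contracted twice with v, the two Kronecker terms give the same contribution d\<rho>(v)
  v, and the factor 2 on the left cancels. The two accelerations thus differ by a multiple of the
  velocity.\<close>

lemma acceleration_shift:
  assumes "c \<in> A" "x \<in> fst c"
  shows "acceleration h c x v = acceleration g c x v -
    (frechet_derivative (\<lambda>q. \<rho> (inv_chart c q)) (at (snd c x)) v / \<rho> x) *\<^sub>R v"
proof -
  let ?D = "frechet_derivative (\<lambda>q. \<rho> (inv_chart c q)) (at (snd c x))"
  have "linear ?D"
    by (rule has_derivative_linear[OF C1_on_derivative[OF \<rho>_C1[OF assms(1)]]]) (use assms in simp)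
  note L = linear_sum[OF this] linear_scale[OF this]
  have "?D v = ?D (\<Sum>i\<in>UNIV. (v $ i) *\<^sub>R axis i 1)"
    using basis_expansion[of v] by (simp add: scalar_mult_eq_scaleR)
  hence Dv: "?D v = (\<Sum>i\<in>UNIV. v $ i * ?D (axis i 1))" by (simp add: L)
  have "acceleration h c x v $ k = (acceleration g c x v - (?D v / \<rho> x) *\<^sub>R v) $ k" for k
  proof -
    have \<rho>: "\<rho> x \<noteq> 0" using \<rho>_pos[of x] by simp
    have "2 * \<rho> x * (acceleration g c x v $ k - acceleration h c x v $ k) =
        (\<Sum>i\<in>UNIV. \<Sum>j\<in>UNIV. 2 * \<rho> x * (christoffel A h c x k i j - christoffel A g c x k i j) * (v $ i * v $ j))"
      by (simp add: acceleration_def sum_distrib_left sum_subtractf algebra_simps)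
    also have "\<dots> = (\<Sum>i\<in>UNIV. \<Sum>j\<in>UNIV. (if k = j then ?D (axis i 1) * (v $ i * v $ j) else 0)) +
       (\<Sum>i\<in>UNIV. \<Sum>j\<in>UNIV. (if k = i then ?D (axis j 1) * (v $ i * v $ j) else 0))"
      unfolding christoffel_shift[OF assms] sum.distrib[symmetric]
      by (intro sum.cong refl) (simp add: algebra_simps)
    also have "(\<Sum>i\<in>UNIV. \<Sum>j\<in>UNIV. (if k = i then ?D (axis j 1) * (v $ i * v $ j) else 0)) =
       (\<Sum>i\<in>UNIV. \<Sum>j\<in>UNIV. (if k = j then ?D (axis i 1) * (v $ i * v $ j) else 0))"
      by (subst sum.swap) (simp add: mult.commute)
    also have "(\<Sum>i\<in>UNIV. \<Sum>j\<in>UNIV. (if k = j then ?D (axis i 1) * (v $ i * v $ j) else 0)) = ?D v * v $ k"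
      by (simp add: Dv sum_distrib_left mult_ac)
    finally have "\<rho> x * (acceleration g c x v $ k - acceleration h c x v $ k) = ?D v * v $ k" by simp
    thus ?thesis using \<rho> by (simp add: field_simps)
  qed
  thus ?thesis by (simp add: vec_eq_iff)
qed

text \<open>If \<open>\<sigma>\<close> is an antiderivative of \<open>\<rho>\<close> along a \<open>g\<close>-geodesic, then \<open>\<sigma>\<close> is an affine parameter of the
  same curve regarded as an \<open>h\<close>-geodesic.\<close>

lemma geodesic_reparametrization:
  assumes I: "open_interval I" and \<gamma>: "geodesic A g I \<gamma>"
  shows "\<exists>J \<delta>. open_interval J \<and> geodesic A h J \<delta> \<and> same_unparametrized I \<gamma> J \<delta>"
proof -
  have oI: "open I" and iI: "is_interval I" and neI: "I \<noteq> {}" using I by (auto simp: open_interval_def)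
  have \<gamma>c: "continuous_on I \<gamma>" using \<gamma> by (simp add: geodesic_def)
  have "\<forall>c. \<exists>v. c \<in> A \<longrightarrow> (\<forall>t\<in>I. \<gamma> t \<in> fst c \<longrightarrow>
      ((\<lambda>s. snd c (\<gamma> s)) has_vector_derivative v t) (at t) \<and>
      (v has_vector_derivative acceleration g c (\<gamma> t) (v t)) (at t))"
    using \<gamma> unfolding geodesic_def acceleration_def by blast
  from choice[OF this] obtain V where V: "\<And>c t. c \<in> A \<Longrightarrow> t \<in> I \<Longrightarrow> \<gamma> t \<in> fst c \<Longrightarrow>
      ((\<lambda>s. snd c (\<gamma> s)) has_vector_derivative V c t) (at t) \<and>
      (V c has_vector_derivative acceleration g c (\<gamma> t) (V c t)) (at t)"
    by blast
  define Ic where "Ic c = I \<inter> \<gamma> -` fst c" for c :: "('m, real^'n) chart"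
  have oIc: "open (Ic c)" if "c \<in> A" for c
    unfolding Ic_def using chart_domain_open(1)[OF A that] by (intro continuous_open_preimage \<gamma>c oI)
  have cover: "\<exists>c\<in>A. t \<in> Ic c" if "t \<in> I" for t
    using A that unfolding smooth_atlas_def Ic_def by blast
  define r where "r t = \<rho> (\<gamma> t)" for t
  define D where "D c t = frechet_derivative (\<lambda>q. \<rho> (inv_chart c q)) (at (snd c (\<gamma> t))) (V c t)" for c t
  have r_pos: "r t > 0" for t by (simp add: r_def \<rho>_pos)
  have r_deriv: "(r has_real_derivative D c t) (at t)" if c: "c \<in> A" and t: "t \<in> Ic c" for c t
  proof -
    have q: "snd c (\<gamma> t) \<in> snd c ` fst c" using t by (simp add: Ic_def)
    have "((\<lambda>q. \<rho> (inv_chart c q)) \<circ> (\<lambda>s. snd c (\<gamma> s)) has_derivative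
        frechet_derivative (\<lambda>q. \<rho> (inv_chart c q)) (at (snd c (\<gamma> t))) \<circ> (\<lambda>u. u *\<^sub>R V c t)) (at t)"
      using V[OF c, of t] t C1_on_derivative[OF \<rho>_C1[OF c] q]
      by (intro diff_chain_at) (auto simp: has_vector_derivative_def Ic_def)
    moreover have "linear (frechet_derivative (\<lambda>q. \<rho> (inv_chart c q)) (at (snd c (\<gamma> t))))"
      by (rule has_derivative_linear[OF C1_on_derivative[OF \<rho>_C1[OF c] q]])
    ultimately have "((\<lambda>s. \<rho> (inv_chart c (snd c (\<gamma> s)))) has_derivative (\<lambda>u. D c t * u)) (at t)"
      by (simp add: o_def D_def linear_scale mult.commute)
    hence "(r has_derivative (\<lambda>u. D c t * u)) (at t)"
      by (rule has_derivative_transform_within_open[OF _ oIc[OF c] t])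
        (simp add: r_def Ic_def chart_inv[OF A c])
    thus ?thesis by (simp add: has_field_derivative_def)
  qed
  \<comment> \<open>Defined without a chart, so that it is one function on all of \<open>I\<close>;
    its continuity is then checked through the local expression \<open>D c\<close>.\<close>
  define r1 where "r1 = deriv r"
  have r1_eq: "r1 t = D c t" if "c \<in> A" "t \<in> Ic c" for c t
    unfolding r1_def by (rule DERIV_imp_deriv[OF r_deriv[OF that]])
  have r1: "(r has_real_derivative r1 t) (at t)" if "t \<in> I" for t
    using cover[OF that] r_deriv r1_eq by fastforce
  have r1_cont: "continuous_on I r1"
  proof (rule continuous_at_imp_continuous_on, rule ballI)
    fix t assume "t \<in> I"
    then obtain c where c: "c \<in> A" "t \<in> Ic c" using cover by blast
    have Vc: "continuous_on (Ic c) (V c)" and xc: "continuous_on (Ic c) (\<lambda>s. snd c (\<gamma> s))"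
      using V[OF c(1)] unfolding Ic_def
      by (auto intro!: continuous_at_imp_continuous_on dest!: has_vector_derivative_continuous)
    have exp: "D c s = (\<Sum>i\<in>UNIV. V c s $ i * frechet_derivative (\<lambda>q. \<rho> (inv_chart c q)) (at (snd c (\<gamma> s))) (axis i 1))"
      if "s \<in> Ic c" for s
    proof -
      have "snd c (\<gamma> s) \<in> snd c ` fst c" using that by (simp add: Ic_def)
      note lin = has_derivative_linear[OF C1_on_derivative[OF \<rho>_C1[OF c(1)] this]]
      have "D c s = frechet_derivative (\<lambda>q. \<rho> (inv_chart c q)) (at (snd c (\<gamma> s))) (\<Sum>i\<in>UNIV. (V c s $ i) *\<^sub>R axis i 1)"
        using basis_expansion[of "V c s"] by (simp add: scalar_mult_eq_scaleR D_def)
      thus ?thesis by (simp add: linear_sum[OF lin] linear_scale[OF lin])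
    qed
    have "continuous_on (Ic c) (\<lambda>s. \<Sum>i\<in>UNIV. V c s $ i * frechet_derivative (\<lambda>q. \<rho> (inv_chart c q)) (at (snd c (\<gamma> s))) (axis i 1))"
      by (intro continuous_intros Vc continuous_on_compose2[OF C1_on_derivative_continuous[OF \<rho>_C1[OF c(1)]] xc])
        (auto simp: Ic_def)
    hence "continuous_on (Ic c) r1"
      by (rule continuous_on_cong[THEN iffD1, rotated -1]) (auto simp: r1_eq[OF c(1)] exp)
    thus "isCont r1 t" using oIc[OF c(1)] c(2) continuous_on_eq_continuous_at by blast
  qed
  have "isCont r t" if "t \<in> I" for t using r1[OF that] by (rule DERIV_isCont)
  from open_interval_antiderivative[OF I this]
  obtain \<sigma> where \<sigma>: "\<And>t. t \<in> I \<Longrightarrow> (\<sigma> has_real_derivative r t) (at t)" by blast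
  have \<sigma>_mono: "\<sigma> s < \<sigma> t" if "s \<in> I" "t \<in> I" "s < t" for s t
  proof (rule DERIV_pos_imp_increasing[OF that(3)])
    fix x assume "s \<le> x" "x \<le> t"
    hence "x \<in> I" using mem_is_interval_1_I[OF iI that(1,2)] by blast
    thus "\<exists>y. (\<sigma> has_real_derivative y) (at x) \<and> 0 < y" using \<sigma> r_pos by blast
  qed
  have inj: "inj_on \<sigma> I"
    by (rule linorder_inj_onI) (use \<sigma>_mono in force)+
  have \<sigma>_cont: "continuous_on I \<sigma>"
    using \<sigma> DERIV_isCont by (blast intro: continuous_at_imp_continuous_on)
  define J where "J = \<sigma> ` I"
  define \<tau> where "\<tau> = inv_into I \<sigma>"
  have \<tau>\<sigma>: "\<tau> (\<sigma> t) = t" if "t \<in> I" for t using inj that by (simp add: \<tau>_def)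
  have \<tau>I: "\<tau> s \<in> I" "\<sigma> (\<tau> s) = s" if "s \<in> J" for s
    using that by (auto simp: J_def \<tau>\<sigma>)
  have oJ: "open J" unfolding J_def by (rule invariance_of_domain[OF \<sigma>_cont oI inj])
  have "is_interval J" unfolding J_def is_interval_connected_1
    by (intro connected_continuous_image \<sigma>_cont) (use iI is_interval_connected_1 in blast)
  hence J: "open_interval J" using oJ neI by (simp add: open_interval_def J_def)
  have bij: "bij_betw \<tau> J I"
    unfolding J_def \<tau>_def using inj by (simp add: bij_betw_inv_into inj_on_imp_bij_betw)
  define a where "a s = 1 / r (\<tau> s)" for s
  have \<tau>_deriv: "(\<tau> has_real_derivative a s) (at s)" if "s \<in> J" for s
  proof -
    have "(\<tau> has_derivative (\<lambda>u. a s * u)) (at (\<sigma> (\<tau> s)))"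
      by (rule has_derivative_inverse_strong[OF oI \<tau>I(1)[OF that] \<sigma>_cont \<tau>\<sigma>
            \<sigma>[OF \<tau>I(1)[OF that], unfolded has_field_derivative_def]])
        (use r_pos[of "\<tau> s"] in \<open>auto simp: a_def fun_eq_iff\<close>)
    thus ?thesis by (simp add: has_field_derivative_def \<tau>I(2)[OF that])
  qed
  \<comment> \<open>The second derivative of \<tau>, from differentiating 1 / r along
    \<tau>.\<close>
  define a1 where "a1 s = - (r1 (\<tau> s) / r (\<tau> s) ^ 3)" for s
  have a_deriv: "(a has_real_derivative a1 s) (at s)" if "s \<in> J" for s
  proof -
    have "((\<lambda>s. r (\<tau> s)) has_real_derivative r1 (\<tau> s) * a s) (at s)"
      by (rule DERIV_chain2[OF r1[OF \<tau>I(1)[OF that]] \<tau>_deriv[OF that]])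
    from DERIV_inverse_fun[OF this] r_pos[of "\<tau> s"]
    have "((\<lambda>s. inverse (r (\<tau> s))) has_real_derivative a1 s) (at s)"
      by (simp add: a_def a1_def field_simps power3_eq_cube power2_eq_square)
    thus ?thesis by (simp add: a_def[abs_def] divide_inverse)
  qed
  have \<tau>_cont: "continuous_on J \<tau>"
    using \<tau>_deriv DERIV_isCont by (blast intro: continuous_at_imp_continuous_on)
  have r_cont: "continuous_on I r"
    using r1 DERIV_isCont by (blast intro: continuous_at_imp_continuous_on)
  have "continuous_on J a1" unfolding a1_def
    by (intro continuous_intros continuous_on_compose2[OF r1_cont \<tau>_cont] continuous_on_compose2[OF r_cont \<tau>_cont])
      (use \<tau>I r_pos in \<open>auto simp: less_imp_neq[symmetric]\<close>)
  from real_C2[OF oJ \<tau>_deriv a_deriv this] have \<tau>2: "higher_differentiable_on 2 J \<tau>" .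
  have inv\<tau>: "inv_into J \<tau> t = \<sigma> t" if "t \<in> I" for t
  proof -
    have "inj_on \<tau> J" using bij by (simp add: bij_betw_def)
    from inv_into_f_f[OF this, of "\<sigma> t"] show ?thesis using that by (simp add: \<tau>\<sigma> J_def)
  qed
  have "(inv_into J \<tau> has_real_derivative r t) (at t)" if "t \<in> I" for t
    unfolding has_field_derivative_def
    by (rule has_derivative_transform_within_open[OF \<sigma>[OF that, unfolded has_field_derivative_def] oI that])
      (simp add: inv\<tau>)
  from real_C2[OF oI this r1 r1_cont] have \<sigma>2: "higher_differentiable_on 2 I (inv_into J \<tau>)" .
  have same: "same_unparametrized I \<gamma> J (\<gamma> \<circ> \<tau>)"
    unfolding same_unparametrized_def by (intro exI[of _ \<tau>]) (simp add: bij \<tau>2 \<sigma>2)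
  have "geodesic A h J (\<gamma> \<circ> \<tau>)"
    unfolding geodesic_def
  proof (intro conjI ballI)
    show "continuous_on J (\<gamma> \<circ> \<tau>)"
      by (rule continuous_on_compose[OF \<tau>_cont]) (use \<gamma>c bij in \<open>simp add: bij_betw_def\<close>)
    fix c assume c: "c \<in> A"
    show "\<exists>v. \<forall>t\<in>J. (\<gamma> \<circ> \<tau>) t \<in> fst c \<longrightarrow>
        ((\<lambda>s. snd c ((\<gamma> \<circ> \<tau>) s)) has_vector_derivative v t) (at t) \<and>
        (v has_vector_derivative
           (\<chi> k. - (\<Sum>i\<in>UNIV. \<Sum>j\<in>UNIV. christoffel A h c ((\<gamma> \<circ> \<tau>) t) k i j * v t $ i * v t $ j))) (at t)"
    proof (intro exI[of _ "\<lambda>s. a s *\<^sub>R V c (\<tau> s)"] ballI impI conjI)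
      fix s assume s: "s \<in> J" and "(\<gamma> \<circ> \<tau>) s \<in> fst c"
      hence x: "\<gamma> (\<tau> s) \<in> fst c" and tI: "\<tau> s \<in> Ic c" using \<tau>I by (auto simp: Ic_def)
      have d\<tau>: "(\<tau> has_vector_derivative a s) (at s)"
        using \<tau>_deriv[OF s] by (simp add: has_real_derivative_iff_has_vector_derivative)
      note VV = V[OF c \<tau>I(1)[OF s] x]
      show "((\<lambda>s. snd c ((\<gamma> \<circ> \<tau>) s)) has_vector_derivative a s *\<^sub>R V c (\<tau> s)) (at s)"
        using vector_diff_chain_at[OF d\<tau> conjunct1[OF VV]] by (simp add: o_def)
      let ?v = "V c (\<tau> s)"
      have "((\<lambda>s. a s *\<^sub>R V c (\<tau> s)) has_vector_derivative
          a s *\<^sub>R (a s *\<^sub>R acceleration g c (\<gamma> (\<tau> s)) ?v) + a1 s *\<^sub>R ?v) (at s)"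
        using has_vector_derivative_scaleR[OF a_deriv[OF s] vector_diff_chain_at[OF d\<tau> conjunct2[OF VV]]]
        by (simp add: o_def)
      \<comment> \<open>The term with \<open>a1\<close> is tangential and is exactly the correction
        in \<open>acceleration_shift\<close>; this is why \<sigma> has to integrate \<rho> along the
        curve.\<close>
      also have "a s *\<^sub>R (a s *\<^sub>R acceleration g c (\<gamma> (\<tau> s)) ?v) + a1 s *\<^sub>R ?v =
          (a s * a s) *\<^sub>R acceleration h c (\<gamma> (\<tau> s)) ?v"
      proof -
        have "r1 (\<tau> s) = D c (\<tau> s)" by (rule r1_eq[OF c tI])
        hence "a1 s = - (a s * a s * (D c (\<tau> s) / r (\<tau> s)))"
          by (simp add: a1_def a_def power3_eq_cube)
        thus ?thesis
          by (simp add: acceleration_shift[OF c x] D_def r_def scaleR_diff_right)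
      qed
      also have "\<dots> = acceleration h c (\<gamma> (\<tau> s)) (a s *\<^sub>R ?v)"
        by (simp add: acceleration_def vec_eq_iff sum_distrib_left mult_ac)
      finally show "((\<lambda>s. a s *\<^sub>R V c (\<tau> s)) has_vector_derivative
           (\<chi> k. - (\<Sum>i\<in>UNIV. \<Sum>j\<in>UNIV. christoffel A h c ((\<gamma> \<circ> \<tau>) s) k i j * (a s *\<^sub>R ?v) $ i * (a s *\<^sub>R ?v) $ j))) (at s)"
        by (simp only: acceleration_def o_apply)
    qed
  qed
  with J same show ?thesis by blast
qed

end

section \<open>The weight as a global function and the two directions of the equivalence\<close>

context commuting_metrics
begin

definition "global_weight x = (let c = (SOME c. c \<in> A \<and> x \<in> fst c) in weight c (snd c x))"

lemma global_weight_eq: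
  assumes c: "c \<in> A" "x \<in> fst c"
  shows "global_weight x = weight c (snd c x)"
proof -
  define d where "d = (SOME c. c \<in> A \<and> x \<in> fst c)"
  have d: "d \<in> A" "x \<in> fst d" using someI[of "\<lambda>c. c \<in> A \<and> x \<in> fst c" c] c by (auto simp: d_def)
  have "global_weight x = weight d (snd d x)" by (simp add: global_weight_def d_def Let_def)
  thus ?thesis using weight_change[OF d c] by simp
qed

lemma global_weight_inv: "c \<in> A \<Longrightarrow> q \<in> U c \<Longrightarrow> global_weight (inv_chart c q) = weight c q"
  by (erule imageE) (simp add: chart_inv[OF A] global_weight_eq del: split_paired_All)

lemma global_weight_pos: "global_weight x > 0"
proof -
  obtain c where c: "c \<in> A" "x \<in> fst c" using A unfolding smooth_atlas_def by blast
  show ?thesis unfolding global_weight_eq[OF c] by (rule weight_pos[OF c(1)]) (use c in simp)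
qed

lemma C1_global_weight: "c \<in> A \<Longrightarrow> C1_on (U c) (\<lambda>q. global_weight (inv_chart c q))"
  by (rule C1_on_cong[OF chart_domain_open(2)[OF A] _ C1_weight]) (simp_all only: global_weight_inv)

lemma christoffel_difference_global:
  assumes c: "c \<in> A" "x \<in> fst c"
  shows "2 * global_weight x * (christoffel A h c x k i j - christoffel A g c x k i j) =
    - ((if k = j then frechet_derivative (\<lambda>q. global_weight (inv_chart c q)) (at (snd c x)) (axis i 1) else 0) +
       (if k = i then frechet_derivative (\<lambda>q. global_weight (inv_chart c q)) (at (snd c x)) (axis j 1) else 0))"
proof -
  have q: "snd c x \<in> U c" using c by simp
  have "frechet_derivative (weight c) (at (snd c x)) =
      frechet_derivative (\<lambda>q. global_weight (inv_chart c q)) (at (snd c x))"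
  proof (rule frechet_derivative_transform_within_open[OF _ chart_domain_open(2)[OF A c(1)] q])
    show "weight c differentiable at (snd c x)" using C1_weight[OF c(1)] q unfolding C1_on_iff by blast
  qed (simp only: global_weight_inv[OF c(1)])
  thus ?thesis using christoffel_difference[OF c] by (simp add: global_weight_eq[OF c])
qed

text \<open>The reparametrization is applied with \<rho> = 1 / w from g to h and with \<rho> = w
  from h to g: exchanging the metrics changes the sign of the difference of Christoffel symbols, and
  so does replacing w by 1 / w in its logarithmic derivative.\<close>

lemma geodesic_equivalence: "geodesically_equivalent A g h"
proof -
  have dinv: "frechet_derivative (\<lambda>q. inverse (global_weight (inv_chart c q))) (at (snd c x)) v =
      - (frechet_derivative (\<lambda>q. global_weight (inv_chart c q)) (at (snd c x)) v / (global_weight x)^2)"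
    if c: "c \<in> A" "x \<in> fst c" for c x v
  proof -
    have "snd c x \<in> U c" using c by simp
    from has_derivative_compose[OF C1_on_derivative[OF C1_global_weight[OF c(1)] this]
        DERIV_inverse[unfolded has_field_derivative_def]]
    have "((\<lambda>q. inverse (global_weight (inv_chart c q))) has_derivative
        (\<lambda>v. - (inverse (global_weight x) ^ Suc (Suc 0)) *
           frechet_derivative (\<lambda>q. global_weight (inv_chart c q)) (at (snd c x)) v)) (at (snd c x))"
      using global_weight_pos[of x] chart_inv[OF A c] by simp
    from frechet_derivative_at[OF this, symmetric]
    show ?thesis by (simp add: divide_inverse power2_eq_square mult.commute)
  qed
  have "\<exists>J \<delta>. open_interval J \<and> geodesic A h J \<delta> \<and> same_unparametrized I \<gamma> J \<delta>"
    if "open_interval I" "geodesic A g I \<gamma>" for I \<gamma>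
  proof (rule geodesic_reparametrization[where \<rho>="\<lambda>x. inverse (global_weight x)", OF A _ _ _ that])
    fix c assume c: "c \<in> A"
    show "C1_on (U c) (\<lambda>q. inverse (global_weight (inv_chart c q)))"
      using global_weight_pos by (intro C1_on_inverse C1_global_weight c) (simp add: less_imp_neq[symmetric])
    fix x k i j assume x: "x \<in> fst c"
    have "2 * inverse (global_weight x) * (christoffel A h c x k i j - christoffel A g c x k i j) =
        (2 * global_weight x * (christoffel A h c x k i j - christoffel A g c x k i j)) / (global_weight x)^2"
      using global_weight_pos[of x] by (simp add: field_simps power2_eq_square)
    thus "2 * inverse (global_weight x) * (christoffel A h c x k i j - christoffel A g c x k i j) =
        (if k = j then frechet_derivative (\<lambda>q. inverse (global_weight (inv_chart c q))) (at (snd c x)) (axis i 1) else 0) +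
        (if k = i then frechet_derivative (\<lambda>q. inverse (global_weight (inv_chart c q))) (at (snd c x)) (axis j 1) else 0)"
      unfolding christoffel_difference_global[OF c x] dinv[OF c x] by (simp add: add_divide_distrib)
  qed (use global_weight_pos in simp)
  moreover have "\<exists>J \<delta>. open_interval J \<and> geodesic A g J \<delta> \<and> same_unparametrized I \<gamma> J \<delta>"
    if "open_interval I" "geodesic A h I \<gamma>" for I \<gamma>
  proof (rule geodesic_reparametrization[where \<rho>=global_weight, OF A global_weight_pos C1_global_weight _ that])
    fix c x k i j assume c: "c \<in> A" "x \<in> fst c"
    show "2 * global_weight x * (christoffel A g c x k i j - christoffel A h c x k i j) =
        (if k = j then frechet_derivative (\<lambda>q. global_weight (inv_chart c q)) (at (snd c x)) (axis i 1) else 0) +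
        (if k = i then frechet_derivative (\<lambda>q. global_weight (inv_chart c q)) (at (snd c x)) (axis j 1) else 0)"
      using christoffel_difference_global[OF c, of k i j] by (simp add: algebra_simps)
  qed
  ultimately show ?thesis unfolding geodesically_equivalent_def by blast
qed

end

theorem theorem6:
  fixes A :: "('m::{t2_space,second_countable_topology}, real^'n) chart set"
    and g h :: "('m, 'n) metric"
  assumes "smooth_atlas A"
    and "riemannian_metric 2 A g"
    and "riemannian_metric 2 A h"
    and "functionally_independent_ae A CARD('n) (integral_I A g h)"
    and "\<And>k l. k < CARD('n) \<Longrightarrow> l < CARD('n) \<Longrightarrow>
           poisson_commute A (integral_I A g h k) (integral_I A g h l)"
  shows "geodesically_equivalent A g h"
proof -
  interpret commuting_metrics A g h by unfold_locales (fact assms)+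
  show ?thesis by (rule geodesic_equivalence)
qed

end
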